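(* Let $k\ge2$ be a standard natural number. Over $\mathsf{RCA}_0$, $\mathsf{ATR}_0$ is equivalent to the following statement: for every Borel code $B$ for a subset of $(\omega)^k$, there is some point $x\in(\omega)^k$ such that $x\in B$ or $x\notin B$.
   Context: All definitions are made in $\mathsf{RCA}_0$. $(\omega)^k$ is the set of surjections $p:\omega\to\{0,\dots,k-1\}$ with $\min p^{-1}(i)<\min p^{-1}(j)$ whenever $i<j<k$; $(<\omega)^k$ is the set of finite strings $\sigma:r\to k$ ($r\in\omega$) with the same properties (surjective onto $k$ and ordered). For $\sigma\in(<\omega)^k$, $[\sigma]=\{p\in(\omega)^k:\sigma\prec p\}$. Let $L$ be a countable set of labels effectively coding the clopen sets $\emptyset$, $(\omega)^k$, $[\sigma]$ and $\overline{[\sigma]}$ for $\sigma\in(<\omega)^k$. A Borel code is a pair $(B,\varphi)$ where $B\subseteq\omega^{<\omega}$ is a well-founded tree and $\varphi$ is a labeling function on $B$ which labels each leaf by an element of $L$ and each interior node by $\cup$ or $\cap$. An evaluation map for $B$ at $x\in(\omega)^k$ is a function $f:B\to\{0,1\}$ such that (writing $\sigma n$ for the string $\sigma$ with the entry $n$ appended): for leaves $\sigma$, $f(\sigma)=1$ iff $x\in\varphi(\sigma)$; if $\varphi(\sigma)=\cup$, $f(\sigma)=1$ iff there is $n$ with $\sigma n\in B$ and $f(\sigma n)=1$; if $\varphi(\sigma)=\cap$, $f(\sigma)=1$ iff $f(\sigma n)=1$ for all $n$ with $\sigma n\in B$. "$x\in B$" means there exists an evaluation map for $B$ at $x$ with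 value $1$ at the root; "$x\notin B$" means there exists an evaluation map for $B$ at $x$ with value $0$ at the root. (So "$x\notin B$" is not the formal negation of "$x\in B$".) *)

theory Defs
  imports Main
begin

text \<open>
  Second order arithmetic and its (Henkin) structures, following Simpson,
  "Subsystems of Second Order Arithmetic".  The first order part of a structure is the whole
  type \<open>'a\<close> and may be nonstandard; set quantifiers range over the designated family of sets only.
  A statement about a subsystem is read as truth in all of its models.
\<close>

section \<open>Formulas\<close>

datatype trm = Var nat | Zero | One | Plus trm trm | Times trm trm

text \<open>In \<open>Mem t X\<close> and the set quantifiers, \<open>X\<close> is the index of a set variable; number
  variables and set variables are separate.\<close>

datatype fm =
    Eq trm trm | Less trm trm | Mem trm nat
  | Neg fm | Conj fm fm | Disj fm fm | Imp fm fm
  | AllN nat fm | ExN nat fm | AllS nat fm | ExS nat fm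

primrec tvars :: "trm \<Rightarrow> nat set" where
  "tvars (Var x) = {x}"
| "tvars Zero = {}"
| "tvars One = {}"
| "tvars (Plus t u) = tvars t \<union> tvars u"
| "tvars (Times t u) = tvars t \<union> tvars u"

inductive bounded_fm :: "fm \<Rightarrow> bool" where
  "bounded_fm (Eq t u)"
| "bounded_fm (Less t u)"
| "bounded_fm (Mem t X)"
| "bounded_fm \<phi> \<Longrightarrow> bounded_fm (Neg \<phi>)"
| "bounded_fm \<phi> \<Longrightarrow> bounded_fm \<psi> \<Longrightarrow> bounded_fm (Conj \<phi> \<psi>)"
| "bounded_fm \<phi> \<Longrightarrow> bounded_fm \<psi> \<Longrightarrow> bounded_fm (Disj \<phi> \<psi>)"
| "bounded_fm \<phi> \<Longrightarrow> bounded_fm \<psi> \<Longrightarrow> bounded_fm (Imp \<phi> \<psi>)"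
| "bounded_fm \<phi> \<Longrightarrow> x \<notin> tvars t \<Longrightarrow> bounded_fm (AllN x (Imp (Less (Var x) t) \<phi>))"
| "bounded_fm \<phi> \<Longrightarrow> x \<notin> tvars t \<Longrightarrow> bounded_fm (ExN x (Conj (Less (Var x) t) \<phi>))"

inductive Sigma01 :: "fm \<Rightarrow> bool" where
  "bounded_fm \<phi> \<Longrightarrow> Sigma01 (ExN x \<phi>)"

inductive Pi01 :: "fm \<Rightarrow> bool" where
  "bounded_fm \<phi> \<Longrightarrow> Pi01 (AllN x \<phi>)"

primrec arithmetical :: "fm \<Rightarrow> bool" where
  "arithmetical (Eq t u) = True"
| "arithmetical (Less t u) = True"
| "arithmetical (Mem t X) = True"
| "arithmetical (Neg \<phi>) = arithmetical \<phi>"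
| "arithmetical (Conj \<phi> \<psi>) = (arithmetical \<phi> \<and> arithmetical \<psi>)"
| "arithmetical (Disj \<phi> \<psi>) = (arithmetical \<phi> \<and> arithmetical \<psi>)"
| "arithmetical (Imp \<phi> \<psi>) = (arithmetical \<phi> \<and> arithmetical \<psi>)"
| "arithmetical (AllN x \<phi>) = arithmetical \<phi>"
| "arithmetical (ExN x \<phi>) = arithmetical \<phi>"
| "arithmetical (AllS X \<phi>) = False"
| "arithmetical (ExS X \<phi>) = False"

section \<open>Structures and satisfaction\<close>

record 'a l2 =
  l2_zero  :: 'a  ("\<zero>\<index>")
  l2_one   :: 'a  ("\<one>\<index>")
  l2_plus  :: "'a \<Rightarrow> 'a \<Rightarrow> 'a"  (infixl "\<oplus>\<index>" 65)
  l2_times :: "'a \<Rightarrow> 'a \<Rightarrow> 'a"  (infixl "\<otimes>\<index>" 70)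
  l2_less  :: "'a \<Rightarrow> 'a \<Rightarrow> bool"  (infix "\<prec>\<index>" 50)
  l2_sets  :: "'a set set"  ("\<S>\<index>")

locale l2_structure =
  fixes M :: "'a l2" (structure)
  assumes sets_nonempty: "\<S> \<noteq> {}"
begin

primrec tval :: "(nat \<Rightarrow> 'a) \<Rightarrow> trm \<Rightarrow> 'a" where
  "tval e (Var x) = e x"
| "tval e Zero = \<zero>"
| "tval e One = \<one>"
| "tval e (Plus t u) = tval e t \<oplus> tval e u"
| "tval e (Times t u) = tval e t \<otimes> tval e u"

primrec sat :: "(nat \<Rightarrow> 'a) \<Rightarrow> (nat \<Rightarrow> 'a set) \<Rightarrow> fm \<Rightarrow> bool" where
  "sat e s (Eq t u) = (tval e t = tval e u)"
| "sat e s (Less t u) = (tval e t \<prec> tval e u)"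
| "sat e s (Mem t X) = (tval e t \<in> s X)"
| "sat e s (Neg \<phi>) = (\<not> sat e s \<phi>)"
| "sat e s (Conj \<phi> \<psi>) = (sat e s \<phi> \<and> sat e s \<psi>)"
| "sat e s (Disj \<phi> \<psi>) = (sat e s \<phi> \<or> sat e s \<psi>)"
| "sat e s (Imp \<phi> \<psi>) = (sat e s \<phi> \<longrightarrow> sat e s \<psi>)"
| "sat e s (AllN x \<phi>) = (\<forall>a. sat (e(x := a)) s \<phi>)"
| "sat e s (ExN x \<phi>) = (\<exists>a. sat (e(x := a)) s \<phi>)"
| "sat e s (AllS X \<phi>) = (\<forall>A\<in>\<S>. sat e (s(X := A)) \<phi>)"
| "sat e s (ExS X \<phi>) = (\<exists>A\<in>\<S>. sat e (s(X := A)) \<phi>)"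

definition basic_axioms :: bool where
  "basic_axioms \<longleftrightarrow>
     (\<forall>n. n \<oplus> \<one> \<noteq> \<zero>) \<and>
     (\<forall>m n. m \<oplus> \<one> = n \<oplus> \<one> \<longrightarrow> m = n) \<and>
     (\<forall>m. m \<oplus> \<zero> = m) \<and>
     (\<forall>m n. m \<oplus> (n \<oplus> \<one>) = (m \<oplus> n) \<oplus> \<one>) \<and>
     (\<forall>m. m \<otimes> \<zero> = \<zero>) \<and>
     (\<forall>m n. m \<otimes> (n \<oplus> \<one>) = (m \<otimes> n) \<oplus> m) \<and>
     (\<forall>m. \<not> m \<prec> \<zero>) \<and>
     (\<forall>m n. m \<prec> n \<oplus> \<one> \<longleftrightarrow> m \<prec> n \<or> m = n)"

text \<open>In the schemes below, the quantification over assignments \<open>e\<close>, \<open>s\<close> is the universal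
  closure over all number and set parameters of the formula.\<close>

definition Sigma01_induction :: bool where
  "Sigma01_induction \<longleftrightarrow>
     (\<forall>\<phi> x e s. Sigma01 \<phi> \<longrightarrow> range s \<subseteq> \<S> \<longrightarrow>
        sat (e(x := \<zero>)) s \<phi> \<longrightarrow>
        (\<forall>n. sat (e(x := n)) s \<phi> \<longrightarrow> sat (e(x := n \<oplus> \<one>)) s \<phi>) \<longrightarrow>
        (\<forall>n. sat (e(x := n)) s \<phi>))"

definition Delta01_comprehension :: bool where
  "Delta01_comprehension \<longleftrightarrow>
     (\<forall>\<phi> \<psi> x e s. Sigma01 \<phi> \<longrightarrow> Pi01 \<psi> \<longrightarrow> range s \<subseteq> \<S> \<longrightarrow>
        (\<forall>n. sat (e(x := n)) s \<phi> \<longleftrightarrow> sat (e(x := n)) s \<psi>) \<longrightarrow>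
        (\<exists>X\<in>\<S>. \<forall>n. n \<in> X \<longleftrightarrow> sat (e(x := n)) s \<phi>))"

definition RCA0 :: bool where
  "RCA0 \<longleftrightarrow> basic_axioms \<and> Sigma01_induction \<and> Delta01_comprehension"

definition set_induction :: bool where
  "set_induction \<longleftrightarrow>
     (\<forall>X\<in>\<S>. \<zero> \<in> X \<longrightarrow> (\<forall>n. n \<in> X \<longrightarrow> n \<oplus> \<one> \<in> X) \<longrightarrow> (\<forall>n. n \<in> X))"

definition arithmetical_comprehension :: bool where
  "arithmetical_comprehension \<longleftrightarrow>
     (\<forall>\<phi> x e s. arithmetical \<phi> \<longrightarrow> range s \<subseteq> \<S> \<longrightarrow>
        (\<exists>X\<in>\<S>. \<forall>n. n \<in> X \<longleftrightarrow> sat (e(x := n)) s \<phi>))"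

definition ACA0 :: bool where
  "ACA0 \<longleftrightarrow> basic_axioms \<and> set_induction \<and> arithmetical_comprehension"

section \<open>Coding inside a structure\<close>

text \<open>An injective, but not surjective, pairing.\<close>

definition pair :: "'a \<Rightarrow> 'a \<Rightarrow> 'a" where
  "pair i j = (i \<oplus> j) \<otimes> (i \<oplus> j) \<oplus> i"

definition function_on :: "'a set \<Rightarrow> 'a set \<Rightarrow> 'a set \<Rightarrow> bool" where
  "function_on F X Y \<longleftrightarrow>
     (\<forall>z\<in>F. \<exists>i\<in>X. \<exists>j\<in>Y. z = pair i j) \<and> (\<forall>i\<in>X. \<exists>!j. pair i j \<in> F)"

primrec num :: "nat \<Rightarrow> 'a" where
  "num 0 = \<zero>"
| "num (Suc n) = num n \<oplus> \<one>"

text \<open>A triple \<open>(k, (m, n))\<close> represents the finite set of all \<open>i < k\<close> such that \<open>m (i + 1) + 1\<close>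
  divides \<open>n\<close>; the code of a finite set is the least triple representing it.\<close>

definition triple :: "'a \<Rightarrow> bool" where
  "triple c \<longleftrightarrow> (\<exists>k m n. c = pair k (pair m n))"

definition elems :: "'a \<Rightarrow> 'a set" where
  "elems c = {i. \<exists>k m n. c = pair k (pair m n) \<and> i \<prec> k \<and>
                   (\<exists>d. n = (m \<otimes> (i \<oplus> \<one>) \<oplus> \<one>) \<otimes> d)}"

definition finite_set_code :: "'a \<Rightarrow> bool" where
  "finite_set_code c \<longleftrightarrow> triple c \<and> (\<forall>c'. c' \<prec> c \<longrightarrow> triple c' \<longrightarrow> elems c' \<noteq> elems c)"

text \<open>Finite sequences are finite functions, identified with their codes.\<close>

definition seq :: "'a \<Rightarrow> 'a \<Rightarrow> bool" where
  "seq \<sigma> l \<longleftrightarrow> finite_set_code \<sigma> \<and> function_on (elems \<sigma>) {i. i \<prec> l} UNIV"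

text \<open>\<open>\<tau>\<close> is \<open>\<sigma>\<close> with the entry \<open>n\<close> appended.\<close>

definition append_entry :: "'a \<Rightarrow> 'a \<Rightarrow> 'a \<Rightarrow> bool" where
  "append_entry \<sigma> n \<tau> \<longleftrightarrow>
     (\<exists>l. seq \<sigma> l \<and> seq \<tau> (l \<oplus> \<one>) \<and> elems \<tau> = insert (pair l n) (elems \<sigma>))"

definition tree :: "'a set \<Rightarrow> bool" where
  "tree T \<longleftrightarrow>
     (\<forall>\<tau>\<in>T. \<exists>l. seq \<tau> l) \<and>
     (\<forall>\<tau>\<in>T. \<forall>\<sigma> l. seq \<sigma> l \<longrightarrow> elems \<sigma> \<subseteq> elems \<tau> \<longrightarrow> \<sigma> \<in> T)"

definition wf_tree :: "'a set \<Rightarrow> bool" where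
  "wf_tree T \<longleftrightarrow> tree T \<and>
     \<not> (\<exists>f\<in>\<S>. function_on f UNIV UNIV \<and> (\<forall>n. \<exists>\<sigma>\<in>T. seq \<sigma> n \<and> elems \<sigma> \<subseteq> f))"

section \<open>Arithmetical transfinite recursion\<close>

definition field :: "'a set \<Rightarrow> 'a set" where
  "field X = {i. pair i i \<in> X}"

definition less_in :: "'a set \<Rightarrow> 'a \<Rightarrow> 'a \<Rightarrow> bool" where
  "less_in X i j \<longleftrightarrow> pair i j \<in> X \<and> pair j i \<notin> X"

definition LO :: "'a set \<Rightarrow> bool" where
  "LO X \<longleftrightarrow>
     (\<forall>z\<in>X. \<exists>i\<in>field X. \<exists>j\<in>field X. z = pair i j) \<and>
     (\<forall>i j k. pair i j \<in> X \<longrightarrow> pair j k \<in> X \<longrightarrow> pair i k \<in> X) \<and>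
     (\<forall>i j. pair i j \<in> X \<longrightarrow> pair j i \<in> X \<longrightarrow> i = j) \<and>
     (\<forall>i\<in>field X. \<forall>j\<in>field X. pair i j \<in> X \<or> pair j i \<in> X)"

definition WO :: "'a set \<Rightarrow> bool" where
  "WO X \<longleftrightarrow> LO X \<and>
     \<not> (\<exists>f\<in>\<S>. function_on f UNIV (field X) \<and>
          (\<forall>n a b. pair n a \<in> f \<longrightarrow> pair (n \<oplus> \<one>) b \<in> f \<longrightarrow> less_in X b a))"

definition below :: "'a set \<Rightarrow> 'a set \<Rightarrow> 'a \<Rightarrow> 'a set" where
  "below X Y j = {z. \<exists>m i. z = pair m i \<and> less_in X i j \<and> z \<in> Y}"

text \<open>\<open>Y\<close> is the result of iterating \<open>\<theta>\<close> along \<open>X\<close>, where \<open>\<theta> n Z\<close> is the operator.\<close>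

definition iterates :: "('a \<Rightarrow> 'a set \<Rightarrow> bool) \<Rightarrow> 'a set \<Rightarrow> 'a set \<Rightarrow> bool" where
  "iterates \<theta> X Y \<longleftrightarrow> LO X \<and>
     Y = {z. \<exists>n j. z = pair n j \<and> j \<in> field X \<and> \<theta> n (below X Y j)}"

definition arithmetical_transfinite_recursion :: bool where
  "arithmetical_transfinite_recursion \<longleftrightarrow>
     (\<forall>\<theta> x V e s. arithmetical \<theta> \<longrightarrow> range s \<subseteq> \<S> \<longrightarrow>
        (\<forall>X\<in>\<S>. WO X \<longrightarrow>
           (\<exists>Y\<in>\<S>. iterates (\<lambda>n Z. sat (e(x := n)) (s(V := Z)) \<theta>) X Y)))"

definition ATR0 :: bool where
  "ATR0 \<longleftrightarrow> ACA0 \<and> arithmetical_transfinite_recursion"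

section \<open>Partitions and Borel codes\<close>

definition least :: "'a set \<Rightarrow> 'a \<Rightarrow> bool" where
  "least A a \<longleftrightarrow> a \<in> A \<and> (\<forall>b. b \<prec> a \<longrightarrow> b \<notin> A)"

definition ordered_surjection :: "nat \<Rightarrow> 'a set \<Rightarrow> 'a set \<Rightarrow> bool" where
  "ordered_surjection k D p \<longleftrightarrow>
     function_on p D {i. i \<prec> num k} \<and>
     (\<forall>i. i \<prec> num k \<longrightarrow> (\<exists>n\<in>D. pair n i \<in> p)) \<and>
     (\<forall>i j. i \<prec> j \<longrightarrow> j \<prec> num k \<longrightarrow>
        (\<exists>a b. least {n. pair n i \<in> p} a \<and> least {n. pair n j \<in> p} b \<and> a \<prec> b))"

definition partitions :: "nat \<Rightarrow> 'a set set" where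
  "partitions k = {p \<in> \<S>. ordered_surjection k UNIV p}"

definition finite_partitions :: "nat \<Rightarrow> 'a set" where
  "finite_partitions k =
     {\<sigma>. \<exists>r. seq \<sigma> r \<and> ordered_surjection k {i. i \<prec> r} (elems \<sigma>)}"

text \<open>For the string \<open>\<sigma>\<close>, being an initial segment of \<open>p\<close> amounts to inclusion of graphs.\<close>

definition cylinder :: "nat \<Rightarrow> 'a \<Rightarrow> 'a set set" where
  "cylinder k \<sigma> = {p \<in> partitions k. elems \<sigma> \<subseteq> p}"

text \<open>Codes of the labels: those of the empty set, the whole space, \<open>[\<sigma>]\<close>, the complement of
  \<open>[\<sigma>]\<close>, union and intersection have first components 0, 1, 2, 3, 4 and 5, respectively.\<close>

definition lab_empty :: 'a where "lab_empty = pair (num 0) \<zero>"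
definition lab_full :: 'a where "lab_full = pair (num 1) \<zero>"
definition lab_cyl :: "'a \<Rightarrow> 'a" where "lab_cyl \<sigma> = pair (num 2) \<sigma>"
definition lab_cocyl :: "'a \<Rightarrow> 'a" where "lab_cocyl \<sigma> = pair (num 3) \<sigma>"
definition lab_union :: 'a where "lab_union = pair (num 4) \<zero>"
definition lab_inter :: 'a where "lab_inter = pair (num 5) \<zero>"

definition clopen_labels :: "nat \<Rightarrow> 'a set" where
  "clopen_labels k =
     {lab_empty, lab_full} \<union> lab_cyl ` finite_partitions k \<union> lab_cocyl ` finite_partitions k"

definition in_clopen :: "nat \<Rightarrow> 'a set \<Rightarrow> 'a \<Rightarrow> bool" where
  "in_clopen k x l \<longleftrightarrow>
     (l = lab_full \<and> x \<in> partitions k) \<or>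
     (\<exists>\<sigma>\<in>finite_partitions k. l = lab_cyl \<sigma> \<and> x \<in> cylinder k \<sigma>) \<or>
     (\<exists>\<sigma>\<in>finite_partitions k. l = lab_cocyl \<sigma> \<and> x \<in> partitions k - cylinder k \<sigma>)"

definition children :: "'a set \<Rightarrow> 'a \<Rightarrow> 'a set" where
  "children B \<sigma> = {\<tau> \<in> B. \<exists>n. append_entry \<sigma> n \<tau>}"

definition leaf :: "'a set \<Rightarrow> 'a \<Rightarrow> bool" where
  "leaf B \<sigma> \<longleftrightarrow> \<sigma> \<in> B \<and> children B \<sigma> = {}"

definition root :: "'a \<Rightarrow> bool" where
  "root \<sigma> \<longleftrightarrow> seq \<sigma> \<zero>"

text \<open>Trees used as Borel codes are required to contain the root, since membership in the coded
  set refers to the value at the root.\<close>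

definition borel_code :: "nat \<Rightarrow> 'a set \<Rightarrow> 'a set \<Rightarrow> bool" where
  "borel_code k B \<phi> \<longleftrightarrow>
     B \<in> \<S> \<and> \<phi> \<in> \<S> \<and> wf_tree B \<and> (\<exists>\<rho>\<in>B. root \<rho>) \<and>
     function_on \<phi> B UNIV \<and>
     (\<forall>\<sigma>\<in>B. \<forall>l. pair \<sigma> l \<in> \<phi> \<longrightarrow>
        (if leaf B \<sigma> then l \<in> clopen_labels k else l \<in> {lab_union, lab_inter}))"

definition evaluation_map :: "nat \<Rightarrow> 'a set \<Rightarrow> 'a set \<Rightarrow> 'a set \<Rightarrow> 'a set \<Rightarrow> bool" where
  "evaluation_map k B \<phi> x f \<longleftrightarrow>
     f \<in> \<S> \<and> function_on f B {\<zero>, \<one>} \<and>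
     (\<forall>\<sigma>\<in>B.
        (leaf B \<sigma> \<longrightarrow>
           (pair \<sigma> \<one> \<in> f \<longleftrightarrow> (\<exists>l. pair \<sigma> l \<in> \<phi> \<and> in_clopen k x l))) \<and>
        (pair \<sigma> lab_union \<in> \<phi> \<longrightarrow>
           (pair \<sigma> \<one> \<in> f \<longleftrightarrow> (\<exists>\<tau>\<in>children B \<sigma>. pair \<tau> \<one> \<in> f))) \<and>
        (pair \<sigma> lab_inter \<in> \<phi> \<longrightarrow>
           (pair \<sigma> \<one> \<in> f \<longleftrightarrow> (\<forall>\<tau>\<in>children B \<sigma>. pair \<tau> \<one> \<in> f))))"

definition in_borel :: "nat \<Rightarrow> 'a set \<Rightarrow> 'a set \<Rightarrow> 'a set \<Rightarrow> bool" where
  "in_borel k x B \<phi> \<longleftrightarrow>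
     (\<exists>f. evaluation_map k B \<phi> x f \<and> (\<exists>\<rho>\<in>B. root \<rho> \<and> pair \<rho> \<one> \<in> f))"

definition notin_borel :: "nat \<Rightarrow> 'a set \<Rightarrow> 'a set \<Rightarrow> 'a set \<Rightarrow> bool" where
  "notin_borel k x B \<phi> \<longleftrightarrow>
     (\<exists>f. evaluation_map k B \<phi> x f \<and> (\<exists>\<rho>\<in>B. root \<rho> \<and> pair \<rho> \<zero> \<in> f))"

end

end

theory Submission
  imports Defs
begin

text \<open>
  From \<open>ATR\<^sub>0\<close>: the Kleene-Brouwer order of a well-founded tree is a well-order, and an evaluation map
  at any given point is obtained by recursion along it.

  Conversely, a Borel code all of whose leaves are labelled by the empty set or by the whole space has
  essentially one evaluation map, which does not depend on the point. If a graph has no infinite path,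
  then applying this to its tree of finite paths, with unions and intersections alternating, yields a
  kernel: a set \<open>v\<close> such that a vertex is in \<open>v\<close> iff one of its successors is not. Now write an
  arithmetical operator as a block of quantifiers, each followed by a negation, in front of a single
  query of its set argument, and let the queries about \<open>(m, i)\<close>, where \<open>i\<close> precedes the current stage
  \<open>j\<close>, lead back to the beginning of the block at stage \<open>i\<close>. This graph has no infinite path as the
  order of the stages is a well-order, and its kernel is the iteration of the operator. The one point
  order gives arithmetical comprehension.
\<close>

section \<open>Definability\<close>

text \<open>The reversal has to be carried out in RCA0, and this shapes it. A Borel code must exist
  as a set, so its labels must be decidable; being a dead end of a graph is only Pi01, which is why
  every graph comes with the set of those vertices that have a successor. An evaluation map assigns
  values to finite paths, not to vertices. That two paths with the same last vertex agree has to be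
  shown without arithmetical transfinite induction: a disagreement is followed, by dependent choice,
  along an infinite path. The agreement then gives the kernel both a Sigma01 and a Pi01 definition,
  so that it exists. The number of quantifiers of the operator is a standard number even if the
  model is not; hence the steps within one block can be counted outside the model. In the other
  direction, the operator of a recursion sees only the results of the earlier stages and not the
  stage itself, which has to be recovered from them.\<close>

context l2_structure
begin

text \<open>Predicates of an environment \<open>e\<close> that are defined by a bounded formula with arbitrary
  parameters, independently of the choice of variables: \<open>v\<close> tells which variables stand for the
  entries of \<open>e\<close>, and \<open>u\<close> which ones hold the finitely many number parameters. The entries of \<open>e\<close>
  serve as de Bruijn indices.\<close>

definition term_at where
  "term_at v u C t r \<longleftrightarrow> tvars r \<subseteq> range v \<union> u ` C \<and>
     (\<forall>E. (\<forall>c\<in>C. E (u c) = c) \<longrightarrow> tval E r = t (E \<circ> v))"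

definition fm_at where
  "fm_at v u C s P \<phi> \<longleftrightarrow> bounded_fm \<phi> \<and>
     (\<forall>E. (\<forall>c\<in>C. E (u c) = c) \<longrightarrow> sat E s \<phi> = P (E \<circ> v))"

definition tm :: "((nat \<Rightarrow> 'a) \<Rightarrow> 'a) \<Rightarrow> bool" where
  "tm t \<longleftrightarrow> (\<exists>C. finite C \<and> (\<forall>v u. \<exists>r. term_at v u C t r))"

text \<open>The finite sets of parameters are fixed before the variables are chosen, so that
  formulas for different predicates can be given the same variables and joined. The complement of
  \<open>range v\<close> has to be infinite to leave fresh variables for bounded
  quantifiers.\<close>

definition D0 :: "((nat \<Rightarrow> 'a) \<Rightarrow> bool) \<Rightarrow> bool" where
  "D0 P \<longleftrightarrow> (\<exists>C F. finite C \<and> finite F \<and> F \<subseteq> \<S> \<and>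
     (\<forall>v u s. infinite (- range v) \<longrightarrow> F \<subseteq> range s \<longrightarrow> (\<exists>\<phi>. fm_at v u C s P \<phi>)))"

lemma tval_cong: "(\<And>x. x \<in> tvars r \<Longrightarrow> e x = e' x) \<Longrightarrow> tval e r = tval e' r"
  by (induction r) auto

lemma tm_var: "tm (\<lambda>e. e n)"
  unfolding tm_def term_at_def
proof (intro exI[of _ "{}"] conjI allI)
  fix v :: "nat \<Rightarrow> nat" and u :: "'a \<Rightarrow> nat"
  show "\<exists>r. tvars r \<subseteq> range v \<union> u ` {} \<and> (\<forall>E. (\<forall>c\<in>{}. E (u c) = c) \<longrightarrow> tval E r = (E \<circ> v) n)"
    by (intro exI[of _ "Var (v n)"]) auto
qed auto

lemma tm_const: "tm (\<lambda>e. a)"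
  unfolding tm_def term_at_def
proof (intro exI[of _ "{a}"] conjI allI)
  fix v :: "nat \<Rightarrow> nat" and u :: "'a \<Rightarrow> nat"
  show "\<exists>r. tvars r \<subseteq> range v \<union> u ` {a} \<and> (\<forall>E. (\<forall>c\<in>{a}. E (u c) = c) \<longrightarrow> tval E r = a)"
    by (intro exI[of _ "Var (u a)"]) auto
qed auto

lemma tm_binary:
  assumes "tm t" "tm u"
    and F: "\<And>r s E. tval E (F r s) = G (tval E r) (tval E s)"
    and V: "\<And>r s. tvars (F r s) = tvars r \<union> tvars s"
  shows "tm (\<lambda>e. G (t e) (u e))"
proof -
  obtain C1 C2 where C: "finite C1" "finite C2"
    and 1: "\<And>v w. \<exists>r. term_at v w C1 t r"
    and 2: "\<And>v w. \<exists>r. term_at v w C2 u r"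
    using assms(1,2) unfolding tm_def by metis
  show ?thesis
    unfolding tm_def term_at_def
  proof (intro exI[of _ "C1 \<union> C2"] conjI allI)
    fix v :: "nat \<Rightarrow> nat" and w :: "'a \<Rightarrow> nat"
    obtain r where r: "tvars r \<subseteq> range v \<union> w ` C1" "\<And>E. (\<forall>c\<in>C1. E (w c) = c) \<Longrightarrow> tval E r = t (E \<circ> v)"
      using 1 unfolding term_at_def fm_at_def by metis
    obtain s where s: "tvars s \<subseteq> range v \<union> w ` C2" "\<And>E. (\<forall>c\<in>C2. E (w c) = c) \<Longrightarrow> tval E s = u (E \<circ> v)"
      using 2 unfolding term_at_def fm_at_def by metis
    show "\<exists>r. tvars r \<subseteq> range v \<union> w ` (C1 \<union> C2) \<and>
      (\<forall>E. (\<forall>c\<in>C1 \<union> C2. E (w c) = c) \<longrightarrow> tval E r = G (t (E \<circ> v)) (u (E \<circ> v)))"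
      using r s by (intro exI[of _ "F r s"]) (auto simp: F V)
  qed (use C in auto)
qed

lemma tm_plus: "tm t \<Longrightarrow> tm u \<Longrightarrow> tm (\<lambda>e. t e \<oplus> u e)"
  by (rule tm_binary[where F = Plus]) auto

lemma tm_times: "tm t \<Longrightarrow> tm u \<Longrightarrow> tm (\<lambda>e. t e \<otimes> u e)"
  by (rule tm_binary[where F = Times]) auto

lemma tm_pair: "tm t \<Longrightarrow> tm u \<Longrightarrow> tm (\<lambda>e. pair (t e) (u e))"
  unfolding pair_def by (intro tm_plus tm_times)

lemmas tm_intros = tm_var tm_const tm_plus tm_times tm_pair

lemma tm_rename:
  assumes "tm t"
  shows "tm (\<lambda>e. t (\<lambda>n. e (r n)))"
proof -
  obtain C where C: "finite C"
    and 1: "\<And>v w. \<exists>q. term_at v w C t q"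
    using assms unfolding tm_def by metis
  show ?thesis
    unfolding tm_def term_at_def
  proof (intro exI[of _ C] conjI allI)
    fix v :: "nat \<Rightarrow> nat" and u :: "'a \<Rightarrow> nat"
    from 1[of "\<lambda>n. v (r n)" u] obtain q where "tvars q \<subseteq> range (\<lambda>n. v (r n)) \<union> u ` C"
      "\<forall>E. (\<forall>c\<in>C. E (u c) = c) \<longrightarrow> tval E q = t (E \<circ> (\<lambda>n. v (r n)))"
      unfolding term_at_def by blast
    then show "\<exists>q. tvars q \<subseteq> range v \<union> u ` C \<and>
        (\<forall>E. (\<forall>c\<in>C. E (u c) = c) \<longrightarrow> tval E q = t (\<lambda>n. (E \<circ> v) (r n)))"
      by (intro exI[of _ q] conjI) (blast, simp add: o_def)
  qed (rule C)
qed

lemma D0_atom: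
  assumes "tm t" "tm u"
    and B: "\<And>r r'. bounded_fm (F r r')"
    and F: "\<And>r r' E s. sat E s (F r r') = G (tval E r) (tval E r')"
  shows "D0 (\<lambda>e. G (t e) (u e))"
proof -
  obtain C1 C2 where C: "finite C1" "finite C2"
    and 1: "\<And>v w. \<exists>r. term_at v w C1 t r"
    and 2: "\<And>v w. \<exists>r. term_at v w C2 u r"
    using assms(1,2) unfolding tm_def by metis
  show ?thesis
    unfolding D0_def fm_at_def
  proof (intro exI[of _ "C1 \<union> C2"] exI[of _ "{}"] conjI allI impI)
    fix v :: "nat \<Rightarrow> nat" and w :: "'a \<Rightarrow> nat" and s :: "nat \<Rightarrow> 'a set"
    obtain r where r: "\<And>E. (\<forall>c\<in>C1. E (w c) = c) \<Longrightarrow> tval E r = t (E \<circ> v)"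
      using 1 unfolding term_at_def fm_at_def by metis
    obtain r' where r': "\<And>E. (\<forall>c\<in>C2. E (w c) = c) \<Longrightarrow> tval E r' = u (E \<circ> v)"
      using 2 unfolding term_at_def fm_at_def by metis
    show "\<exists>\<phi>. bounded_fm \<phi> \<and> (\<forall>E. (\<forall>c\<in>C1 \<union> C2. E (w c) = c) \<longrightarrow>
        sat E s \<phi> = G (t (E \<circ> v)) (u (E \<circ> v)))"
      using r r' by (intro exI[of _ "F r r'"]) (auto simp: F B)
  qed (use C in auto)
qed

lemma D0_eq: "tm t \<Longrightarrow> tm u \<Longrightarrow> D0 (\<lambda>e. t e = u e)"
  by (rule D0_atom[where F = Eq]) (auto intro: bounded_fm.intros)

lemma D0_less: "tm t \<Longrightarrow> tm u \<Longrightarrow> D0 (\<lambda>e. t e \<prec> u e)"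
  by (rule D0_atom[where F = Less]) (auto intro: bounded_fm.intros)

lemma D0_mem:
  assumes "tm t" "X \<in> \<S>"
  shows "D0 (\<lambda>e. t e \<in> X)"
proof -
  obtain C where C: "finite C"
    and 1: "\<And>v w. \<exists>r. term_at v w C t r"
    using assms(1) unfolding tm_def by metis
  show ?thesis
    unfolding D0_def fm_at_def
  proof (intro exI[of _ C] exI[of _ "{X}"] conjI allI impI)
    fix v :: "nat \<Rightarrow> nat" and w :: "'a \<Rightarrow> nat" and s :: "nat \<Rightarrow> 'a set"
    assume "{X} \<subseteq> range s"
    then obtain n where n: "X = s n" by auto
    obtain r where r: "\<And>E. (\<forall>c\<in>C. E (w c) = c) \<Longrightarrow> tval E r = t (E \<circ> v)"
      using 1 unfolding term_at_def fm_at_def by metis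
    show "\<exists>\<phi>. bounded_fm \<phi> \<and> (\<forall>E. (\<forall>c\<in>C. E (w c) = c) \<longrightarrow> sat E s \<phi> = (t (E \<circ> v) \<in> X))"
      using r by (intro exI[of _ "Mem r n"]) (auto simp: n intro: bounded_fm.intros)
  qed (use C assms in auto)
qed

lemma D0_neg:
  assumes "D0 P"
  shows "D0 (\<lambda>e. \<not> P e)"
proof -
  obtain C F where C: "finite C" "finite F" "F \<subseteq> \<S>"
    and 1: "\<And>v u s. infinite (- range v) \<Longrightarrow> F \<subseteq> range s \<Longrightarrow> \<exists>\<phi>. fm_at v u C s P \<phi>"
    using assms unfolding D0_def by metis
  show ?thesis
    unfolding D0_def fm_at_def
  proof (intro exI[of _ C] exI[of _ F] conjI allI impI)
    fix v :: "nat \<Rightarrow> nat" and u :: "'a \<Rightarrow> nat" and s :: "nat \<Rightarrow> 'a set"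
    assume "infinite (- range v)" "F \<subseteq> range s"
    then obtain \<phi> where "bounded_fm \<phi>" "\<And>E. (\<forall>c\<in>C. E (u c) = c) \<Longrightarrow> sat E s \<phi> = P (E \<circ> v)"
      using 1 unfolding term_at_def fm_at_def by metis
    then show "\<exists>\<phi>. bounded_fm \<phi> \<and> (\<forall>E. (\<forall>c\<in>C. E (u c) = c) \<longrightarrow> sat E s \<phi> = (\<not> P (E \<circ> v)))"
      by (intro exI[of _ "Neg \<phi>"]) (auto intro: bounded_fm.intros)
  qed (use C in auto)
qed

lemma D0_conj:
  assumes "D0 P" "D0 Q"
  shows "D0 (\<lambda>e. P e \<and> Q e)"
proof -
  obtain C1 F1 where C1: "finite C1" "finite F1" "F1 \<subseteq> \<S>"
    and 1: "\<And>v u s. infinite (- range v) \<Longrightarrow> F1 \<subseteq> range s \<Longrightarrow> \<exists>\<phi>. fm_at v u C1 s P \<phi>"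
    using assms(1) unfolding D0_def by metis
  obtain C2 F2 where C2: "finite C2" "finite F2" "F2 \<subseteq> \<S>"
    and 2: "\<And>v u s. infinite (- range v) \<Longrightarrow> F2 \<subseteq> range s \<Longrightarrow> \<exists>\<phi>. fm_at v u C2 s Q \<phi>"
    using assms(2) unfolding D0_def by metis
  show ?thesis
    unfolding D0_def fm_at_def
  proof (intro exI[of _ "C1 \<union> C2"] exI[of _ "F1 \<union> F2"] conjI allI impI)
    fix v :: "nat \<Rightarrow> nat" and u :: "'a \<Rightarrow> nat" and s :: "nat \<Rightarrow> 'a set"
    assume *: "infinite (- range v)" "F1 \<union> F2 \<subseteq> range s"
    then obtain \<phi> where "bounded_fm \<phi>" "\<And>E. (\<forall>c\<in>C1. E (u c) = c) \<Longrightarrow> sat E s \<phi> = P (E \<circ> v)"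
      using 1 unfolding term_at_def fm_at_def by (metis Un_subset_iff)
    moreover obtain \<psi> where "bounded_fm \<psi>" "\<And>E. (\<forall>c\<in>C2. E (u c) = c) \<Longrightarrow> sat E s \<psi> = Q (E \<circ> v)"
      using 2 * unfolding term_at_def fm_at_def by (metis Un_subset_iff)
    ultimately show "\<exists>\<phi>. bounded_fm \<phi> \<and> (\<forall>E. (\<forall>c\<in>C1 \<union> C2. E (u c) = c) \<longrightarrow>
        sat E s \<phi> = (P (E \<circ> v) \<and> Q (E \<circ> v)))"
      by (intro exI[of _ "Conj \<phi> \<psi>"]) (auto intro: bounded_fm.intros)
  qed (use C1 C2 in auto)
qed

lemma D0_disj: "D0 P \<Longrightarrow> D0 Q \<Longrightarrow> D0 (\<lambda>e. P e \<or> Q e)"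
  using D0_neg[OF D0_conj[OF D0_neg D0_neg, of P Q]] by simp

lemma D0_imp: "D0 P \<Longrightarrow> D0 Q \<Longrightarrow> D0 (\<lambda>e. P e \<longrightarrow> Q e)"
  using D0_neg[OF D0_conj[OF _ D0_neg, of P Q]] by simp

lemma D0_iff: "D0 P \<Longrightarrow> D0 Q \<Longrightarrow> D0 (\<lambda>e. P e \<longleftrightarrow> Q e)"
  using D0_conj[OF D0_imp[of P Q] D0_imp[of Q P]] by (simp add: iff_conv_conj_imp)

lemma D0_bool: "D0 (\<lambda>e. b)"
  using D0_eq[OF tm_const[of \<zero>] tm_const[of \<zero>]] D0_neg[OF D0_eq[OF tm_const[of \<zero>] tm_const[of \<zero>]]]
  by (cases b) simp_all

lemma range_case_nat: "range (case_nat x v) = insert x (range v)"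
proof (intro equalityI subsetI)
  fix y assume "y \<in> insert x (range v)"
  then consider "y = case_nat x v 0" | n where "y = case_nat x v (Suc n)" by auto
  then show "y \<in> range (case_nat x v)" by (metis rangeI)
qed (auto split: nat.splits)

lemma infinite_range_case_nat: "infinite (- range v) \<Longrightarrow> infinite (- range (case_nat x v))"
  by (simp add: range_case_nat Compl_insert)

lemma fun_upd_comp_case_nat: "x \<notin> range v \<Longrightarrow> E(x := a) \<circ> case_nat x v = case_nat a (E \<circ> v)"
  by (rule ext) (auto split: nat.splits)

text \<open>The bound variable \<open>x\<close> is fresh for \<open>v\<close> and for the parameters
  and becomes entry 0 under \<open>case_nat x v\<close>, while the other entries move up by one.
  Freshness also keeps \<open>x\<close> out of the bounding term, as \<open>bounded_fm\<close>
  requires.\<close>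

lemma D0_ex_case:
  assumes "tm t" "D0 P"
  shows "D0 (\<lambda>e. \<exists>a. a \<prec> t e \<and> P (case_nat a e))"
proof -
  obtain C1 where C1: "finite C1"
    and 1: "\<And>v w. \<exists>r. term_at v w C1 t r"
    using assms(1) unfolding tm_def by metis
  obtain C2 F where C2: "finite C2" "finite F" "F \<subseteq> \<S>"
    and 2: "\<And>v u s. infinite (- range v) \<Longrightarrow> F \<subseteq> range s \<Longrightarrow> \<exists>\<phi>. fm_at v u C2 s P \<phi>"
    using assms(2) unfolding D0_def by metis
  show ?thesis
    unfolding D0_def fm_at_def
  proof (intro exI[of _ "C1 \<union> C2"] exI[of _ F] conjI allI impI)
    fix v :: "nat \<Rightarrow> nat" and u :: "'a \<Rightarrow> nat" and s :: "nat \<Rightarrow> 'a set"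
    assume *: "infinite (- range v)" "F \<subseteq> range s"
    have "infinite (- range v - u ` (C1 \<union> C2))"
      using *(1) C1 C2 by auto
    then obtain x where x: "x \<notin> range v" "x \<notin> u ` (C1 \<union> C2)"
      by (metis Diff_iff ComplD finite.emptyI ex_in_conv)
    obtain r where r: "tvars r \<subseteq> range v \<union> u ` C1" "\<And>E. (\<forall>c\<in>C1. E (u c) = c) \<Longrightarrow> tval E r = t (E \<circ> v)"
      using 1 unfolding term_at_def fm_at_def by metis
    obtain \<phi> where \<phi>: "bounded_fm \<phi>"
      "\<And>E. (\<forall>c\<in>C2. E (u c) = c) \<Longrightarrow> sat E s \<phi> = P (E \<circ> case_nat x v)"
      using 2[OF infinite_range_case_nat[OF *(1)] *(2)] unfolding fm_at_def by metis
    have xr: "x \<notin> tvars r" using r x by auto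
    show "\<exists>\<phi>. bounded_fm \<phi> \<and> (\<forall>E. (\<forall>c\<in>C1 \<union> C2. E (u c) = c) \<longrightarrow>
        sat E s \<phi> = (\<exists>a. a \<prec> t (E \<circ> v) \<and> P (case_nat a (E \<circ> v))))"
    proof (intro exI[of _ "ExN x (Conj (Less (Var x) r) \<phi>)"] conjI allI impI)
      fix E :: "nat \<Rightarrow> 'a"
      assume E: "\<forall>c\<in>C1 \<union> C2. E (u c) = c"
      have "tval (E(x := a)) r = t (E \<circ> v)" for a
        using r(2)[of E] E xr by (subst tval_cong[of _ _ E]) auto
      moreover have "sat (E(x := a)) s \<phi> = P (case_nat a (E \<circ> v))" for a
      proof -
        have "\<forall>c\<in>C2. (E(x := a)) (u c) = c" using E x(2) by (auto simp: image_iff)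
        then show ?thesis using \<phi>(2)[of "E(x := a)"] x(1) by (simp add: fun_upd_comp_case_nat)
      qed
      ultimately show "sat E s (ExN x (Conj (Less (Var x) r) \<phi>)) =
        (\<exists>a. a \<prec> t (E \<circ> v) \<and> P (case_nat a (E \<circ> v)))"
        by simp
    qed (use \<phi> xr in \<open>auto intro: bounded_fm.intros\<close>)
  qed (use C1 C2 in auto)
qed

text \<open>Separating the shifted environment from the new entry 0 lets the rule be applied
  backwards to predicates written with ordinary bound variables.\<close>

lemma D0_ex:
  assumes "tm t" "D0 (\<lambda>e. P (\<lambda>n. e (Suc n)) (e 0))"
  shows "D0 (\<lambda>e. \<exists>a. a \<prec> t e \<and> P e a)"
  using D0_ex_case[OF assms] by simp

lemma D0_all:
  assumes "tm t" "D0 (\<lambda>e. P (\<lambda>n. e (Suc n)) (e 0))"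
  shows "D0 (\<lambda>e. \<forall>a. a \<prec> t e \<longrightarrow> P e a)"
  using D0_neg[OF D0_ex[OF assms(1) D0_neg[OF assms(2)]]] by simp

lemmas D0_intros = D0_bool D0_eq D0_less D0_mem D0_neg D0_conj D0_disj D0_imp D0_iff D0_ex D0_all

text \<open>The environment is placed at the even variables and the parameters at odd ones, numbered
  by an injection \<open>f\<close>. Two predicates are treated at once because
  \<open>Delta01_comprehension\<close> evaluates its Sigma01 and its Pi01 formula under the same
  assignments.\<close>

lemma D0_instance:
  assumes "D0 P" "D0 Q"
  obtains \<phi> \<psi> s E where "bounded_fm \<phi>" "bounded_fm \<psi>" "range s \<subseteq> \<S>"
    "\<And>e. sat (\<lambda>n. if even n then e (n div 2) else E n) s \<phi> = P e"
    "\<And>e. sat (\<lambda>n. if even n then e (n div 2) else E n) s \<psi> = Q e"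
proof -
  obtain C1 F1 where C1: "finite C1" "finite F1" "F1 \<subseteq> \<S>"
    and 1: "\<And>v u s. infinite (- range v) \<Longrightarrow> F1 \<subseteq> range s \<Longrightarrow> \<exists>\<phi>. fm_at v u C1 s P \<phi>"
    using assms(1) unfolding D0_def by metis
  obtain C2 F2 where C2: "finite C2" "finite F2" "F2 \<subseteq> \<S>"
    and 2: "\<And>v u s. infinite (- range v) \<Longrightarrow> F2 \<subseteq> range s \<Longrightarrow> \<exists>\<phi>. fm_at v u C2 s Q \<phi>"
    using assms(2) unfolding D0_def by metis
  define C where "C = C1 \<union> C2"
  have "finite C" unfolding C_def using C1 C2 by simp
  then obtain f :: "'a \<Rightarrow> nat" where f: "inj_on f C" by (meson finite_imp_inj_to_nat_seg)
  \<comment> \<open>Even if there are no set parameters, the assignment \<open>s\<close> needs a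
    value in \<S>.\<close>
  obtain X where X: "X \<in> \<S>" using sets_nonempty by auto
  have "\<exists>s :: nat \<Rightarrow> 'a set. range s = insert X G" if "finite G" for G
    using that
  proof (induction G)
    case empty
    show ?case by (intro exI[of _ "\<lambda>_. X"]) auto
  next
    case (insert Y G)
    then obtain s :: "nat \<Rightarrow> 'a set" where s: "range s = insert X G" by auto
    have "range (case_nat Y s) = insert X (insert Y G)"
      using s by (auto simp: range_case_nat)
    then show ?case by blast
  qed
  then obtain s :: "nat \<Rightarrow> 'a set" where s: "range s = insert X (F1 \<union> F2)"
    using C1(2) C2(2) by (meson finite_UnI)
  have inf: "infinite (- range (\<lambda>n::nat. 2 * n))"
  proof -
    have "range (\<lambda>n::nat. Suc (2 * n)) \<subseteq> - range (\<lambda>n. 2 * n)" by (auto; presburger)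
    moreover have "infinite (range (\<lambda>n::nat. Suc (2 * n)))"
      by (auto simp: inj_on_def dest: finite_imageD)
    ultimately show ?thesis using infinite_super by blast
  qed
  obtain \<phi> where \<phi>: "bounded_fm \<phi>"
    "\<And>E. (\<forall>c\<in>C1. E (Suc (2 * f c)) = c) \<Longrightarrow> sat E s \<phi> = P (E \<circ> (\<lambda>n. 2 * n))"
    using 1[OF inf, of s "\<lambda>c. Suc (2 * f c)"] s unfolding fm_at_def by auto
  obtain \<psi> where \<psi>: "bounded_fm \<psi>"
    "\<And>E. (\<forall>c\<in>C2. E (Suc (2 * f c)) = c) \<Longrightarrow> sat E s \<psi> = Q (E \<circ> (\<lambda>n. 2 * n))"
    using 2[OF inf, of s "\<lambda>c. Suc (2 * f c)"] s unfolding fm_at_def by auto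
  have inv: "inv_into C f (f c) = c" if "c \<in> C1 \<or> c \<in> C2" for c
    using that f unfolding C_def by (metis Un_iff inv_into_f_f)
  show thesis
  proof (rule that[of \<phi> \<psi> s "\<lambda>n. inv_into C f (n div 2)"])
    fix e :: "nat \<Rightarrow> 'a"
    show "sat (\<lambda>n. if even n then e (n div 2) else inv_into C f (n div 2)) s \<phi> = P e"
      by (subst \<phi>(2)) (auto simp: inv o_def)
    show "sat (\<lambda>n. if even n then e (n div 2) else inv_into C f (n div 2)) s \<psi> = Q e"
      by (subst \<psi>(2)) (auto simp: inv o_def)
  qed (use \<phi> \<psi> s C1 C2 X in auto)
qed

text \<open>The witness \<open>a\<close> is entry 0 and the argument \<open>n\<close> is entry 1, so
  they stand at the variables 0 and 2.\<close>

lemma Sigma01_instance: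
  assumes "D0 (\<lambda>e. P (e 0) (e 1))" "D0 (\<lambda>e. Q (e 0) (e 1))"
  obtains \<phi> \<psi> s E where "bounded_fm \<phi>" "bounded_fm \<psi>" "range s \<subseteq> \<S>"
    "\<And>a n. sat (E(2 := n, 0 := a)) s \<phi> = P a n" "\<And>a n. sat (E(2 := n, 0 := a)) s \<psi> = Q a n"
proof -
  obtain \<phi> \<psi> s E where \<phi>: "bounded_fm \<phi>" "bounded_fm \<psi>" "range s \<subseteq> \<S>"
    "\<And>e. sat (\<lambda>n. if even n then e (n div 2) else E n) s \<phi> = P (e 0) (e 1)"
    "\<And>e. sat (\<lambda>n. if even n then e (n div 2) else E n) s \<psi> = Q (e 0) (e 1)"
    by (rule D0_instance[OF assms]) (rule that)
  have eq: "(\<lambda>n. if even n then \<zero> else E n)(2 := n, 0 := a) =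
        (\<lambda>m. if even m then ((\<lambda>_. \<zero>)(0 := a, 1 := n)) (m div 2) else E m)" for a n
  proof
    fix m :: nat
    have "even m \<Longrightarrow> m div 2 = 0 \<longleftrightarrow> m = 0" "even m \<Longrightarrow> m div 2 = 1 \<longleftrightarrow> m = 2" by presburger+
    then show "((\<lambda>n. if even n then \<zero> else E n)(2 := n, 0 := a)) m =
        (if even m then ((\<lambda>_. \<zero>)(0 := a, 1 := n)) (m div 2) else E m)"
      by auto
  qed
  show thesis
    by (rule that[OF \<phi>(1-3), of "\<lambda>n. if even n then \<zero> else E n"])
      (simp_all only: eq \<phi>(4,5), simp_all)
qed

end

section \<open>Induction and comprehension for bounded predicates in a model of RCA0\<close>

locale rca0 = l2_structure +
  assumes rca0: RCA0
begin

lemma basic: basic_axioms and Sigma01_induction: Sigma01_induction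
  and Delta01_comprehension: Delta01_comprehension
  using rca0 by (auto simp: RCA0_def)

lemma Sigma_induct:
  assumes "D0 (\<lambda>e. P (e 0) (e 1))" "\<exists>a. P a \<zero>" "\<And>n a. P a n \<Longrightarrow> \<exists>a. P a (n \<oplus> \<one>)"
  shows "\<exists>a. P a n"
proof -
  obtain \<phi> \<psi> s E where \<phi>: "bounded_fm \<phi>" "bounded_fm \<psi>" "range s \<subseteq> \<S>"
    "\<And>a n. sat (E(2 := n, 0 := a)) s \<phi> = P a n" "\<And>a n. sat (E(2 := n, 0 := a)) s \<psi> = P a n"
    by (rule Sigma01_instance[OF assms(1) assms(1)]) (rule that)
  have "Sigma01 (ExN 0 \<phi>)" using \<phi>(1) by (rule Sigma01.intros)
  moreover have *: "sat (E(2 := n)) s (ExN 0 \<phi>) = (\<exists>a. P a n)" for n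
    using \<phi>(4) by simp
  moreover have "Sigma01 (ExN 0 \<phi>) \<longrightarrow> range s \<subseteq> \<S> \<longrightarrow> sat (E(2 := \<zero>)) s (ExN 0 \<phi>) \<longrightarrow>
      (\<forall>n. sat (E(2 := n)) s (ExN 0 \<phi>) \<longrightarrow> sat (E(2 := n \<oplus> \<one>)) s (ExN 0 \<phi>)) \<longrightarrow>
      (\<forall>n. sat (E(2 := n)) s (ExN 0 \<phi>))"
    by (rule Sigma01_induction[unfolded Sigma01_induction_def, THEN spec, THEN spec, THEN spec, THEN spec])
  moreover have "\<forall>n. (\<exists>a. P a n) \<longrightarrow> (\<exists>a. P a (n \<oplus> \<one>))"
    using assms(3) by (intro allI impI) (erule exE)
  ultimately have "\<forall>n. \<exists>a. P a n" using assms(2) \<phi>(3) unfolding * by iprover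
  then show ?thesis by (rule spec)
qed

lemma Delta_comp:
  assumes "D0 (\<lambda>e. P (e 0) (e 1))" "D0 (\<lambda>e. Q (e 0) (e 1))"
    and eq: "\<And>n. (\<exists>a. P a n) \<longleftrightarrow> (\<forall>a. Q a n)"
  shows "{n. \<exists>a. P a n} \<in> \<S>"
proof -
  obtain \<phi> \<psi> s E where \<phi>: "bounded_fm \<phi>" "bounded_fm \<psi>"
    "range s \<subseteq> \<S>" "\<And>a n. sat (E(2 := n, 0 := a)) s \<phi> = P a n" "\<And>a n. sat (E(2 := n, 0 := a)) s \<psi> = Q a n"
    by (rule Sigma01_instance[OF assms(1,2)]) (rule that)
  have "Sigma01 (ExN 0 \<phi>)" "Pi01 (AllN 0 \<psi>)" using \<phi>(1,2) by (auto intro: Sigma01.intros Pi01.intros)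
  moreover have "sat (E(2 := n)) s (ExN 0 \<phi>) = (\<exists>a. P a n)"
    "sat (E(2 := n)) s (AllN 0 \<psi>) = (\<forall>a. Q a n)" for n
    using \<phi>(4,5) by simp_all
  moreover have "Sigma01 (ExN 0 \<phi>) \<longrightarrow> Pi01 (AllN 0 \<psi>) \<longrightarrow> range s \<subseteq> \<S> \<longrightarrow>
      (\<forall>n. sat (E(2 := n)) s (ExN 0 \<phi>) \<longleftrightarrow> sat (E(2 := n)) s (AllN 0 \<psi>)) \<longrightarrow>
      (\<exists>X\<in>\<S>. \<forall>n. n \<in> X \<longleftrightarrow> sat (E(2 := n)) s (ExN 0 \<phi>))"
    by (rule Delta01_comprehension[unfolded Delta01_comprehension_def, THEN spec, THEN spec, THEN spec, THEN spec, THEN spec])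
  ultimately obtain X where "X \<in> \<S>" "\<forall>n. n \<in> X \<longleftrightarrow> (\<exists>a. P a n)"
    using \<phi>(3) eq by (auto simp del: sat.simps)
  moreover have "X = {n. \<exists>a. P a n}" using calculation by auto
  ultimately show ?thesis by simp
qed

lemma D0_rename:
  assumes "D0 P"
  shows "D0 (\<lambda>e. P (\<lambda>n. e (r n)))"
proof -
  obtain C F where C: "finite C" "finite F" "F \<subseteq> \<S>"
    and 1: "\<And>v u s. infinite (- range v) \<Longrightarrow> F \<subseteq> range s \<Longrightarrow> \<exists>\<phi>. fm_at v u C s P \<phi>"
    using assms unfolding D0_def by metis
  show ?thesis
    unfolding D0_def fm_at_def
  proof (intro exI[of _ C] exI[of _ F] conjI allI impI)
    fix v :: "nat \<Rightarrow> nat" and u :: "'a \<Rightarrow> nat" and s :: "nat \<Rightarrow> 'a set"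
    assume v: "infinite (- range v)" and s: "F \<subseteq> range s"
    have "infinite (- range (\<lambda>n. v (r n)))"
      by (rule infinite_super[OF _ v]) auto
    from 1[OF this s, of u] show "\<exists>\<phi>. bounded_fm \<phi> \<and> (\<forall>E. (\<forall>c\<in>C. E (u c) = c) \<longrightarrow>
        sat E s \<phi> = P (\<lambda>n. (E \<circ> v) (r n)))"
      by (simp add: fm_at_def o_def)
  qed (use C in auto)
qed

lemma D0_shift: "D0 (\<lambda>e. P (e 0)) \<Longrightarrow> D0 (\<lambda>e. P (e 1))"
  by (drule D0_rename[of _ Suc]) simp

lemma D0_comp: "D0 (\<lambda>e. P (e 0)) \<Longrightarrow> {n. P n} \<in> \<S>"
  using Delta_comp[of "\<lambda>a. P" "\<lambda>a. P", OF D0_shift D0_shift] by simp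

lemma D0_induct:
  assumes "D0 (\<lambda>e. P (e 0))" "P \<zero>" "\<And>n. P n \<Longrightarrow> P (n \<oplus> \<one>)"
  shows "P n"
proof -
  have "\<exists>a :: 'a. P n"
    by (rule Sigma_induct[of "\<lambda>a. P"]) (use assms D0_shift[of P] in auto)
  then show ?thesis by simp
qed

section \<open>Arithmetic\<close>


definition le (infix "\<preceq>" 50) where "a \<preceq> b \<longleftrightarrow> a \<prec> b \<or> a = b"

lemma D0_le: "tm t \<Longrightarrow> tm u \<Longrightarrow> D0 (\<lambda>e. t e \<preceq> u e)"
  unfolding le_def by (intro D0_disj D0_less D0_eq)

lemma
  shows succ_neq_0: "n \<oplus> \<one> \<noteq> \<zero>"
    and succ_inject: "m \<oplus> \<one> = n \<oplus> \<one> \<Longrightarrow> m = n"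
    and plus_0: "m \<oplus> \<zero> = m"
    and plus_succ: "m \<oplus> (n \<oplus> \<one>) = (m \<oplus> n) \<oplus> \<one>"
    and times_0: "m \<otimes> \<zero> = \<zero>"
    and times_succ: "m \<otimes> (n \<oplus> \<one>) = (m \<otimes> n) \<oplus> m"
    and not_less_0: "\<not> m \<prec> \<zero>"
    and less_succ: "m \<prec> n \<oplus> \<one> \<longleftrightarrow> m \<preceq> n"
  using basic unfolding basic_axioms_def le_def by blast+

lemma plus_assoc: "(a \<oplus> b) \<oplus> c = a \<oplus> (b \<oplus> c)"
  by (rule D0_induct[of "\<lambda>c. (a \<oplus> b) \<oplus> c = a \<oplus> (b \<oplus> c)"], intro D0_intros tm_intros, metis plus_0, metis plus_succ)

lemma zero_plus: "\<zero> \<oplus> a = a"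
  by (rule D0_induct[of "\<lambda>a. \<zero> \<oplus> a = a"], intro D0_intros tm_intros, metis plus_0, metis plus_succ)

lemma succ_plus: "(a \<oplus> \<one>) \<oplus> b = (a \<oplus> b) \<oplus> \<one>"
  by (rule D0_induct[of "\<lambda>b. (a \<oplus> \<one>) \<oplus> b = (a \<oplus> b) \<oplus> \<one>"], intro D0_intros tm_intros, metis plus_0, metis plus_succ)

lemma plus_comm: "a \<oplus> b = b \<oplus> a"
  by (rule D0_induct[of "\<lambda>a. a \<oplus> b = b \<oplus> a"], intro D0_intros tm_intros, metis plus_0 zero_plus, metis plus_succ succ_plus)

lemma plus_cancel: "a \<oplus> c = b \<oplus> c \<Longrightarrow> a = b"
  by (rule D0_induct[of "\<lambda>c. a \<oplus> c = b \<oplus> c \<longrightarrow> a = b", THEN mp], intro D0_intros tm_intros, metis plus_0, metis plus_succ succ_inject)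

lemma zero_times: "\<zero> \<otimes> a = \<zero>"
  by (rule D0_induct[of "\<lambda>a. \<zero> \<otimes> a = \<zero>"], intro D0_intros tm_intros, metis times_0, metis times_succ plus_0)

lemma times_plus: "a \<otimes> (b \<oplus> c) = a \<otimes> b \<oplus> a \<otimes> c"
  by (rule D0_induct[of "\<lambda>c. a \<otimes> (b \<oplus> c) = a \<otimes> b \<oplus> a \<otimes> c"], intro D0_intros tm_intros, metis plus_0 times_0, metis plus_succ times_succ plus_assoc)

lemma succ_times: "(a \<oplus> \<one>) \<otimes> b = a \<otimes> b \<oplus> b"
proof (rule D0_induct[of "\<lambda>b. (a \<oplus> \<one>) \<otimes> b = a \<otimes> b \<oplus> b"])
  show "D0 (\<lambda>e. (a \<oplus> \<one>) \<otimes> e 0 = a \<otimes> e 0 \<oplus> e 0)" by (intro D0_intros tm_intros)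
  show "(a \<oplus> \<one>) \<otimes> n = a \<otimes> n \<oplus> n \<Longrightarrow>
      (a \<oplus> \<one>) \<otimes> (n \<oplus> \<one>) = a \<otimes> (n \<oplus> \<one>) \<oplus> (n \<oplus> \<one>)" for n
    unfolding times_succ plus_succ by (metis plus_assoc plus_comm)
qed (metis plus_0 times_0)

lemma times_comm: "a \<otimes> b = b \<otimes> a"
  by (rule D0_induct[of "\<lambda>a. a \<otimes> b = b \<otimes> a"], intro D0_intros tm_intros, metis times_0 zero_times, metis times_succ succ_times)

lemma times_assoc: "(a \<otimes> b) \<otimes> c = a \<otimes> (b \<otimes> c)"
  by (rule D0_induct[of "\<lambda>c. (a \<otimes> b) \<otimes> c = a \<otimes> (b \<otimes> c)"], intro D0_intros tm_intros, metis times_0, metis times_succ times_plus)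

lemma times_one: "a \<otimes> \<one> = a"
  by (metis times_succ times_0 zero_plus)

lemma less_plus_succ: "m \<prec> m \<oplus> d \<oplus> \<one>"
  by (rule D0_induct[of "\<lambda>d. m \<prec> m \<oplus> d \<oplus> \<one>"], intro D0_intros tm_intros, metis plus_0 less_succ le_def, metis plus_succ less_succ le_def)

text \<open>For the forward direction, \<open>m \<prec> n\<close> is moved into the scope of the
  existential quantifier, which makes the claim a Sigma01 statement about \<open>n\<close>; where
  \<open>m \<prec> n\<close> fails, any \<open>d\<close> is a witness.\<close>

lemma less_iff: "m \<prec> n \<longleftrightarrow> (\<exists>d. n = m \<oplus> d \<oplus> \<one>)"
proof
  have "\<exists>d. m \<prec> n \<longrightarrow> n = m \<oplus> d \<oplus> \<one>"
    by (rule Sigma_induct[of "\<lambda>d n. m \<prec> n \<longrightarrow> n = m \<oplus> d \<oplus> \<one>"], intro D0_intros tm_intros, metis not_less_0, metis less_succ le_def plus_0 plus_succ)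
  then show "m \<prec> n \<Longrightarrow> \<exists>d. n = m \<oplus> d \<oplus> \<one>" by blast
qed (use less_plus_succ in auto)

lemma irrefl: "\<not> m \<prec> m"
  by (metis less_iff plus_0 plus_cancel plus_comm plus_succ succ_neq_0)

lemma trans: "a \<prec> b \<Longrightarrow> b \<prec> c \<Longrightarrow> a \<prec> c"
  unfolding less_iff by (metis plus_assoc plus_comm)

lemma zero_cases: "a = \<zero> \<or> (\<exists>b. a = b \<oplus> \<one>)"
proof -
  have "\<exists>b. a = \<zero> \<or> a = b \<oplus> \<one>"
    by (rule Sigma_induct[of "\<lambda>b a. a = \<zero> \<or> a = b \<oplus> \<one>"], intro D0_intros tm_intros, auto)
  then show ?thesis by blast
qed

lemma zero_le: "\<zero> \<preceq> a"
  using zero_cases[of a] by (metis le_def less_iff zero_plus)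

lemma linear: "a \<prec> b \<or> a = b \<or> b \<prec> a"
proof (rule D0_induct[of "\<lambda>b. a \<prec> b \<or> a = b \<or> b \<prec> a"])
  show "D0 (\<lambda>e. a \<prec> e 0 \<or> a = e 0 \<or> e 0 \<prec> a)" by (intro D0_intros tm_intros)
  show "a \<prec> \<zero> \<or> a = \<zero> \<or> \<zero> \<prec> a" using zero_le le_def by auto
  fix n assume "a \<prec> n \<or> a = n \<or> n \<prec> a"
  then consider "a \<prec> n \<oplus> \<one>" | d where "a = n \<oplus> d \<oplus> \<one>" by (metis less_succ le_def less_iff)
  then show "a \<prec> n \<oplus> \<one> \<or> a = n \<oplus> \<one> \<or> n \<oplus> \<one> \<prec> a"
  proof cases
    case (2 d)
    then show ?thesis using zero_cases[of d] by (metis less_iff plus_0 plus_succ succ_plus)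
  qed auto
qed

lemma le_iff: "a \<preceq> b \<longleftrightarrow> (\<exists>d. b = a \<oplus> d)"
  unfolding le_def by (metis less_iff plus_0 plus_assoc zero_cases)

text \<open>Truncated subtraction is not in the language of arithmetic; it is introduced because
  \<open>linordered_semidom\<close> asks for it.\<close>

definition minus (infixl "\<ominus>" 65) where
  "a \<ominus> b = (if b \<preceq> a then THE d. a = b \<oplus> d else \<zero>)"

lemma plus_minus: "(a \<oplus> b) \<ominus> b = a"
proof -
  have "(THE d. a \<oplus> b = b \<oplus> d) = a" by (rule the_equality) (metis plus_comm plus_cancel)+
  then show ?thesis unfolding minus_def by (metis le_iff plus_comm)
qed

lemma zero_minus: "\<zero> \<ominus> a = \<zero>"
proof (cases "a = \<zero>")
  case True then show ?thesis by (metis plus_minus plus_0)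
next
  case False then show ?thesis unfolding minus_def le_def using not_less_0 by auto
qed

lemma plus_less: "a \<prec> b \<Longrightarrow> c \<oplus> a \<prec> c \<oplus> b"
  by (metis less_iff plus_assoc)

lemma minus_minus: "(a \<ominus> b) \<ominus> c = a \<ominus> (b \<oplus> c)"
proof (cases "b \<preceq> a")
  case True
  then obtain d where d: "a = b \<oplus> d" using le_iff by blast
  then have 1: "a \<ominus> b = d" by (metis plus_minus plus_comm)
  show ?thesis
  proof (cases "c \<preceq> d")
    case True
    then obtain f where f: "d = c \<oplus> f" using le_iff by blast
    then show ?thesis using d 1 by (metis plus_minus plus_comm plus_assoc)
  next
    case False
    then have "\<not> b \<oplus> c \<preceq> a" unfolding d le_iff by (metis plus_assoc plus_cancel plus_comm)
    then show ?thesis using False 1 unfolding minus_def by auto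
  qed
next
  case False
  then have "\<not> b \<oplus> c \<preceq> a" unfolding le_iff by (metis plus_assoc)
  then have "a \<ominus> (b \<oplus> c) = \<zero>" unfolding minus_def by auto
  moreover have "a \<ominus> b = \<zero>" using False unfolding minus_def by auto
  ultimately show ?thesis by (simp add: zero_minus)
qed

lemma times_less: "a \<prec> b \<Longrightarrow> \<zero> \<prec> c \<Longrightarrow> c \<otimes> a \<prec> c \<otimes> b"
proof -
  assume "a \<prec> b" "\<zero> \<prec> c"
  then obtain d e where "b = a \<oplus> d \<oplus> \<one>" "c = e \<oplus> \<one>"
    unfolding less_iff by (metis zero_plus)
  then have "c \<otimes> b = c \<otimes> a \<oplus> (c \<otimes> d \<oplus> e) \<oplus> \<one>"
    by (metis plus_assoc times_plus times_one)
  then show ?thesis using less_iff by blast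
qed

lemma le_minus: "a \<preceq> b \<Longrightarrow> a \<ominus> b = \<zero>"
  by (cases "a = b") (metis plus_minus zero_plus, metis le_def minus_def trans irrefl)

lemma times_minus: "a \<otimes> (b \<ominus> c) = a \<otimes> b \<ominus> a \<otimes> c"
proof (cases "c \<preceq> b")
  case True
  then obtain d where "b = c \<oplus> d" using le_iff by blast
  then show ?thesis by (metis plus_minus plus_comm times_plus)
next
  case False
  then have "b \<preceq> c" using linear unfolding le_def by blast
  then obtain d where "c = b \<oplus> d" using le_iff by blast
  then have "a \<otimes> b \<preceq> a \<otimes> c" by (metis le_iff times_plus)
  with \<open>b \<preceq> c\<close> show ?thesis by (simp add: le_minus times_0)
qed

text \<open>This makes the possibly nonstandard numbers an ordered semiring in the sense of the
  library, whose lemmas are available from here on with the prefix \<open>N\<close>.\<close>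

sublocale N: linordered_semidom "(\<oplus>)" "(\<ominus>)" "(\<preceq>)" "(\<prec>)" \<zero> "(\<otimes>)" \<one>
proof unfold_locales
  show "\<zero> \<noteq> \<one>" by (metis succ_neq_0 zero_plus)
  show "a \<otimes> b \<noteq> \<zero>" if "a \<noteq> \<zero>" "b \<noteq> \<zero>" for a b
    using that times_less[of \<zero> b a] zero_le times_0 not_less_0 le_def by metis
  show "a \<prec> b \<longleftrightarrow> a \<preceq> b \<and> \<not> b \<preceq> a" for a b unfolding le_def using irrefl trans by blast
  show "b \<preceq> a \<Longrightarrow> (a \<ominus> b) \<oplus> b = a" for a b by (metis le_iff plus_minus plus_comm)
  show "c \<oplus> a \<preceq> c \<oplus> b" if "a \<preceq> b" for a b c using that plus_less unfolding le_def by blast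
  show "a \<oplus> b \<ominus> a = b" for a b by (metis plus_minus plus_comm)
  show "(a \<otimes> b) \<otimes> c = a \<otimes> (b \<otimes> c)" for a b c by (rule times_assoc)
  show "a \<ominus> b \<ominus> c = a \<ominus> (b \<oplus> c)" for a b c by (rule minus_minus)
  show "c \<otimes> a \<prec> c \<otimes> b" if "a \<prec> b" "\<zero> \<prec> c" for a b c using that by (rule times_less)
  show "(a \<oplus> b) \<otimes> c = a \<otimes> c \<oplus> b \<otimes> c" for a b c by (metis times_plus times_comm)
  show "\<zero> \<prec> \<one>" by (metis less_succ le_def zero_plus)
  show "a \<preceq> a" for a by (simp add: le_def)
  show "a \<preceq> b \<Longrightarrow> b \<preceq> c \<Longrightarrow> a \<preceq> c" for a b c unfolding le_def using trans by blast
  show "a \<preceq> b \<Longrightarrow> b \<preceq> a \<Longrightarrow> a = b" for a b unfolding le_def using irrefl trans by blast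
  show "a \<preceq> b \<or> b \<preceq> a" for a b unfolding le_def using linear by blast
  show "a \<oplus> b \<oplus> c = a \<oplus> (b \<oplus> c)" for a b c by (rule plus_assoc)
  show "a \<oplus> b = b \<oplus> a" for a b by (rule plus_comm)
  show "a \<otimes> b = b \<otimes> a" for a b by (rule times_comm)
qed (simp_all add: zero_plus zero_times times_0 zero_minus times_comm[of \<one>] times_one plus_0 times_minus times_plus)

lemma le_plus [simp]: "a \<preceq> a \<oplus> b" "a \<preceq> b \<oplus> a"
  using le_iff plus_comm by blast+

declare zero_le [simp] less_succ [simp] not_less_0 [simp] succ_neq_0 [simp] succ_neq_0 [symmetric, simp]

lemma succ_le [simp]: "m \<oplus> \<one> \<preceq> n \<longleftrightarrow> m \<prec> n"
  by (metis N.not_le less_succ)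

lemma le_times: "a \<preceq> a \<otimes> a"
proof (cases "a = \<zero>")
  case False
  then have "\<one> \<preceq> a" by (metis N.not_le le_def less_succ zero_plus not_less_0)
  then have "a \<otimes> \<one> \<preceq> a \<otimes> a" by (intro N.mult_left_mono) auto
  then show ?thesis by simp
qed simp

section \<open>Pairing\<close>

lemma le_pair: "i \<oplus> j \<preceq> pair i j" "i \<preceq> pair i j" "j \<preceq> pair i j"
proof -
  show *: "i \<oplus> j \<preceq> pair i j"
    unfolding pair_def by (rule N.order_trans[OF le_times le_plus(1)])
  show "i \<preceq> pair i j" "j \<preceq> pair i j"
    by (rule N.order_trans[OF _ *], rule le_plus)+
qed

text \<open>With \<open>s = i \<oplus> j\<close> the code is
  \<open>s \<otimes> s \<oplus> i\<close>, where \<open>i \<preceq> s\<close>. So the codes of pairs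
  with sum \<open>s\<close> lie between the squares of \<open>s\<close> and
  \<open>s \<oplus> \<one>\<close>, and a code determines first the sum and then
  \<open>i\<close>.\<close>

lemma pair_less_square: "pair i j \<prec> (i \<oplus> j \<oplus> \<one>) \<otimes> (i \<oplus> j \<oplus> \<one>)"
proof -
  have "(i \<oplus> j \<oplus> \<one>) \<otimes> (i \<oplus> j \<oplus> \<one>) = pair i j \<oplus> (i \<oplus> j \<oplus> j) \<oplus> \<one>"
    unfolding pair_def by (simp add: algebra_simps)
  then show ?thesis by (simp add: less_succ)
qed

lemma pair_inject' : "pair i j = pair i' j' \<Longrightarrow> i = i' \<and> j = j'"
proof -
  have *: False if "i \<oplus> j \<prec> i' \<oplus> j'" "pair i j = pair i' j'" for i j i' j'
  proof -
    have "i \<oplus> j \<oplus> \<one> \<preceq> i' \<oplus> j'" using that by simp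
    then have "(i \<oplus> j \<oplus> \<one>) \<otimes> (i \<oplus> j \<oplus> \<one>) \<preceq> (i' \<oplus> j') \<otimes> (i' \<oplus> j')"
      by (intro N.mult_mono) auto
    also have "\<dots> \<preceq> pair i' j'" unfolding pair_def by simp
    finally show False using pair_less_square[of i j] that(2) N.not_le by metis
  qed
  assume eq: "pair i j = pair i' j'"
  have s: "i \<oplus> j = i' \<oplus> j'" using *[of i j i' j'] *[of i' j' i j] eq linear by metis
  then have "i = i'" using eq unfolding pair_def by simp
  then show ?thesis using s by simp
qed

lemma pair_inject [simp]: "pair i j = pair i' j' \<longleftrightarrow> i = i' \<and> j = j'"
  using pair_inject' by blast

section \<open>Finite sets and sequences\<close>


lemma D0_ex_le:
  assumes "tm t" "D0 (\<lambda>e. P (\<lambda>n. e (Suc n)) (e 0))"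
  shows "D0 (\<lambda>e. \<exists>a. a \<preceq> t e \<and> P e a)"
  using D0_ex[OF tm_plus[OF assms(1) tm_const[of \<one>]] assms(2)] by simp

text \<open>A term is substituted for an entry by means of a bounded quantifier
  \<open>a \<preceq> t e\<close> together with \<open>a = t e\<close>. Thus a predicate need be
  shown \<open>D0\<close> only at variables to be usable at all terms.\<close>

lemma D0_subst1:
  assumes "D0 (\<lambda>e. Q (e 0))" "tm t"
  shows "D0 (\<lambda>e. Q (t e))"
proof -
  have "D0 (\<lambda>e. \<exists>a. a \<preceq> t e \<and> (a = t e \<and> Q a))"
    by (intro D0_ex_le D0_conj D0_eq tm_var assms tm_rename[OF assms(2)])
  then show ?thesis by simp
qed

lemma D0_subst2:
  assumes "D0 (\<lambda>e. Q (e 0) (e 1))" "tm t" "tm u"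
  shows "D0 (\<lambda>e. Q (t e) (u e))"
proof -
  have "D0 (\<lambda>e. \<exists>b. b \<preceq> u e \<and> (\<exists>a. a \<preceq> t e \<and> (b = u e \<and> (a = t e \<and> Q a b))))"
    by (intro D0_ex_le D0_conj D0_eq tm_var assms
        tm_rename[OF assms(2)] tm_rename[OF assms(3), of "\<lambda>n. Suc (Suc n)"] tm_rename[OF assms(3)])
      (use assms(1) in simp)
  then show ?thesis by simp
qed

lemma D0_subst3:
  assumes "D0 (\<lambda>e. Q (e 0) (e 1) (e 2))" "tm t" "tm u" "tm w"
  shows "D0 (\<lambda>e. Q (t e) (u e) (w e))"
proof -
  have "D0 (\<lambda>e. \<exists>c. c \<preceq> w e \<and> (\<exists>b. b \<preceq> u e \<and> (\<exists>a. a \<preceq> t e \<and> (c = w e \<and> (b = u e \<and> (a = t e \<and> Q a b c))))))"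
    by (intro D0_ex_le D0_conj D0_eq tm_var assms tm_rename[OF assms(2)] tm_rename[OF assms(3)]
       tm_rename[OF assms(4)] tm_rename[OF assms(2), of "\<lambda>n. Suc (Suc n)"] tm_rename[OF assms(3), of "\<lambda>n. Suc (Suc n)"]
       tm_rename[OF assms(4), of "\<lambda>n. Suc (Suc n)"] tm_rename[OF assms(2), of "\<lambda>n. Suc (Suc (Suc n))"]
       tm_rename[OF assms(3), of "\<lambda>n. Suc (Suc (Suc n))"] tm_rename[OF assms(4), of "\<lambda>n. Suc (Suc (Suc n))"])
      (use assms(1) in \<open>simp add: numeral_2_eq_2\<close>)
  then show ?thesis by simp
qed

lemma least_number:
  assumes "D0 (\<lambda>e. P (e 0))" "P n"
  obtains m where "P m" "\<And>i. i \<prec> m \<Longrightarrow> \<not> P i" "m \<preceq> n"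
proof -
  have "\<exists>m. P m \<and> (\<forall>i. i \<prec> m \<longrightarrow> \<not> P i)"
  proof (rule ccontr)
    assume no: "\<nexists>m. P m \<and> (\<forall>i. i \<prec> m \<longrightarrow> \<not> P i)"
    have "\<forall>i. i \<prec> n \<longrightarrow> \<not> P i"
    proof (rule D0_induct[of "\<lambda>n. \<forall>i. i \<prec> n \<longrightarrow> \<not> P i"])
      show "D0 (\<lambda>e. \<forall>i. i \<prec> e 0 \<longrightarrow> \<not> P i)" by (intro D0_intros tm_intros assms(1))
      show "\<forall>i. i \<prec> n \<longrightarrow> \<not> P i \<Longrightarrow> \<forall>i. i \<prec> n \<oplus> \<one> \<longrightarrow> \<not> P i" for n
        using no unfolding less_succ le_def by blast
    qed auto
    then show False using no assms(2) by blast
  qed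
  then obtain m where "P m" "\<forall>i. i \<prec> m \<longrightarrow> \<not> P i" by blast
  then show thesis using that assms(2) N.not_le by blast
qed

abbreviation N_dvd (infix "\<ddagger>" 50) where "a \<ddagger> b \<equiv> dvd.dvd (\<otimes>) a b"

lemma dvd_iff: "a \<oplus> \<one> \<ddagger> b \<longleftrightarrow> (\<exists>d. d \<preceq> b \<and> b = (a \<oplus> \<one>) \<otimes> d)"
proof -
  have "d \<preceq> (a \<oplus> \<one>) \<otimes> d" for d by (simp add: algebra_simps)
  then show ?thesis unfolding N.dvd_def by blast
qed

text \<open>The components of a code do not exceed it, and the quotient by a positive divisor does
  not exceed \<open>n\<close>; this bounds all quantifiers. The equivalences for
  \<open>triple\<close>, \<open>finite_set_code\<close> and \<open>seq\<close> below serve the same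
  purpose.\<close>

lemma elems_iff: "i \<in> elems c \<longleftrightarrow> (\<exists>k. k \<preceq> c \<and> (\<exists>m. m \<preceq> c \<and> (\<exists>n. n \<preceq> c \<and> (c = pair k (pair m n) \<and> (i \<prec> k \<and>
   (\<exists>d. d \<preceq> n \<and> n = (m \<otimes> (i \<oplus> \<one>) \<oplus> \<one>) \<otimes> d))))))"
proof -
  have "k \<preceq> c \<and> m \<preceq> c \<and> n \<preceq> c" if "c = pair k (pair m n)" for k m n
    using that le_pair N.order_trans by blast
  moreover have "n = (m \<otimes> (i \<oplus> \<one>) \<oplus> \<one>) \<otimes> d \<Longrightarrow> d \<preceq> n" for n m d
    by (simp add: algebra_simps)
  ultimately show ?thesis unfolding elems_def by blast
qed

lemma D0_elems: "tm t \<Longrightarrow> tm u \<Longrightarrow> D0 (\<lambda>e. t e \<in> elems (u e))"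
proof (rule D0_subst2[of "\<lambda>i c. i \<in> elems c"])
  show "D0 (\<lambda>e. e 0 \<in> elems (e 1))"
    unfolding elems_iff by (intro D0_intros tm_intros D0_ex_le)
qed

lemma elems_pair: "i \<in> elems (pair k (pair m n)) \<longleftrightarrow> i \<prec> k \<and> m \<otimes> (i \<oplus> \<one>) \<oplus> \<one> \<ddagger> n"
  unfolding elems_def N.dvd_def by auto

lemma elems_less: "i \<in> elems c \<Longrightarrow> i \<prec> c"
  unfolding elems_def using le_pair N.less_le_trans by blast

lemma triple_iff: "triple c \<longleftrightarrow> (\<exists>k. k \<preceq> c \<and> (\<exists>m. m \<preceq> c \<and> (\<exists>n. n \<preceq> c \<and> c = pair k (pair m n))))"
proof -
  have "k \<preceq> c \<and> m \<preceq> c \<and> n \<preceq> c" if "c = pair k (pair m n)" for k m n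
    using that le_pair N.order_trans by blast
  then show ?thesis unfolding triple_def by blast
qed

lemma finite_set_code_iff: "finite_set_code c \<longleftrightarrow> triple c \<and>
    (\<forall>c'. c' \<prec> c \<longrightarrow> triple c' \<longrightarrow> (\<exists>i. i \<prec> c \<and> \<not> (i \<in> elems c' \<longleftrightarrow> i \<in> elems c)))"
proof -
  have "elems c' \<noteq> elems c \<longleftrightarrow> (\<exists>i. i \<prec> c \<and> \<not> (i \<in> elems c' \<longleftrightarrow> i \<in> elems c))" if "c' \<prec> c" for c'
    using elems_less that N.less_trans by blast
  then show ?thesis unfolding finite_set_code_def by blast
qed

lemma D0_triple: "tm t \<Longrightarrow> D0 (\<lambda>e. triple (t e))"
proof (rule D0_subst1[of triple])
  show "D0 (\<lambda>e. triple (e 0))"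
    unfolding triple_iff by (intro D0_intros tm_intros D0_ex_le)
qed

lemma D0_finite_set_code: "tm t \<Longrightarrow> D0 (\<lambda>e. finite_set_code (t e))"
proof (rule D0_subst1[of finite_set_code])
  show "D0 (\<lambda>e. finite_set_code (e 0))"
    unfolding finite_set_code_iff by (intro D0_intros tm_intros D0_triple D0_elems)
qed

lemma seq_iff: "seq \<sigma> l \<longleftrightarrow> finite_set_code \<sigma> \<and>
    (\<forall>z. z \<prec> \<sigma> \<longrightarrow> z \<in> elems \<sigma> \<longrightarrow> (\<exists>i. i \<prec> l \<and> (\<exists>j. j \<preceq> z \<and> z = pair i j))) \<and>
    (\<forall>i. i \<prec> l \<longrightarrow> (\<exists>j. j \<prec> \<sigma> \<and> pair i j \<in> elems \<sigma> \<and> (\<forall>j'. j' \<prec> \<sigma> \<longrightarrow> pair i j' \<in> elems \<sigma> \<longrightarrow> j' = j)))"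
proof -
  have *: "pair i j \<in> elems \<sigma> \<Longrightarrow> j \<prec> \<sigma>" for i j
    using le_pair elems_less N.le_less_trans by blast
  have "(\<exists>i\<in>{i. i \<prec> l}. \<exists>j\<in>UNIV. z = pair i j) \<longleftrightarrow> (\<exists>i. i \<prec> l \<and> (\<exists>j. j \<preceq> z \<and> z = pair i j))" for z
    using le_pair(3) by auto
  then have "(\<forall>z\<in>elems \<sigma>. \<exists>i\<in>{i. i \<prec> l}. \<exists>j\<in>UNIV. z = pair i j) \<longleftrightarrow>
    (\<forall>z. z \<prec> \<sigma> \<longrightarrow> z \<in> elems \<sigma> \<longrightarrow> (\<exists>i. i \<prec> l \<and> (\<exists>j. j \<preceq> z \<and> z = pair i j)))"
    using elems_less by auto
  moreover have "(\<forall>i\<in>{i. i \<prec> l}. \<exists>!j. pair i j \<in> elems \<sigma>) \<longleftrightarrow>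
    (\<forall>i. i \<prec> l \<longrightarrow> (\<exists>j. j \<prec> \<sigma> \<and> pair i j \<in> elems \<sigma> \<and> (\<forall>j'. j' \<prec> \<sigma> \<longrightarrow> pair i j' \<in> elems \<sigma> \<longrightarrow> j' = j)))"
    using * by blast
  ultimately show ?thesis unfolding seq_def function_on_def by simp
qed

lemma D0_seq: "tm t \<Longrightarrow> tm u \<Longrightarrow> D0 (\<lambda>e. seq (t e) (u e))"
proof (rule D0_subst2[of seq])
  show "D0 (\<lambda>e. seq (e 0) (e 1))"
    unfolding seq_iff by (intro D0_intros tm_intros D0_elems D0_finite_set_code D0_ex_le)
qed

section \<open>Uniqueness and existence of codes of finite sets\<close>

lemma finite_set_code_unique:
  "finite_set_code c \<Longrightarrow> finite_set_code c' \<Longrightarrow> elems c = elems c' \<Longrightarrow> c = c'"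
  unfolding finite_set_code_def using linear by metis

text \<open>The moduli \<open>m (i + 1) + 1\<close> for \<open>i < k\<close> are pairwise coprime if all positive numbers
  up to \<open>k\<close> divide \<open>m\<close>.\<close>

lemma modulus_coprime:
  assumes m: "m = f \<otimes> e"
    and q: "m \<otimes> (j \<oplus> \<one>) \<oplus> \<one> = m \<otimes> (i \<oplus> \<one>) \<oplus> \<one> \<oplus> m \<otimes> f \<or>
            m \<otimes> (i \<oplus> \<one>) \<oplus> \<one> = m \<otimes> (j \<oplus> \<one>) \<oplus> \<one> \<oplus> m \<otimes> f"
    and d: "m \<otimes> (i \<oplus> \<one>) \<oplus> \<one> \<ddagger> x \<otimes> (m \<otimes> (j \<oplus> \<one>) \<oplus> \<one>)"
  shows "m \<otimes> (i \<oplus> \<one>) \<oplus> \<one> \<ddagger> x"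
proof -
  define p where "p = m \<otimes> (i \<oplus> \<one>) \<oplus> \<one>"
  define q' where "q' = m \<otimes> (j \<oplus> \<one>) \<oplus> \<one>"
  \<comment> \<open>This says that \<open>p\<close> is prime to \<open>m\<close>: the product of
    \<open>p\<close> and \<open>y\<close> is
    \<open>(y \<otimes> m) \<otimes> (i \<oplus> \<one>) \<oplus> y\<close>, so if \<open>p\<close>
    divides the first summand it divides \<open>y\<close>.\<close>
  have 1: "p \<ddagger> y" if "p \<ddagger> y \<otimes> m" for y
  proof -
    have "p \<ddagger> (y \<otimes> m) \<otimes> (i \<oplus> \<one>)" using that by (rule N.dvd_mult2)
    moreover have "p \<ddagger> (y \<otimes> m) \<otimes> (i \<oplus> \<one>) \<oplus> y"
      using N.dvd_triv_right[of p y] unfolding p_def by (simp add: algebra_simps)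
    ultimately show ?thesis using N.dvd_add_right_iff by blast
  qed
  \<comment> \<open>The two moduli differ by \<open>m \<otimes> f\<close>, and \<open>p\<close>
    divides \<open>x\<close> times either of them.\<close>
  have "p \<ddagger> x \<otimes> m \<otimes> f"
  proof (cases "q' = p \<oplus> m \<otimes> f")
    case True
    then have "x \<otimes> q' = x \<otimes> p \<oplus> x \<otimes> m \<otimes> f" by (simp add: algebra_simps)
    then show ?thesis using d N.dvd_add_right_iff[of p "x \<otimes> p" "x \<otimes> m \<otimes> f"]
      unfolding p_def[symmetric] q'_def[symmetric] by simp
  next
    case False
    then have "p = q' \<oplus> m \<otimes> f" using q unfolding p_def q'_def by simp
    then have "x \<otimes> p = x \<otimes> q' \<oplus> x \<otimes> m \<otimes> f" by (simp add: algebra_simps)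
    then show ?thesis using d N.dvd_add_right_iff[of p "x \<otimes> q'" "x \<otimes> m \<otimes> f"] N.dvd_triv_right[of p x]
      unfolding p_def[symmetric] q'_def[symmetric] by simp
  qed
  \<comment> \<open>Here \<open>m\<close> is cancelled. Multiplication by \<open>e\<close> turns
    \<open>x \<otimes> f\<close> into \<open>x \<otimes> m\<close>, because \<open>f\<close> divides
    \<open>m\<close>, and then \<open>m\<close> is cancelled once more.\<close>
  then have "p \<ddagger> x \<otimes> f" using 1[of "x \<otimes> f"] by (simp add: algebra_simps)
  then have "p \<ddagger> x \<otimes> m" unfolding m using N.dvd_mult2[of p "x \<otimes> f" e] by (simp add: algebra_simps)
  then show ?thesis using 1 unfolding p_def by blast
qed

lemma plus_eq_0: "a \<oplus> b = \<zero> \<Longrightarrow> b = \<zero>"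
  using zero_cases[of b] by (metis plus_succ succ_neq_0)

lemma ex_common_multiple: "\<exists>m. m \<noteq> \<zero> \<and> (\<forall>i. i \<prec> k \<longrightarrow> i \<oplus> \<one> \<ddagger> m)"
proof (rule Sigma_induct[of "\<lambda>m k. m \<noteq> \<zero> \<and> (\<forall>i. i \<prec> k \<longrightarrow> i \<oplus> \<one> \<ddagger> m)"])
  show "D0 (\<lambda>e. e 0 \<noteq> \<zero> \<and> (\<forall>i. i \<prec> e 1 \<longrightarrow> i \<oplus> \<one> \<ddagger> e 0))"
    unfolding dvd_iff by (intro D0_intros tm_intros D0_ex_le)
  show "\<exists>m. m \<noteq> \<zero> \<and> (\<forall>i. i \<prec> \<zero> \<longrightarrow> i \<oplus> \<one> \<ddagger> m)" by (intro exI[of _ \<one>]) simp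
  fix n m assume "m \<noteq> \<zero> \<and> (\<forall>i. i \<prec> n \<longrightarrow> i \<oplus> \<one> \<ddagger> m)"
  then show "\<exists>m. m \<noteq> \<zero> \<and> (\<forall>i. i \<prec> n \<oplus> \<one> \<longrightarrow> i \<oplus> \<one> \<ddagger> m)"
    by (intro exI[of _ "m \<otimes> (n \<oplus> \<one>)"]) (auto simp: le_def)
qed

text \<open>This is the idea of Goedel's beta function: the product of the moduli \<open>p j\<close>
  with \<open>j \<in> X\<close> and \<open>j \<prec> k\<close> is divisible by exactly these moduli
  among the first \<open>k\<close>, because they are pairwise coprime.\<close>

lemma ex_triple:
  assumes "X \<in> \<S>"
  shows "\<exists>c. triple c \<and> elems c = {i \<in> X. i \<prec> k}"
proof -
  obtain m where m: "m \<noteq> \<zero>" "\<And>i. i \<prec> k \<Longrightarrow> i \<oplus> \<one> \<ddagger> m" using ex_common_multiple by blast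
  define p where "p i = m \<otimes> (i \<oplus> \<one>) \<oplus> \<one>" for i
  have cop: "p i \<ddagger> x" if ij: "i \<prec> k" "j \<prec> k" "i \<noteq> j" and dv: "p i \<ddagger> x \<otimes> p j" for i j x
  proof -
    obtain f where f: "f \<prec> k" "j = i \<oplus> (f \<oplus> \<one>) \<or> i = j \<oplus> (f \<oplus> \<one>)"
    proof -
      from linear[of i j] ij(3) obtain f where "j = i \<oplus> f \<oplus> \<one> \<or> i = j \<oplus> f \<oplus> \<one>"
        unfolding less_iff by blast
      moreover have "f \<prec> i \<oplus> f \<oplus> \<one>" "f \<prec> j \<oplus> f \<oplus> \<one>" by simp_all
      ultimately show thesis using that[of f] ij(1,2) N.less_trans N.add.assoc by metis
    qed
    \<comment> \<open>The distance of \<open>i\<close> and \<open>j\<close> is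
      \<open>f \<oplus> \<one>\<close> with \<open>f \<prec> k\<close>, so it divides
      \<open>m\<close>.\<close>
    from m(2)[OF f(1)] obtain e where e: "m = (f \<oplus> \<one>) \<otimes> e" unfolding N.dvd_def by blast
    show ?thesis
      unfolding p_def
      by (rule modulus_coprime[OF e, where j = j]) (use f(2) dv in \<open>auto simp: p_def algebra_simps\<close>)
  qed
  \<comment> \<open>The product is built by Sigma01 induction on \<open>j\<close>, one factor at a
    time. The guard \<open>j \<preceq> k\<close> keeps to indices whose moduli are known to be
    coprime.\<close>
  have "\<exists>n. j \<preceq> k \<longrightarrow> (\<forall>i. i \<prec> k \<longrightarrow> (p i \<ddagger> n \<longleftrightarrow> i \<in> X \<and> i \<prec> j))"
    (is "\<exists>n. ?P n j") for j
  proof (rule Sigma_induct[of ?P])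
    show "D0 (\<lambda>e. ?P (e 0) (e 1))"
      unfolding dvd_iff p_def by (intro D0_intros tm_intros D0_ex_le D0_le assms)
    show "\<exists>n. ?P n \<zero>"
    proof (intro exI[of _ \<one>] impI allI)
      fix i
      \<comment> \<open>The empty product is 1, which no modulus divides since \<open>m\<close> is
        not 0.\<close>
      have "\<not> p i \<ddagger> \<one>"
      proof
        assume "p i \<ddagger> \<one>"
        then obtain d where d: "\<one> = p i \<otimes> d" unfolding N.dvd_def by blast
        then obtain d' where d': "d = d' \<oplus> \<one>"
          using zero_cases[of d] by (metis times_0 succ_neq_0 zero_plus)
        have "p i \<otimes> d = (p i \<otimes> d' \<oplus> m \<otimes> (i \<oplus> \<one>)) \<oplus> \<one>"
          unfolding d' p_def by (simp add: algebra_simps)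
        then have "p i \<otimes> d' \<oplus> m \<otimes> (i \<oplus> \<one>) = \<zero>"
          using succ_inject[of \<zero>] d by (metis zero_plus)
        then have "m \<otimes> (i \<oplus> \<one>) = \<zero>" by (rule plus_eq_0)
        then show False using m(1) by simp
      qed
      then show "p i \<ddagger> \<one> \<longleftrightarrow> i \<in> X \<and> i \<prec> \<zero>" by simp
    qed
    fix j n assume IH: "?P n j"
    show "\<exists>n. ?P n (j \<oplus> \<one>)"
    proof (cases "j \<in> X")
      case False
      then show ?thesis using IH by (intro exI[of _ n]) (auto simp: le_def[of _ j] N.less_imp_le)
    next
      case True
      show ?thesis
      proof (intro exI[of _ "n \<otimes> p j"] impI allI)
        fix i assume *: "j \<oplus> \<one> \<preceq> k" "i \<prec> k"
        then have "j \<prec> k" by simp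
        show "p i \<ddagger> n \<otimes> p j \<longleftrightarrow> i \<in> X \<and> i \<prec> j \<oplus> \<one>"
        proof (cases "i = j")
          case False
          then have "p i \<ddagger> n \<otimes> p j \<longleftrightarrow> p i \<ddagger> n" using cop[OF *(2) \<open>j \<prec> k\<close>] N.dvd_mult2 by blast
          then show ?thesis using IH *(2) \<open>j \<prec> k\<close> False by (auto simp: le_def[of _ j] N.less_imp_le)
        qed (use True in auto)
      qed
    qed
  qed
  from this[of k] obtain n where "\<forall>i. i \<prec> k \<longrightarrow> (p i \<ddagger> n \<longleftrightarrow> i \<in> X \<and> i \<prec> k)" by auto
  then have "elems (pair k (pair m n)) = {i \<in> X. i \<prec> k}"
    unfolding p_def by (auto simp: elems_pair)
  then show ?thesis unfolding triple_def by blast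
qed

text \<open>The code is the least triple with the given elements. The least number principle applies
  since elements are smaller than their triple, so that equality of two such sets is a bounded
  statement.\<close>

lemma ex_finite_set_code:
  assumes "X \<in> \<S>"
  shows "\<exists>c. finite_set_code c \<and> elems c = {i \<in> X. i \<prec> k}"
proof -
  obtain c0 where c0: "triple c0" "elems c0 = {i \<in> X. i \<prec> k}" using ex_triple[OF assms] by blast
  define Q where "Q c \<longleftrightarrow> triple c \<and> (\<forall>i. i \<prec> c \<oplus> c0 \<longrightarrow> (i \<in> elems c \<longleftrightarrow> i \<in> elems c0))" for c
  have Q: "Q c \<longleftrightarrow> triple c \<and> elems c = elems c0" for c
  proof -
    have "i \<in> elems c \<or> i \<in> elems c0 \<Longrightarrow> i \<prec> c \<oplus> c0" for i
      using elems_less N.less_le_trans le_plus by blast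
    then show ?thesis unfolding Q_def by blast
  qed
  have "D0 (\<lambda>e. Q (e 0))" unfolding Q_def by (intro D0_intros tm_intros D0_triple D0_elems)
  moreover have "Q c0" using Q c0 by simp
  ultimately obtain c where "Q c" "\<And>i. i \<prec> c \<Longrightarrow> \<not> Q i" by (rule least_number) blast
  then have "finite_set_code c" "elems c = elems c0" unfolding Q finite_set_code_def by auto
  then show ?thesis using c0 by blast
qed


lemma D0_ex_pair:
  assumes "tm t" "D0 (\<lambda>e. P (\<lambda>n. e (Suc (Suc n))) (e (Suc 0)) (e 0))"
  shows "D0 (\<lambda>e. \<exists>i j. t e = pair i j \<and> P e i j)"
proof -
  have "D0 (\<lambda>e. \<exists>i. i \<preceq> t e \<and> (\<exists>j. j \<preceq> t e \<and> (t e = pair i j \<and> P e i j)))"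
    by (intro D0_ex_le D0_conj D0_eq tm_intros assms tm_rename[OF assms(1)]
        tm_rename[OF assms(1), of "\<lambda>n. Suc (Suc n)"])
  moreover have "(\<exists>i. i \<preceq> z \<and> (\<exists>j. j \<preceq> z \<and> (z = pair i j \<and> Q i j))) \<longleftrightarrow> (\<exists>i j. z = pair i j \<and> Q i j)" for z Q
    using le_pair by blast
  ultimately show ?thesis by simp
qed

section \<open>Finite sequences\<close>

lemma pair_in_elems: "pair i j \<in> elems c \<Longrightarrow> i \<prec> c \<and> j \<prec> c"
  using le_pair elems_less N.le_less_trans by blast

lemma
  assumes "seq \<sigma> l"
  shows seq_pair: "z \<in> elems \<sigma> \<Longrightarrow> \<exists>i j. i \<prec> l \<and> z = pair i j"
    and seq_dom: "pair i j \<in> elems \<sigma> \<Longrightarrow> i \<prec> l"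
    and seq_total: "i \<prec> l \<Longrightarrow> \<exists>j. pair i j \<in> elems \<sigma>"
    and seq_fun: "pair i j \<in> elems \<sigma> \<Longrightarrow> pair i j' \<in> elems \<sigma> \<Longrightarrow> j = j'"
proof -
  have f: "finite_set_code \<sigma>" "function_on (elems \<sigma>) {i. i \<prec> l} UNIV" using assms unfolding seq_def by auto
  show "z \<in> elems \<sigma> \<Longrightarrow> \<exists>i j. i \<prec> l \<and> z = pair i j" for z
    using f unfolding function_on_def by blast
  show *: "pair i j \<in> elems \<sigma> \<Longrightarrow> i \<prec> l" for i j
    using f(2) unfolding function_on_def by (metis mem_Collect_eq pair_inject)
  show "i \<prec> l \<Longrightarrow> \<exists>j. pair i j \<in> elems \<sigma>"
    using f unfolding function_on_def by blast
  show "pair i j \<in> elems \<sigma> \<Longrightarrow> pair i j' \<in> elems \<sigma> \<Longrightarrow> j = j'"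
    using f(2) * unfolding function_on_def by blast
qed

lemma seqI:
  assumes "finite_set_code \<sigma>" "\<And>z. z \<in> elems \<sigma> \<Longrightarrow> \<exists>i j. i \<prec> l \<and> z = pair i j"
    "\<And>i. i \<prec> l \<Longrightarrow> \<exists>j. pair i j \<in> elems \<sigma>"
    "\<And>i j j'. pair i j \<in> elems \<sigma> \<Longrightarrow> pair i j' \<in> elems \<sigma> \<Longrightarrow> j = j'"
  shows "seq \<sigma> l"
  unfolding seq_def function_on_def using assms by blast

lemma seq_length: "seq \<sigma> l \<Longrightarrow> seq \<sigma> l' \<Longrightarrow> l = l'"
  using seq_total seq_dom linear irrefl by metis

text \<open>A sequence of positive length has an entry at its last position, and this position is
  smaller than the code. The estimate allows the length of a coded sequence to be bounded by the
  code in definitions.\<close>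

lemma seq_length_le: "seq \<sigma> l \<Longrightarrow> l \<preceq> \<sigma>"
  using zero_cases[of l] seq_total[of \<sigma> l] pair_in_elems by fastforce

lemma seq_eqI: "seq \<sigma> l \<Longrightarrow> seq \<tau> l' \<Longrightarrow> elems \<sigma> = elems \<tau> \<Longrightarrow> \<sigma> = \<tau>"
  unfolding seq_def using finite_set_code_unique by blast

lemma ex_seq:
  assumes "X \<in> \<S>" "\<And>z. z \<in> X \<Longrightarrow> z \<prec> b" "\<And>z. z \<in> X \<Longrightarrow> \<exists>i j. i \<prec> l \<and> z = pair i j"
    "\<And>i. i \<prec> l \<Longrightarrow> \<exists>j. pair i j \<in> X"
    "\<And>i j j'. pair i j \<in> X \<Longrightarrow> pair i j' \<in> X \<Longrightarrow> j = j'"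
  shows "\<exists>\<sigma>. seq \<sigma> l \<and> elems \<sigma> = X"
proof -
  obtain \<sigma> where \<sigma>: "finite_set_code \<sigma>" "elems \<sigma> = {z \<in> X. z \<prec> b}" using ex_finite_set_code[OF assms(1)] by blast
  then have "elems \<sigma> = X" using assms(2) by blast
  then show ?thesis using seqI[OF \<sigma>(1), of l] assms(3-5) by metis
qed

lemma ex_root: "\<exists>\<rho>. seq \<rho> \<zero>"
proof -
  have "{z. False} \<in> \<S>" by (intro D0_comp D0_bool)
  then show ?thesis using ex_seq[of "{}" \<zero> \<zero>] by auto
qed

lemma seq_zero: "seq \<rho> \<zero> \<Longrightarrow> elems \<rho> = {}"
  using seq_pair by fastforce

lemma ex_append:
  assumes "seq \<sigma> l"
  obtains \<tau> where "seq \<tau> (l \<oplus> \<one>)" "elems \<tau> = insert (pair l n) (elems \<sigma>)"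
proof -
  have "{z. z \<in> elems \<sigma> \<or> z = pair l n} \<in> \<S>" by (intro D0_comp D0_disj D0_elems D0_eq tm_intros)
  moreover have "{z. z \<in> elems \<sigma> \<or> z = pair l n} = insert (pair l n) (elems \<sigma>)" by auto
  ultimately have S: "insert (pair l n) (elems \<sigma>) \<in> \<S>" by simp
  have 1: "z \<prec> \<sigma> \<oplus> pair l n \<oplus> \<one>" if "z \<in> insert (pair l n) (elems \<sigma>)" for z
    using that elems_less[of z \<sigma>] N.less_imp_le[of z \<sigma>] N.order_trans[OF _ le_plus(1), of z \<sigma>] by auto
  have 2: "\<exists>i j. i \<prec> l \<oplus> \<one> \<and> z = pair i j" if "z \<in> insert (pair l n) (elems \<sigma>)" for z
    using that seq_pair[OF assms, of z] N.less_imp_le by auto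
  have 3: "\<exists>j. pair i j \<in> insert (pair l n) (elems \<sigma>)" if "i \<prec> l \<oplus> \<one>" for i
    using that seq_total[OF assms, of i] by (auto simp: le_def)
  have 4: "j = j'" if "pair i j \<in> insert (pair l n) (elems \<sigma>)" "pair i j' \<in> insert (pair l n) (elems \<sigma>)" for i j j'
    using that seq_fun[OF assms, of i] seq_dom[OF assms, of l] irrefl by auto
  have "\<exists>\<tau>. seq \<tau> (l \<oplus> \<one>) \<and> elems \<tau> = insert (pair l n) (elems \<sigma>)"
    by (rule ex_seq[OF S]) (fact 1, fact 2, fact 3, fact 4)
  then show thesis using that by blast
qed

lemma append_entry_iff: "seq \<sigma> l \<Longrightarrow>
    append_entry \<sigma> n \<tau> \<longleftrightarrow> seq \<tau> (l \<oplus> \<one>) \<and> elems \<tau> = insert (pair l n) (elems \<sigma>)"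
  unfolding append_entry_def using seq_length by blast

section \<open>Dependent choice\<close>

lemma function_onD:
  assumes "function_on F UNIV Y"
  shows "pair i a \<in> F \<Longrightarrow> a \<in> Y" "\<exists>a\<in>Y. pair i a \<in> F" "pair i a \<in> F \<Longrightarrow> pair i b \<in> F \<Longrightarrow> a = b"
    "z \<in> F \<Longrightarrow> \<exists>i a. z = pair i a"
proof -
  show *: "pair i a \<in> F \<Longrightarrow> a \<in> Y" for i a using assms unfolding function_on_def by (metis pair_inject)
  show "\<exists>a\<in>Y. pair i a \<in> F" using assms * unfolding function_on_def by blast
  show "pair i a \<in> F \<Longrightarrow> pair i b \<in> F \<Longrightarrow> a = b" "z \<in> F \<Longrightarrow> \<exists>i a. z = pair i a"
    using assms unfolding function_on_def by blast+
qed

lemma function_onI: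
  assumes "\<And>z. z \<in> F \<Longrightarrow> \<exists>i a. z = pair i a" "\<And>i a. pair i a \<in> F \<Longrightarrow> a \<in> Y"
    "\<And>i. \<exists>a. pair i a \<in> F" "\<And>i a b. pair i a \<in> F \<Longrightarrow> pair i b \<in> F \<Longrightarrow> a = b"
  shows "function_on F UNIV Y"
  unfolding function_on_def using assms by blast

definition path :: "'a set \<Rightarrow> 'a set \<Rightarrow> bool" where
  "path R f \<longleftrightarrow> (\<forall>n a b. pair n a \<in> f \<longrightarrow> pair (n \<oplus> \<one>) b \<in> f \<longrightarrow> pair a b \<in> R)"

text \<open>Taking the least admissible successor turns the choice into a recursion. As usual in
  RCA0, its initial runs are coded as finite sequences; they exist by Sigma01 induction and are
  unique by bounded induction, which gives a Delta01 definition of \<open>f\<close>.\<close>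

lemma dependent_choice:
  assumes "R \<in> \<S>" "D \<in> \<S>" "a0 \<in> D" and ser: "\<And>a. a \<in> D \<Longrightarrow> \<exists>b\<in>D. pair a b \<in> R"
  shows "\<exists>f\<in>\<S>. function_on f UNIV D \<and> path R f"
proof -
  define nxt where "nxt a b \<longleftrightarrow> b \<in> D \<and> pair a b \<in> R \<and> (\<forall>b'. b' \<prec> b \<longrightarrow> \<not> (b' \<in> D \<and> pair a b' \<in> R))" for a b
  \<comment> \<open>Here \<open>c\<close> records a run of \<open>n\<close> steps, hence has length
    \<open>n \<oplus> \<one>\<close>. Its entries are quantified below \<open>c\<close> to keep the
    predicate bounded.\<close>
  define G where "G c n \<longleftrightarrow> seq c (n \<oplus> \<one>) \<and> pair \<zero> a0 \<in> elems c \<and>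
    (\<forall>i. i \<prec> n \<longrightarrow> (\<forall>a. a \<prec> c \<longrightarrow> (\<forall>b. b \<prec> c \<longrightarrow>
      pair i a \<in> elems c \<longrightarrow> pair (i \<oplus> \<one>) b \<in> elems c \<longrightarrow> nxt a b)))" for c n
  have nxt_ex: "\<exists>b. nxt a b" if "a \<in> D" for a
  proof -
    obtain b where "b \<in> D \<and> pair a b \<in> R" using ser \<open>a \<in> D\<close> by blast
    moreover have "D0 (\<lambda>e. e 0 \<in> D \<and> pair a (e 0) \<in> R)" by (intro D0_intros tm_intros assms)
    ultimately obtain b where "b \<in> D \<and> pair a b \<in> R" "\<And>b'. b' \<prec> b \<Longrightarrow> \<not> (b' \<in> D \<and> pair a b' \<in> R)"
      using least_number[of "\<lambda>b. b \<in> D \<and> pair a b \<in> R"] by metis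
    then show ?thesis unfolding nxt_def by blast
  qed
  have nxt_fun: "nxt a b \<Longrightarrow> nxt a b' \<Longrightarrow> b = b'" for a b b'
    unfolding nxt_def using linear by metis
  have D0_nxt: "D0 (\<lambda>e. nxt (t e) (u e))" if "tm t" "tm u" for t u
    by (rule D0_subst2[OF _ that]) (unfold nxt_def, intro D0_intros tm_intros assms)
  have D0_G: "D0 (\<lambda>e. G (t e) (u e))" if "tm t" "tm u" for t u
    by (rule D0_subst2[OF _ that]) (unfold G_def, intro D0_intros tm_intros D0_elems D0_seq D0_nxt)
  have Gnxt: "nxt a b" if "G c n" "i \<prec> n" "pair i a \<in> elems c" "pair (i \<oplus> \<one>) b \<in> elems c" for c n i a b
    using that pair_in_elems unfolding G_def by blast
  have G0: "a = a0" if "G c n" "pair \<zero> a \<in> elems c" for c n a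
    using that seq_fun[of c "n \<oplus> \<one>" \<zero> a a0] unfolding G_def by blast
  have GD: "i \<prec> n \<oplus> \<one> \<longrightarrow> (\<forall>a. a \<prec> c \<longrightarrow> pair i a \<in> elems c \<longrightarrow> a \<in> D)"
    (is "?P i") if G: "G c n" for c n i
  proof (rule D0_induct[of ?P])
    show "D0 (\<lambda>e. ?P (e 0))"
      by (intro D0_intros tm_intros D0_elems assms)
    show "?P \<zero>"
      using G0[OF G] assms(3) by metis
    fix i assume "?P i"
    show "?P (i \<oplus> \<one>)"
    proof (intro impI allI)
      fix b assume *: "i \<oplus> \<one> \<prec> n \<oplus> \<one>" "pair (i \<oplus> \<one>) b \<in> elems c"
      then have "i \<prec> n" by simp
      moreover obtain a where "pair i a \<in> elems c"
        using seq_total[of c "n \<oplus> \<one>" i] G \<open>i \<prec> n\<close> N.less_imp_le unfolding G_def by auto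
      ultimately show "b \<in> D" using Gnxt[OF G] *(2) unfolding nxt_def by blast
    qed
  qed
  have ex: "\<exists>c. G c n" for n
  proof (rule Sigma_induct[of G])
    show "D0 (\<lambda>e. G (e 0) (e 1))" by (intro D0_G tm_intros)
    obtain \<rho> where \<rho>: "seq \<rho> \<zero>" using ex_root by blast
    obtain c where c: "seq c (\<zero> \<oplus> \<one>)" "elems c = insert (pair \<zero> a0) (elems \<rho>)" by (rule ex_append[OF \<rho>])
    then show "\<exists>c. G c \<zero>" unfolding G_def by auto
    fix n c assume G: "G c n"
    then have c: "seq c (n \<oplus> \<one>)" unfolding G_def by blast
    obtain a where a: "pair n a \<in> elems c" using seq_total[OF c, of n] by auto
    then have "a \<in> D" using GD[OF G] pair_in_elems by fastforce
    then obtain b where b: "nxt a b" using nxt_ex by blast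
    obtain d where d: "seq d (n \<oplus> \<one> \<oplus> \<one>)" "elems d = insert (pair (n \<oplus> \<one>) b) (elems c)"
      by (rule ex_append[OF c])
    have "nxt x y" if "i \<prec> n \<oplus> \<one>" "pair i x \<in> elems d" "pair (i \<oplus> \<one>) y \<in> elems d" for i x y
    proof (cases "i = n")
      case True
      then have "x = a" "y = b" using that d a seq_fun[OF d(1)] by blast+
      then show ?thesis using b by simp
    next
      case False
      then have "i \<prec> n" using that(1) by (simp add: le_def)
      moreover from this have "i \<noteq> n \<oplus> \<one>" "i \<oplus> \<one> \<noteq> n \<oplus> \<one>"
        using that(1) irrefl succ_inject by blast+
      ultimately show ?thesis using Gnxt[OF G] that d(2) by auto
    qed
    then show "\<exists>c. G c (n \<oplus> \<one>)" unfolding G_def using G d by (intro exI[of _ d]) (auto simp: G_def)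
  qed
  \<comment> \<open>Runs of different lengths have to be compared because \<open>path\<close>
    relates the value at \<open>n\<close> to the one at \<open>n \<oplus> \<one>\<close>, which
    comes from a longer run.\<close>
  have uniq: "i \<preceq> n \<longrightarrow> i \<preceq> n' \<longrightarrow> (\<forall>a. a \<prec> c \<longrightarrow> (\<forall>a'. a' \<prec> c' \<longrightarrow>
      pair i a \<in> elems c \<longrightarrow> pair i a' \<in> elems c' \<longrightarrow> a = a'))"
    (is "?P i") if G: "G c n" "G c' n'" for c c' n n' i
  proof (rule D0_induct[of ?P])
    show "D0 (\<lambda>e. ?P (e 0))"
      by (intro D0_intros tm_intros D0_elems D0_le)
    show "?P \<zero>"
      using G0[OF G(1)] G0[OF G(2)] by metis
    fix i assume IH: "?P i"
    show "?P (i \<oplus> \<one>)"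
    proof (intro impI allI)
      fix b b' assume *: "i \<oplus> \<one> \<preceq> n" "i \<oplus> \<one> \<preceq> n'"
        and b: "pair (i \<oplus> \<one>) b \<in> elems c" "pair (i \<oplus> \<one>) b' \<in> elems c'"
      then have i: "i \<prec> n" "i \<prec> n'" by simp_all
      obtain a where a: "pair i a \<in> elems c"
        using seq_total[of c "n \<oplus> \<one>" i] G i N.less_imp_le unfolding G_def by auto
      obtain a' where a': "pair i a' \<in> elems c'"
        using seq_total[of c' "n' \<oplus> \<one>" i] G i N.less_imp_le unfolding G_def by auto
      have "a = a'" using IH i a a' pair_in_elems N.less_imp_le by blast
      then show "b = b'" using Gnxt[OF G(1) i(1) a b(1)] Gnxt[OF G(2) i(2) a' b(2)] nxt_fun by blast
    qed
  qed
  \<comment> \<open>The two forms required by \<open>Delta_comp\<close>: some run of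
    \<open>n\<close> steps ends with the given entry, and every run of \<open>n\<close> steps
    does.\<close>
  define P where "P c z \<longleftrightarrow> (\<exists>n a. z = pair n a \<and> G c n \<and> z \<in> elems c)" for c z
  define Q where "Q c z \<longleftrightarrow> (\<exists>n a. z = pair n a \<and> (G c n \<longrightarrow> z \<in> elems c))" for c z
  define f where "f = {z. \<exists>c. P c z}"
  have f: "pair n a \<in> f \<longleftrightarrow> (\<exists>c. G c n \<and> pair n a \<in> elems c)" for n a
    unfolding f_def P_def by auto
  have "f \<in> \<S>"
    unfolding f_def
  proof (rule Delta_comp)
    show "D0 (\<lambda>e. P (e 0) (e 1))" unfolding P_def
      by (intro D0_ex_pair D0_intros tm_intros D0_G D0_elems)
    show "D0 (\<lambda>e. Q (e 0) (e 1))" unfolding Q_def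
      by (intro D0_ex_pair D0_intros tm_intros D0_G D0_elems)
    fix z
    show "(\<exists>c. P c z) \<longleftrightarrow> (\<forall>c. Q c z)"
    proof
      assume "\<exists>c. P c z"
      then obtain n a c where c: "z = pair n a" "G c n" "z \<in> elems c" unfolding P_def by blast
      have "z \<in> elems c'" if G': "G c' n" for c'
      proof -
        obtain a' where "pair n a' \<in> elems c'" using seq_total[of c' "n \<oplus> \<one>" n] G' unfolding G_def by auto
        then show ?thesis using uniq[OF c(2) G', of n] c(1,3) pair_in_elems by blast
      qed
      then show "\<forall>c. Q c z" unfolding Q_def using c(1) by blast
    next
      assume *: "\<forall>c. Q c z"
      then obtain n a where z: "z = pair n a" unfolding Q_def by blast
      obtain c where c: "G c n" using ex by blast
      then have "z \<in> elems c" using * unfolding Q_def z by auto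
      then show "\<exists>c. P c z" using c unfolding P_def z by blast
    qed
  qed
  moreover have "function_on f UNIV D"
  proof (rule function_onI)
    show "z \<in> f \<Longrightarrow> \<exists>i a. z = pair i a" for z unfolding f_def P_def by blast
    show "pair i a \<in> f \<Longrightarrow> a \<in> D" for i a
      unfolding f using GD pair_in_elems by fastforce
    show "\<exists>a. pair i a \<in> f" for i
      unfolding f using ex[of i] seq_total[of _ "i \<oplus> \<one>" i] unfolding G_def by fastforce
    show "pair i a \<in> f \<Longrightarrow> pair i b \<in> f \<Longrightarrow> a = b" for i a b
      unfolding f using uniq pair_in_elems by (metis N.order_refl)
  qed
  moreover have "path R f"
    unfolding path_def
  proof (intro allI impI)
    fix n a b assume "pair n a \<in> f" "pair (n \<oplus> \<one>) b \<in> f"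
    then obtain c d where c: "G c n" "pair n a \<in> elems c" and d: "G d (n \<oplus> \<one>)" "pair (n \<oplus> \<one>) b \<in> elems d"
      unfolding f by blast
    obtain a' where a': "pair n a' \<in> elems d"
      using seq_total[of d "n \<oplus> \<one> \<oplus> \<one>" n] d(1) N.less_imp_le unfolding G_def by auto
    have "a = a'" using uniq[OF c(1) d(1), of n] c(2) a' pair_in_elems by (simp add: N.less_imp_le)
    then show "pair a b \<in> R" using Gnxt[OF d(1) _ a' d(2)] unfolding nxt_def by simp
  qed
  ultimately show ?thesis by blast
qed

text \<open>The same with an auxiliary witness: \<open>a\<close> ranges over a set that need not exist.\<close>

lemma ex_path:
  assumes "R \<in> \<S>" "D \<in> \<S>" "pair a0 y0 \<in> D"
    and ser: "\<And>a y. pair a y \<in> D \<Longrightarrow> \<exists>b y'. pair b y' \<in> D \<and> pair a b \<in> R"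
  shows "\<exists>f\<in>\<S>. function_on f UNIV {a. \<exists>y. pair a y \<in> D} \<and> path R f"
proof -
  define D' where "D' = {z. \<exists>a y. z = pair a y \<and> z \<in> D}"
  define R' where "R' = {w. \<exists>p q. w = pair p q \<and>
    (\<exists>a y. p = pair a y \<and> (\<exists>b y'. q = pair b y' \<and> pair a b \<in> R))}"
  have "D' \<in> \<S>" unfolding D'_def by (intro D0_comp D0_ex_pair D0_intros tm_intros assms)
  have "R' \<in> \<S>" unfolding R'_def by (intro D0_comp D0_ex_pair D0_intros tm_intros assms)
  have D': "z \<in> D' \<longleftrightarrow> (\<exists>a y. z = pair a y \<and> pair a y \<in> D)" for z
    unfolding D'_def by auto
  have R': "pair (pair a y) (pair b y') \<in> R' \<longleftrightarrow> pair a b \<in> R" for a y b y'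
    unfolding R'_def by simp
  have "\<exists>g\<in>\<S>. function_on g UNIV D' \<and> path R' g"
  proof (rule dependent_choice[OF \<open>R' \<in> \<S>\<close> \<open>D' \<in> \<S>\<close>, of "pair a0 y0"])
    show "pair a0 y0 \<in> D'" using assms(3) D' by blast
    fix z assume "z \<in> D'"
    then obtain a y where z: "z = pair a y" "pair a y \<in> D" using D' by blast
    then obtain b y' where "pair b y' \<in> D" "pair a b \<in> R" using ser by blast
    then show "\<exists>w\<in>D'. pair z w \<in> R'" using z(1) D' R' by blast
  qed
  then obtain g where g: "g \<in> \<S>" "function_on g UNIV D'" "path R' g" by blast
  \<comment> \<open>Dropping the witness \<open>y\<close> is a projection. Since \<open>g\<close>
    has exactly one value at \<open>n\<close>, the projection can also be written with a universal
    quantifier.\<close>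
  define P where "P y z \<longleftrightarrow> (\<exists>n a. z = pair n a \<and> pair n (pair a y) \<in> g)" for y z
  define Q where "Q w z \<longleftrightarrow> (\<exists>n a. z = pair n a \<and>
    (pair n w \<in> g \<longrightarrow> (\<exists>b y. w = pair b y \<and> a = b)))" for w z
  define f where "f = {z. \<exists>y. P y z}"
  have f: "pair n a \<in> f \<longleftrightarrow> (\<exists>y. pair n (pair a y) \<in> g)" for n a
    unfolding f_def P_def by auto
  have "f \<in> \<S>"
    unfolding f_def
  proof (rule Delta_comp)
    show "D0 (\<lambda>e. P (e 0) (e 1))" unfolding P_def by (intro D0_ex_pair D0_intros tm_intros g)
    show "D0 (\<lambda>e. Q (e 0) (e 1))" unfolding Q_def by (intro D0_ex_pair D0_intros tm_intros g)
    fix z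
    show "(\<exists>y. P y z) \<longleftrightarrow> (\<forall>w. Q w z)"
    proof
      assume "\<exists>y. P y z"
      then obtain n a y where 1: "z = pair n a" "pair n (pair a y) \<in> g" unfolding P_def by blast
      then have "pair n w \<in> g \<Longrightarrow> w = pair a y" for w using function_onD(3)[OF g(2)] by blast
      then show "\<forall>w. Q w z" unfolding Q_def 1 by fastforce
    next
      assume *: "\<forall>w. Q w z"
      then obtain n a where z: "z = pair n a" unfolding Q_def by blast
      obtain w where "pair n w \<in> g" using function_onD(2)[OF g(2)] by blast
      then show "\<exists>y. P y z" using * unfolding P_def Q_def z by auto
    qed
  qed
  moreover have "function_on f UNIV {a. \<exists>y. pair a y \<in> D}"
  proof (rule function_onI)
    show "z \<in> f \<Longrightarrow> \<exists>i a. z = pair i a" for z unfolding f_def P_def by blast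
    show "pair i a \<in> f \<Longrightarrow> a \<in> {a. \<exists>y. pair a y \<in> D}" for i a
      unfolding f using function_onD(1)[OF g(2)] D' by fastforce
    show "\<exists>a. pair i a \<in> f" for i
      unfolding f using function_onD(2)[OF g(2), of i] D' by metis
    show "pair i a \<in> f \<Longrightarrow> pair i b \<in> f \<Longrightarrow> a = b" for i a b
      unfolding f using function_onD(3)[OF g(2)] by (metis pair_inject)
  qed
  moreover have "path R f"
    unfolding path_def f using g(3) R' unfolding path_def by metis
  ultimately show ?thesis by blast
qed

section \<open>Kernels of well-founded graphs\<close>


definition odd_num :: "'a \<Rightarrow> bool" where
  "odd_num l \<longleftrightarrow> (\<exists>d. d \<prec> l \<and> l = d \<oplus> d \<oplus> \<one>)"

lemma D0_odd_num: "tm t \<Longrightarrow> D0 (\<lambda>e. odd_num (t e))"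
proof (rule D0_subst1[of odd_num])
  show "D0 (\<lambda>e. odd_num (e 0))"
    unfolding odd_num_def by (intro D0_intros tm_intros)
qed

lemma odd_num_iff: "odd_num l \<longleftrightarrow> (\<exists>d. l = d \<oplus> d \<oplus> \<one>)"
proof -
  have "d \<prec> d \<oplus> d \<oplus> \<one>" for d by simp
  then show ?thesis unfolding odd_num_def by blast
qed

lemma double_neq: "d \<oplus> d \<noteq> e \<oplus> e \<oplus> \<one>"
proof
  assume eq: "d \<oplus> d = e \<oplus> e \<oplus> \<one>"
  show False
  proof (cases "d \<preceq> e")
    case True
    then have "d \<oplus> d \<preceq> e \<oplus> e" by (intro N.add_mono)
    then show False using eq N.not_le less_succ N.order_refl by metis
  next
    case False
    then have "e \<oplus> \<one> \<preceq> d" using N.not_le by simp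
    then have "(e \<oplus> \<one>) \<oplus> (e \<oplus> \<one>) \<preceq> d \<oplus> d" by (intro N.add_mono)
    then have "e \<oplus> e \<oplus> \<one> \<oplus> \<one> \<preceq> e \<oplus> e \<oplus> \<one>" using eq by (simp add: algebra_simps)
    then show False using irrefl succ_le by blast
  qed
qed

lemma double_or: "(\<exists>d. l = d \<oplus> d) \<or> (\<exists>d. l = d \<oplus> d \<oplus> \<one>)"
proof -
  have "\<exists>d. l = d \<oplus> d \<or> l = d \<oplus> d \<oplus> \<one>"
  proof (rule Sigma_induct[of "\<lambda>d l. l = d \<oplus> d \<or> l = d \<oplus> d \<oplus> \<one>"])
    show "D0 (\<lambda>e. e 1 = e 0 \<oplus> e 0 \<or> e 1 = e 0 \<oplus> e 0 \<oplus> \<one>)" by (intro D0_intros tm_intros)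
    show "\<exists>d. \<zero> = d \<oplus> d \<or> \<zero> = d \<oplus> d \<oplus> \<one>" by (intro exI[of _ \<zero>]) simp
    fix l d assume "l = d \<oplus> d \<or> l = d \<oplus> d \<oplus> \<one>"
    moreover have "d \<oplus> d \<oplus> \<one> \<oplus> \<one> = (d \<oplus> \<one>) \<oplus> (d \<oplus> \<one>)" by (simp add: algebra_simps)
    ultimately show "\<exists>d. l \<oplus> \<one> = d \<oplus> d \<or> l \<oplus> \<one> = d \<oplus> d \<oplus> \<one>" by metis
  qed
  then show ?thesis by blast
qed

lemma odd_num_succ: "odd_num (l \<oplus> \<one>) \<longleftrightarrow> \<not> odd_num l"
  unfolding odd_num_iff using double_or[of l] double_neq succ_inject by metis

lemma num_inject: "num a = num b \<longleftrightarrow> a = b"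
proof (induction a arbitrary: b)
  case 0 then show ?case by (cases b) simp_all
next
  case (Suc a) then show ?case by (cases b) simp_all
qed

lemma lab_simps:
  "\<not> in_clopen k x lab_empty" "in_clopen k x lab_full \<longleftrightarrow> x \<in> partitions k"
  "lab_union \<noteq> lab_inter"
  unfolding in_clopen_def lab_empty_def lab_full_def lab_union_def lab_inter_def lab_cyl_def lab_cocyl_def
  using num_inject by (auto simp del: num.simps)

lemma D0_If: "D0 P \<Longrightarrow> D0 Q \<Longrightarrow> D0 Q' \<Longrightarrow> D0 (\<lambda>e. if P e then Q e else Q' e)"
  unfolding if_bool_eq_conj by (intro D0_intros)

lemma eq_If: "(q = (if b then c else d)) = (if b then q = c else q = d)"
  by simp

section \<open>The tree of finite paths of a graph as a Borel code\<close>

context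
  fixes R E :: "'a set"
  assumes R: "R \<in> \<S>" and E: "E \<in> \<S>" and E_iff: "\<And>s. s \<in> E \<longleftrightarrow> (\<exists>t. pair s t \<in> R)"
begin

definition last_entry :: "'a \<Rightarrow> 'a \<Rightarrow> bool" where
  "last_entry \<sigma> s \<longleftrightarrow> (\<exists>i. i \<prec> \<sigma> \<and> (seq \<sigma> (i \<oplus> \<one>) \<and> pair i s \<in> elems \<sigma>))"

lemma last_entry_iff: "last_entry \<sigma> s \<longleftrightarrow> (\<exists>i. seq \<sigma> (i \<oplus> \<one>) \<and> pair i s \<in> elems \<sigma>)"
  unfolding last_entry_def using pair_in_elems by blast

lemma D0_last_entry: "tm t \<Longrightarrow> tm u \<Longrightarrow> D0 (\<lambda>e. last_entry (t e) (u e))"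
proof (rule D0_subst2[of last_entry])
  show "D0 (\<lambda>e. last_entry (e 0) (e 1))"
    unfolding last_entry_def by (intro D0_intros tm_intros D0_seq D0_elems)
qed

lemma last_entry_fun: "last_entry \<sigma> s \<Longrightarrow> last_entry \<sigma> t \<Longrightarrow> s = t"
  unfolding last_entry_iff using seq_length succ_inject seq_fun by metis

lemma last_entry_append:
  "seq \<tau> (l \<oplus> \<one>) \<Longrightarrow> elems \<tau> = insert (pair l t) A \<Longrightarrow> last_entry \<tau> t"
  unfolding last_entry_iff by blast

text \<open>The empty path belongs to the tree and all sequences of length one are its children, so
  that a single code covers all starting vertices.\<close>

definition ptree :: "'a set" where
  "ptree = {\<sigma>. \<exists>l. l \<preceq> \<sigma> \<and> (seq \<sigma> l \<and> (\<forall>i. i \<prec> \<sigma> \<longrightarrow> (\<forall>a. a \<prec> \<sigma> \<longrightarrow> (\<forall>b. b \<prec> \<sigma> \<longrightarrow>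
     pair i a \<in> elems \<sigma> \<longrightarrow> pair (i \<oplus> \<one>) b \<in> elems \<sigma> \<longrightarrow> pair a b \<in> R))))}"

lemma ptree_in_sets: "ptree \<in> \<S>"
  unfolding ptree_def by (intro D0_comp D0_intros tm_intros D0_seq D0_elems D0_ex_le R)

lemma ptree_iff: "\<sigma> \<in> ptree \<longleftrightarrow> (\<exists>l. seq \<sigma> l) \<and>
    (\<forall>i a b. pair i a \<in> elems \<sigma> \<longrightarrow> pair (i \<oplus> \<one>) b \<in> elems \<sigma> \<longrightarrow> pair a b \<in> R)"
  unfolding ptree_def using seq_length_le pair_in_elems by blast

text \<open>The empty path has no last entry; for it the condition is vacuous and every vertex may
  be appended.\<close>

lemma ptree_append:
  assumes "\<sigma> \<in> ptree" "seq \<sigma> l" "seq \<tau> (l \<oplus> \<one>)" "elems \<tau> = insert (pair l t) (elems \<sigma>)"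
  shows "\<tau> \<in> ptree \<longleftrightarrow> (\<forall>s. last_entry \<sigma> s \<longrightarrow> pair s t \<in> R)"
proof
  assume \<tau>: "\<tau> \<in> ptree"
  show "\<forall>s. last_entry \<sigma> s \<longrightarrow> pair s t \<in> R"
  proof (intro allI impI)
    fix s assume "last_entry \<sigma> s"
    then obtain i where i: "seq \<sigma> (i \<oplus> \<one>)" "pair i s \<in> elems \<sigma>" unfolding last_entry_iff by blast
    then have "i \<oplus> \<one> = l" using seq_length assms(2) by blast
    then show "pair s t \<in> R" using \<tau> i(2) assms(4) unfolding ptree_iff by blast
  qed
next
  assume *: "\<forall>s. last_entry \<sigma> s \<longrightarrow> pair s t \<in> R"
  have "pair a b \<in> R" if "pair i a \<in> elems \<tau>" "pair (i \<oplus> \<one>) b \<in> elems \<tau>" for i a b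
  proof (cases "i \<oplus> \<one> = l")
    case True
    then have "b = t" using that(2) seq_fun[OF assms(3)] assms(4) by blast
    have "i \<noteq> l" using True by (metis less_succ N.order_refl irrefl)
    then have "pair i a \<in> elems \<sigma>" using that(1) assms(4) by simp
    then show ?thesis using * True assms(2) \<open>b = t\<close> unfolding last_entry_iff by blast
  next
    case False
    then have b: "pair (i \<oplus> \<one>) b \<in> elems \<sigma>" using that(2) assms(4) by simp
    then have "i \<oplus> \<one> \<prec> l" using seq_dom[OF assms(2)] by blast
    then have "i \<noteq> l" by (metis less_succ N.order_refl N.less_asym)
    then have "pair i a \<in> elems \<sigma>" using that(1) assms(4) by simp
    then show ?thesis using b assms(1) unfolding ptree_iff by blast
  qed
  then show "\<tau> \<in> ptree" unfolding ptree_iff using assms(3) by blast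
qed

lemma children_ptree:
  assumes "\<sigma> \<in> ptree" "last_entry \<sigma> s"
  shows "\<tau> \<in> children ptree \<sigma> \<Longrightarrow> \<exists>t. last_entry \<tau> t \<and> pair s t \<in> R"
    and "pair s t \<in> R \<Longrightarrow> \<exists>\<tau>\<in>children ptree \<sigma>. last_entry \<tau> t"
proof -
  obtain l where l: "seq \<sigma> l" using assms(1) unfolding ptree_iff by blast
  show "\<exists>t. last_entry \<tau> t \<and> pair s t \<in> R" if ch: "\<tau> \<in> children ptree \<sigma>"
  proof -
    obtain t where t: "\<tau> \<in> ptree" "seq \<tau> (l \<oplus> \<one>)" "elems \<tau> = insert (pair l t) (elems \<sigma>)"
      using ch append_entry_iff[OF l] unfolding children_def by blast
    then show ?thesis using ptree_append[OF assms(1) l t(2,3)] assms(2) last_entry_append by blast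
  qed
  show "\<exists>\<tau>\<in>children ptree \<sigma>. last_entry \<tau> t" if "pair s t \<in> R"
  proof -
    obtain \<tau> where \<tau>: "seq \<tau> (l \<oplus> \<one>)" "elems \<tau> = insert (pair l t) (elems \<sigma>)"
      by (rule ex_append[OF l])
    then have "\<tau> \<in> ptree" using ptree_append[OF assms(1) l \<tau>] assms(2) last_entry_fun that by blast
    then show ?thesis unfolding children_def using \<tau> append_entry_iff[OF l] last_entry_append by blast
  qed
qed

lemma root_ptree: "seq \<rho> \<zero> \<Longrightarrow> \<rho> \<in> ptree"
  unfolding ptree_iff using seq_zero by blast

text \<open>Every vertex is the last entry of some node, so that the values at the nodes decide
  membership in the kernel for all vertices.\<close>

lemma ex_singleton: "\<exists>\<sigma>\<in>ptree. seq \<sigma> \<one> \<and> last_entry \<sigma> s"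
proof -
  obtain \<rho> where \<rho>: "seq \<rho> \<zero>" using ex_root by blast
  obtain \<tau> where \<tau>: "seq \<tau> (\<zero> \<oplus> \<one>)" "elems \<tau> = insert (pair \<zero> s) (elems \<rho>)" by (rule ex_append[OF \<rho>])
  have "\<not> last_entry \<rho> t" for t unfolding last_entry_iff seq_zero[OF \<rho>] by simp
  then have "\<tau> \<in> ptree" using ptree_append[OF root_ptree[OF \<rho>] \<rho> \<tau>] by blast
  then show ?thesis using \<tau> last_entry_append[OF \<tau>] by auto
qed

text \<open>A node with a last entry is a leaf iff this entry is a dead end, and the empty path
  always has children. With \<open>E\<close> given, this makes being a leaf decidable and the
  labelling a set.\<close>

lemma leaf_ptree: "\<sigma> \<in> ptree \<Longrightarrow> leaf ptree \<sigma> \<longleftrightarrow> (\<exists>s. last_entry \<sigma> s \<and> s \<notin> E)"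
proof -
  assume \<sigma>: "\<sigma> \<in> ptree"
  show ?thesis
  proof (cases "\<exists>s. last_entry \<sigma> s")
    case True
    then obtain s where s: "last_entry \<sigma> s" by blast
    then have "children ptree \<sigma> = {} \<longleftrightarrow> s \<notin> E" unfolding E_iff using children_ptree[OF \<sigma> s] by blast
    then show ?thesis unfolding leaf_def using \<sigma> s last_entry_fun by blast
  next
    case False
    obtain l where l: "seq \<sigma> l" using \<sigma> unfolding ptree_iff by blast
    obtain \<tau> where \<tau>: "seq \<tau> (l \<oplus> \<one>)" "elems \<tau> = insert (pair l \<zero>) (elems \<sigma>)" by (rule ex_append[OF l])
    have "\<tau> \<in> ptree" using ptree_append[OF \<sigma> l \<tau>] False by blast
    then have "\<tau> \<in> children ptree \<sigma>" unfolding children_def using \<tau> append_entry_iff[OF l] by blast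
    then show ?thesis using False unfolding leaf_def by blast
  qed
qed

text \<open>With these labels, a node is evaluated to the membership of its last entry in the kernel if its
  length is odd, and to the negation of that if its length is even.\<close>

definition plabel :: "'a \<Rightarrow> 'a \<Rightarrow> bool" where
  "plabel \<sigma> q \<longleftrightarrow> (\<exists>l. l \<preceq> \<sigma> \<and> (seq \<sigma> l \<and>
     (if \<exists>s. s \<prec> \<sigma> \<and> (last_entry \<sigma> s \<and> s \<notin> E)
      then q = (if odd_num l then lab_empty else lab_full)
      else q = (if odd_num l then lab_union else lab_inter))))"

lemma last_entry_less: "last_entry \<sigma> s \<Longrightarrow> s \<prec> \<sigma>"
  unfolding last_entry_iff using pair_in_elems by blast

lemma D0_plabel: "tm t \<Longrightarrow> tm u \<Longrightarrow> D0 (\<lambda>e. plabel (t e) (u e))"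
proof (rule D0_subst2[of plabel])
  show "D0 (\<lambda>e. plabel (e 0) (e 1))"
    unfolding plabel_def eq_If
    by (intro D0_intros D0_If tm_intros D0_seq D0_last_entry D0_odd_num D0_ex_le E)
qed

lemma plabel_iff:
  assumes "\<sigma> \<in> ptree" "seq \<sigma> l"
  shows "plabel \<sigma> q \<longleftrightarrow> q = (if leaf ptree \<sigma> then if odd_num l then lab_empty else lab_full
      else if odd_num l then lab_union else lab_inter)"
proof -
  have 1: "(\<exists>l. l \<preceq> \<sigma> \<and> (seq \<sigma> l \<and> F l)) \<longleftrightarrow> F l" for F
    using seq_length[OF _ assms(2)] assms(2) seq_length_le[OF assms(2)] by blast
  have "(\<exists>s. s \<prec> \<sigma> \<and> (last_entry \<sigma> s \<and> s \<notin> E)) \<longleftrightarrow> leaf ptree \<sigma>"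
    unfolding leaf_ptree[OF assms(1)] using last_entry_less by blast
  then show ?thesis unfolding plabel_def 1 by simp
qed

definition plabels :: "'a set" where
  "plabels = {z. \<exists>\<sigma> q. z = pair \<sigma> q \<and> (\<sigma> \<in> ptree \<and> plabel \<sigma> q)}"

lemma plabels_iff: "pair \<sigma> q \<in> plabels \<longleftrightarrow> \<sigma> \<in> ptree \<and> plabel \<sigma> q"
  unfolding plabels_def by simp

text \<open>An infinite branch of the tree would be an infinite path of the graph: its initial
  segment of length \<open>n \<oplus> \<one> \<oplus> \<one>\<close> contains the entries at
  \<open>n\<close> and \<open>n \<oplus> \<one>\<close>, which are therefore related by
  \<open>R\<close>.\<close>

lemma borel_code_ptree:
  assumes wf: "\<And>f. f \<in> \<S> \<Longrightarrow> function_on f UNIV UNIV \<Longrightarrow> \<not> path R f"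
  shows "borel_code k ptree plabels"
  unfolding borel_code_def
proof (intro conjI)
  show "ptree \<in> \<S>" by (rule ptree_in_sets)
  show "plabels \<in> \<S>"
    unfolding plabels_def by (intro D0_comp D0_ex_pair D0_intros tm_intros D0_plabel ptree_in_sets)
  show "\<exists>\<rho>\<in>ptree. root \<rho>" using ex_root root_ptree unfolding root_def by blast
  show "function_on plabels ptree UNIV"
    unfolding function_on_def
  proof (intro conjI ballI)
    show "z \<in> plabels \<Longrightarrow> \<exists>i\<in>ptree. \<exists>j\<in>UNIV. z = pair i j" for z unfolding plabels_def by blast
    fix \<sigma> assume \<sigma>: "\<sigma> \<in> ptree"
    then obtain l where l: "seq \<sigma> l" unfolding ptree_iff by blast
    show "\<exists>!q. pair \<sigma> q \<in> plabels" unfolding plabels_iff plabel_iff[OF \<sigma> l] using \<sigma> by simp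
  qed
  show "\<forall>\<sigma>\<in>ptree. \<forall>q. pair \<sigma> q \<in> plabels \<longrightarrow>
        (if leaf ptree \<sigma> then q \<in> clopen_labels k else q \<in> {lab_union, lab_inter})"
  proof (intro ballI allI impI)
    fix \<sigma> q assume \<sigma>: "\<sigma> \<in> ptree" and q: "pair \<sigma> q \<in> plabels"
    obtain l where l: "seq \<sigma> l" using \<sigma> unfolding ptree_iff by blast
    show "if leaf ptree \<sigma> then q \<in> clopen_labels k else q \<in> {lab_union, lab_inter}"
      using q unfolding plabels_iff plabel_iff[OF \<sigma> l] clopen_labels_def by simp
  qed
  have "tree ptree"
    unfolding tree_def
  proof (intro conjI ballI allI impI)
    show "\<tau> \<in> ptree \<Longrightarrow> \<exists>l. seq \<tau> l" for \<tau> unfolding ptree_iff by blast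
    show "\<sigma> \<in> ptree" if "\<tau> \<in> ptree" "seq \<sigma> l" "elems \<sigma> \<subseteq> elems \<tau>" for \<tau> \<sigma> l
      using that unfolding ptree_iff by blast
  qed
  moreover have "path R f"
    if f: "function_on f UNIV UNIV" and fT: "\<And>n. \<exists>\<sigma>\<in>ptree. seq \<sigma> n \<and> elems \<sigma> \<subseteq> f" for f
    unfolding path_def
  proof (intro allI impI)
    fix n a b assume ab: "pair n a \<in> f" "pair (n \<oplus> \<one>) b \<in> f"
    obtain \<sigma> where \<sigma>: "\<sigma> \<in> ptree" "seq \<sigma> (n \<oplus> \<one> \<oplus> \<one>)" "elems \<sigma> \<subseteq> f" using fT by blast
    obtain a' where a': "pair n a' \<in> elems \<sigma>" using seq_total[OF \<sigma>(2), of n] N.less_imp_le by auto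
    obtain b' where b': "pair (n \<oplus> \<one>) b' \<in> elems \<sigma>" using seq_total[OF \<sigma>(2), of "n \<oplus> \<one>"] by auto
    have "a' = a" "b' = b" using a' b' ab \<sigma>(3) function_onD(3)[OF f] by blast+
    then show "pair a b \<in> R" using a' b' \<sigma>(1) unfolding ptree_iff by blast
  qed
  ultimately show "wf_tree ptree"
    unfolding wf_tree_def using wf by (intro conjI notI) (assumption, elim bexE conjE, metis)
qed

text \<open>The point \<open>x\<close> only serves to provide an evaluation map \<open>f\<close>.
  The kernel is read off from \<open>f\<close> at nodes ending in a given vertex; what has to be
  shown is that different nodes with the same last entry give the same answer.\<close>

lemma kernel:
  assumes H: "\<And>B \<phi>. borel_code k B \<phi> \<Longrightarrow> \<exists>x\<in>partitions k. in_borel k x B \<phi> \<or> notin_borel k x B \<phi>"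
    and wf: "\<And>f. f \<in> \<S> \<Longrightarrow> function_on f UNIV UNIV \<Longrightarrow> \<not> path R f"
  shows "\<exists>v\<in>\<S>. \<forall>s. s \<in> v \<longleftrightarrow> (\<exists>t. pair s t \<in> R \<and> t \<notin> v)"
proof -
  obtain x f where x: "x \<in> partitions k" and f: "evaluation_map k ptree plabels x f"
    using H[OF borel_code_ptree[OF wf]] unfolding in_borel_def notin_borel_def by blast
  have fS: "f \<in> \<S>" using f unfolding evaluation_map_def by blast
  \<comment> \<open>Complementing the values at even length replaces the alternation of unions and
    intersections by one rule for all nodes: a node holds iff some child does not.\<close>
  define val where "val \<sigma> \<longleftrightarrow> (\<exists>l. l \<preceq> \<sigma> \<and> (seq \<sigma> l \<and> (pair \<sigma> \<one> \<in> f \<longleftrightarrow> odd_num l)))" for \<sigma>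
  have val: "val \<sigma> \<longleftrightarrow> (pair \<sigma> \<one> \<in> f \<longleftrightarrow> odd_num l)" if "seq \<sigma> l" for \<sigma> l
    unfolding val_def using that seq_length seq_length_le by blast
  have D0_val: "D0 (\<lambda>e. val (t e))" if "tm t" for t
    by (rule D0_subst1[OF _ that]) (unfold val_def, intro D0_intros tm_intros D0_seq D0_ex_le D0_odd_num fS)
  have step: "val \<sigma> \<longleftrightarrow> (\<exists>\<tau>\<in>children ptree \<sigma>. \<not> val \<tau>)" if \<sigma>: "\<sigma> \<in> ptree" for \<sigma>
  proof -
    obtain l where l: "seq \<sigma> l" using \<sigma> unfolding ptree_iff by blast
    have vc: "val \<tau> \<longleftrightarrow> (pair \<tau> \<one> \<in> f \<longleftrightarrow> \<not> odd_num l)" if "\<tau> \<in> children ptree \<sigma>" for \<tau>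
    proof -
      have "seq \<tau> (l \<oplus> \<one>)" using that append_entry_iff[OF l] unfolding children_def by blast
      then show ?thesis using val odd_num_succ by blast
    qed
    have ev: "leaf ptree \<sigma> \<longrightarrow> (pair \<sigma> \<one> \<in> f \<longleftrightarrow> (\<exists>l. pair \<sigma> l \<in> plabels \<and> in_clopen k x l))"
      "pair \<sigma> lab_union \<in> plabels \<longrightarrow> (pair \<sigma> \<one> \<in> f \<longleftrightarrow> (\<exists>\<tau>\<in>children ptree \<sigma>. pair \<tau> \<one> \<in> f))"
      "pair \<sigma> lab_inter \<in> plabels \<longrightarrow> (pair \<sigma> \<one> \<in> f \<longleftrightarrow> (\<forall>\<tau>\<in>children ptree \<sigma>. pair \<tau> \<one> \<in> f))"
      using f \<sigma> unfolding evaluation_map_def by blast+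
    have lab: "pair \<sigma> q \<in> plabels \<longleftrightarrow> q = (if leaf ptree \<sigma> then if odd_num l then lab_empty else lab_full
      else if odd_num l then lab_union else lab_inter)" for q
      unfolding plabels_iff plabel_iff[OF \<sigma> l] using \<sigma> by simp
    show ?thesis
    proof (cases "leaf ptree \<sigma>")
      case True
      then have "\<not> val \<sigma>" using ev(1) x unfolding lab val[OF l] by (simp add: lab_simps)
      then show ?thesis using True unfolding leaf_def by blast
    next
      case False
      show ?thesis
      proof (cases "odd_num l")
        case True
        then have "pair \<sigma> lab_union \<in> plabels" using False unfolding lab by simp
        then show ?thesis using ev(2) True vc unfolding val[OF l] by blast
      next
        case odd: False
        then have "pair \<sigma> lab_inter \<in> plabels" using False unfolding lab by simp
        then show ?thesis using ev(3) odd vc unfolding val[OF l] by blast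
      qed
    qed
  qed
  \<comment> \<open>A vertex is accompanied by two disagreeing nodes that end in it. The vertices
    alone form a set with a merely Sigma01 definition, which is the situation \<open>ex_path\<close>
    is made for.\<close>
  define D where "D = {z. \<exists>s y. z = pair s y \<and> (\<exists>\<sigma> \<tau>. y = pair \<sigma> \<tau> \<and>
    (\<sigma> \<in> ptree \<and> \<tau> \<in> ptree \<and> last_entry \<sigma> s \<and> last_entry \<tau> s \<and> \<not> (val \<sigma> \<longleftrightarrow> val \<tau>)))}"
  have "D \<in> \<S>" unfolding D_def
    by (intro D0_comp D0_ex_pair D0_intros tm_intros ptree_in_sets D0_val D0_last_entry)
  have D: "pair s y \<in> D \<longleftrightarrow> (\<exists>\<sigma> \<tau>. y = pair \<sigma> \<tau> \<and>
    \<sigma> \<in> ptree \<and> \<tau> \<in> ptree \<and> last_entry \<sigma> s \<and> last_entry \<tau> s \<and> val \<sigma> \<noteq> val \<tau>)" for s y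
    unfolding D_def by simp
  \<comment> \<open>A node that holds has a child that does not, ending in some \<open>t\<close>.
    The node that fails also has a child ending in \<open>t\<close>, and this one must hold; so the
    disagreement passes from \<open>s\<close> to \<open>t\<close>.\<close>
  have one: "\<exists>t y. pair t y \<in> D \<and> pair s t \<in> R"
    if *: "\<sigma> \<in> ptree" "\<tau> \<in> ptree" "last_entry \<sigma> s" "last_entry \<tau> s" "val \<sigma>" "\<not> val \<tau>" for s \<sigma> \<tau>
  proof -
    obtain \<sigma>' where \<sigma>': "\<sigma>' \<in> children ptree \<sigma>" "\<not> val \<sigma>'" using step * by blast
    then obtain t where t: "last_entry \<sigma>' t" "pair s t \<in> R" using children_ptree(1) * by blast
    then obtain \<tau>' where \<tau>': "\<tau>' \<in> children ptree \<tau>" "last_entry \<tau>' t" using children_ptree(2) * by blast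
    then have "val \<tau>'" using step * by blast
    then have "pair t (pair \<sigma>' \<tau>') \<in> D" using \<sigma>' \<tau>' t unfolding D children_def by blast
    then show ?thesis using t by blast
  qed
  have ser: "\<exists>t y'. pair t y' \<in> D \<and> pair s t \<in> R" if *: "pair s y \<in> D" for s y
  proof -
    obtain \<sigma> \<tau> where "\<sigma> \<in> ptree" "\<tau> \<in> ptree" "last_entry \<sigma> s" "last_entry \<tau> s" "val \<sigma> \<noteq> val \<tau>"
      using * unfolding D by blast
    then show ?thesis using one[of \<sigma> \<tau>] one[of \<tau> \<sigma>] by blast
  qed
  have "\<not> pair s y \<in> D" for s y
  proof
    assume "pair s y \<in> D"
    have "\<exists>g\<in>\<S>. function_on g UNIV {a. \<exists>y. pair a y \<in> D} \<and> path R g"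
      by (rule ex_path[OF R \<open>D \<in> \<S>\<close> \<open>pair s y \<in> D\<close>]) (rule ser)
    then obtain g where
      "g \<in> \<S>" "function_on g UNIV {a. \<exists>y. pair a y \<in> D}" "path R g" by blast
    moreover then have "function_on g UNIV UNIV" unfolding function_on_def by blast
    ultimately show False using wf by blast
  qed
  then have coh: "val \<sigma> = val \<tau>" if "\<sigma> \<in> ptree" "\<tau> \<in> ptree" "last_entry \<sigma> s" "last_entry \<tau> s" for \<sigma> \<tau> s
    using that unfolding D by blast
  define v where "v = {s. \<exists>\<sigma>. \<sigma> \<in> ptree \<and> last_entry \<sigma> s \<and> val \<sigma>}"
  have v: "s \<in> v \<longleftrightarrow> val \<sigma>" if "\<sigma> \<in> ptree" "last_entry \<sigma> s" for s \<sigma>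
    unfolding v_def using that coh by blast
  \<comment> \<open>By coherence, and because every vertex ends some node, it makes no difference
    whether some node or every node ending in \<open>s\<close> is required to hold.\<close>
  have "v \<in> \<S>"
    unfolding v_def
  proof (rule Delta_comp)
    show "D0 (\<lambda>e. e 0 \<in> ptree \<and> last_entry (e 0) (e 1) \<and> val (e 0))"
      by (intro D0_intros tm_intros ptree_in_sets D0_last_entry D0_val)
    show "D0 (\<lambda>e. e 0 \<in> ptree \<and> last_entry (e 0) (e 1) \<longrightarrow> val (e 0))"
      by (intro D0_intros tm_intros ptree_in_sets D0_last_entry D0_val)
    show "(\<exists>\<sigma>. \<sigma> \<in> ptree \<and> last_entry \<sigma> s \<and> val \<sigma>) = (\<forall>\<sigma>. \<sigma> \<in> ptree \<and> last_entry \<sigma> s \<longrightarrow> val \<sigma>)" for s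
      using coh ex_singleton[of s] by blast
  qed
  moreover have "s \<in> v \<longleftrightarrow> (\<exists>t. pair s t \<in> R \<and> t \<notin> v)" for s
  proof -
    obtain \<sigma> where \<sigma>: "\<sigma> \<in> ptree" "last_entry \<sigma> s" using ex_singleton by blast
    have "s \<in> v \<longleftrightarrow> (\<exists>\<tau>\<in>children ptree \<sigma>. \<not> val \<tau>)" using v[OF \<sigma>] step[OF \<sigma>(1)] by blast
    also have "\<dots> \<longleftrightarrow> (\<exists>t. pair s t \<in> R \<and> t \<notin> v)"
    proof
      assume "\<exists>\<tau>\<in>children ptree \<sigma>. \<not> val \<tau>"
      then obtain \<tau> where \<tau>: "\<tau> \<in> children ptree \<sigma>" "\<not> val \<tau>" by blast
      then obtain t where "last_entry \<tau> t" "pair s t \<in> R" using children_ptree(1)[OF \<sigma>] by blast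
      then show "\<exists>t. pair s t \<in> R \<and> t \<notin> v" using v \<tau> unfolding children_def by blast
    next
      assume "\<exists>t. pair s t \<in> R \<and> t \<notin> v"
      then obtain t where t: "pair s t \<in> R" "t \<notin> v" by blast
      then obtain \<tau> where "\<tau> \<in> children ptree \<sigma>" "last_entry \<tau> t" using children_ptree(2)[OF \<sigma>] by blast
      then show "\<exists>\<tau>\<in>children ptree \<sigma>. \<not> val \<tau>" using v t unfolding children_def by blast
    qed
    finally show ?thesis .
  qed
  ultimately show ?thesis by blast
qed

end

section \<open>Computable functions\<close>


text \<open>A function outside the model whose graph is a set of the model. It can enter a bounded
  formula through its graph, but not as a term.\<close>

definition cf :: "('a \<Rightarrow> 'a) \<Rightarrow> bool" where
  "cf h \<longleftrightarrow> {z. \<exists>x. z = pair x (h x)} \<in> \<S>"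

lemma cfI: "D0 (\<lambda>e. G (e 0) (e 1)) \<Longrightarrow> (\<And>x y. G x y \<longleftrightarrow> y = h x) \<Longrightarrow> cf h"
proof -
  assume G: "D0 (\<lambda>e. G (e 0) (e 1))" and eq: "\<And>x y. G x y \<longleftrightarrow> y = h x"
  have "{z. \<exists>x y. z = pair x y \<and> G x y} \<in> \<S>"
    by (intro D0_comp D0_ex_pair tm_intros D0_subst2[OF G])
  moreover have "{z. \<exists>x y. z = pair x y \<and> G x y} = {z. \<exists>x. z = pair x (h x)}" using eq by auto
  ultimately show "cf h" unfolding cf_def by simp
qed

text \<open>The value \<open>f x\<close> can be introduced by an existential as well as by a
  universal quantifier over the graph of \<open>f\<close>, so the set is Delta01.\<close>

lemma cf_Delta:
  assumes "cf f" "D0 (\<lambda>e. P (e 0) (e 1))"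
  shows "{x. P x (f x)} \<in> \<S>"
proof -
  let ?F = "{z. \<exists>x. z = pair x (f x)}"
  have F: "?F \<in> \<S>" using assms unfolding cf_def by simp
  have mem: "pair x y \<in> ?F \<longleftrightarrow> y = f x" for x y by auto
  have "{x. \<exists>y. pair x y \<in> ?F \<and> P x y} \<in> \<S>"
  proof (rule Delta_comp)
    show "D0 (\<lambda>e. pair (e 1) (e 0) \<in> ?F \<and> P (e 1) (e 0))"
      by (intro D0_conj D0_mem tm_intros F D0_subst2[OF assms(2)])
    show "D0 (\<lambda>e. pair (e 1) (e 0) \<in> ?F \<longrightarrow> P (e 1) (e 0))"
      by (intro D0_imp D0_mem tm_intros F D0_subst2[OF assms(2)])
  qed (unfold mem, blast)
  then show ?thesis unfolding mem by simp
qed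

lemma cf_set: "cf f \<Longrightarrow> X \<in> \<S> \<Longrightarrow> {x. f x \<in> X} \<in> \<S>"
  by (rule cf_Delta) (assumption, intro D0_mem tm_intros)

lemma cf_id: "cf (\<lambda>x. x)"
  by (rule cfI[of "\<lambda>x y. y = x"]) (intro D0_intros tm_intros, simp)

lemma cf_const: "cf (\<lambda>x. a)"
  by (rule cfI[of "\<lambda>x y. y = a"]) (intro D0_intros tm_intros, simp)

lemma cf_comp:
  assumes "cf g" "cf f"
  shows "cf (\<lambda>x. g (f x))"
proof -
  let ?F = "{z. \<exists>x. z = pair x (f x)}" and ?G = "{z. \<exists>x. z = pair x (g x)}"
  have F: "?F \<in> \<S>" "?G \<in> \<S>" using assms unfolding cf_def by simp_all
  have mem: "pair x y \<in> ?F \<longleftrightarrow> y = f x" "pair x y \<in> ?G \<longleftrightarrow> y = g x" for x y by auto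
  have "{z. \<exists>y. \<exists>x w. z = pair x w \<and> pair x y \<in> ?F \<and> pair y w \<in> ?G} \<in> \<S>"
  proof (rule Delta_comp)
    show "D0 (\<lambda>e. \<exists>x w. e 1 = pair x w \<and> pair x (e 0) \<in> ?F \<and> pair (e 0) w \<in> ?G)"
      by (intro D0_ex_pair D0_conj D0_mem tm_intros F)
    show "D0 (\<lambda>e. \<exists>x w. e 1 = pair x w \<and> (pair x (e 0) \<in> ?F \<longrightarrow> pair (e 0) w \<in> ?G))"
      by (intro D0_ex_pair D0_imp D0_mem tm_intros F)
    fix z
    show "(\<exists>y x w. z = pair x w \<and> pair x y \<in> ?F \<and> pair y w \<in> ?G) \<longleftrightarrow>
        (\<forall>y. \<exists>x w. z = pair x w \<and> (pair x y \<in> ?F \<longrightarrow> pair y w \<in> ?G))"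
      unfolding mem by (cases "\<exists>x w. z = pair x w") fastforce+
  qed
  then show ?thesis unfolding mem cf_def by simp
qed

lemma cf_pair:
  assumes "cf f" "cf g"
  shows "cf (\<lambda>x. pair (f x) (g x))"
proof -
  let ?F = "{z. \<exists>x. z = pair x (f x)}" and ?G = "{z. \<exists>x. z = pair x (g x)}"
  have F: "?F \<in> \<S>" "?G \<in> \<S>" using assms unfolding cf_def by simp_all
  show ?thesis
  proof (rule cfI[of "\<lambda>x y. \<exists>a b. y = pair a b \<and> pair x a \<in> ?F \<and> pair x b \<in> ?G"])
    show "D0 (\<lambda>e. \<exists>a b. e 1 = pair a b \<and> pair (e 0) a \<in> ?F \<and> pair (e 0) b \<in> ?G)"
      by (intro D0_ex_pair D0_conj D0_mem tm_intros F)
  qed auto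
qed

text \<open>Pairing is not onto; both projections are made total by the default 0, which accounts
  for the second disjunct in the proof of \<open>cf_case_pair\<close>.\<close>

definition lft :: "'a \<Rightarrow> 'a" where "lft z = (if \<exists>i j. z = pair i j then THE i. \<exists>j. z = pair i j else \<zero>)"
definition rgt :: "'a \<Rightarrow> 'a" where "rgt z = (if \<exists>i j. z = pair i j then THE j. \<exists>i. z = pair i j else \<zero>)"

lemma lft_pair [simp]: "lft (pair i j) = i" unfolding lft_def by auto
lemma rgt_pair [simp]: "rgt (pair i j) = j" unfolding rgt_def by auto

lemma cf_case_pair:
  assumes "D0 (\<lambda>e. G (e 0) (e 1) (e 2))" "\<And>i j y. G i j y \<longleftrightarrow> y = h i j"
  shows "cf (\<lambda>z. h (lft z) (rgt z))"
proof (rule cfI[of "\<lambda>z y. (\<exists>i j. z = pair i j \<and> G i j y) \<or> (\<not> (\<exists>i j. z = pair i j \<and> True) \<and> G \<zero> \<zero> y)"])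
  show "D0 (\<lambda>e. (\<exists>i j. e 0 = pair i j \<and> G i j (e 1)) \<or> (\<not> (\<exists>i j. e 0 = pair i j \<and> True) \<and> G \<zero> \<zero> (e 1)))"
    by (intro D0_ex_pair D0_bool D0_conj D0_disj D0_neg tm_intros D0_subst3[OF assms(1)])
  fix z y
  show "(\<exists>i j. z = pair i j \<and> G i j y) \<or> (\<not> (\<exists>i j. z = pair i j \<and> True) \<and> G \<zero> \<zero> y) \<longleftrightarrow> y = h (lft z) (rgt z)"
  proof (cases "\<exists>i j. z = pair i j")
    case True
    then obtain i j where "z = pair i j" by blast
    then show ?thesis by (simp add: assms(2))
  next
    case False
    then have "lft z = \<zero>" "rgt z = \<zero>" unfolding lft_def rgt_def by argo+
    then show ?thesis using False by (simp add: assms(2))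
  qed
qed

lemma cf_lft: "cf f \<Longrightarrow> cf (\<lambda>x. lft (f x))"
  by (rule cf_comp[OF cf_case_pair[of "\<lambda>i j y. y = i" "\<lambda>i j. i"]]) (intro D0_intros tm_intros, simp)

lemma cf_rgt: "cf f \<Longrightarrow> cf (\<lambda>x. rgt (f x))"
  by (rule cf_comp[OF cf_case_pair[of "\<lambda>i j y. y = j" "\<lambda>i j. j"]]) (intro D0_intros tm_intros, simp)

lemma cf_binary:
  assumes "D0 (\<lambda>e. e 2 = h (e 0) (e 1))" "cf f" "cf g"
  shows "cf (\<lambda>x. h (f x) (g x))"
  using cf_comp[OF cf_case_pair[of "\<lambda>i j y. y = h i j" h] cf_pair[OF assms(2,3)]] assms(1) by simp

lemma cf_plus: "cf f \<Longrightarrow> cf g \<Longrightarrow> cf (\<lambda>x. f x \<oplus> g x)"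
  by (rule cf_binary[of "(\<oplus>)"]) (intro D0_intros tm_intros)

lemma cf_times: "cf f \<Longrightarrow> cf g \<Longrightarrow> cf (\<lambda>x. f x \<otimes> g x)"
  by (rule cf_binary[of "(\<otimes>)"]) (intro D0_intros tm_intros)

lemma cf_If:
  assumes "B \<in> \<S>" "cf f" "cf g"
  shows "cf (\<lambda>x. if x \<in> B then f x else g x)"
proof -
  let ?F = "{z. \<exists>x. z = pair x (f x)}" and ?G = "{z. \<exists>x. z = pair x (g x)}"
  have F: "?F \<in> \<S>" "?G \<in> \<S>" using assms unfolding cf_def by simp_all
  show ?thesis
  proof (rule cfI[of "\<lambda>x y. if x \<in> B then pair x y \<in> ?F else pair x y \<in> ?G"])
    show "D0 (\<lambda>e. if e 0 \<in> B then pair (e 0) (e 1) \<in> ?F else pair (e 0) (e 1) \<in> ?G)"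
      by (intro D0_If D0_mem tm_intros F assms)
  qed auto
qed

lemma UNIV_in_sets: "UNIV \<in> \<S>"
  using D0_comp[OF D0_bool[of True]] by simp

lemma empty_in_sets: "{} \<in> \<S>"
  using D0_comp[OF D0_bool[of False]] by simp

lemma Compl_in_sets: "X \<in> \<S> \<Longrightarrow> - X \<in> \<S>"
  using D0_comp[of "\<lambda>x. x \<notin> X"] by (simp add: D0_intros tm_intros Compl_eq)

lemma If_in_sets: "B \<in> \<S> \<Longrightarrow> X \<in> \<S> \<Longrightarrow> Y \<in> \<S> \<Longrightarrow> {x. if x \<in> B then x \<in> X else x \<in> Y} \<in> \<S>"
  by (intro D0_comp D0_If D0_mem tm_intros)

section \<open>A normal form for arithmetical formulas\<close>

text \<open>With environments coded as iterated pairs, a formula becomes a predicate of a single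
  number and a quantifier changes one component of it.\<close>

primrec entry :: "nat \<Rightarrow> 'a \<Rightarrow> 'a" where
  "entry 0 w = lft w"
| "entry (Suc n) w = entry n (rgt w)"

primrec upd :: "nat \<Rightarrow> 'a \<Rightarrow> 'a \<Rightarrow> 'a" where
  "upd 0 c w = pair c (rgt w)"
| "upd (Suc x) c w = pair (lft w) (upd x c (rgt w))"

primrec env_code :: "nat \<Rightarrow> (nat \<Rightarrow> 'a) \<Rightarrow> 'a" where
  "env_code 0 e = \<zero>"
| "env_code (Suc N) e = pair (e 0) (env_code N (\<lambda>n. e (Suc n)))"

lemma entry_upd: "entry n (upd x c w) = (if n = x then c else entry n w)"
proof (induction x arbitrary: n w)
  case 0 then show ?case by (cases n) simp_all
next
  case (Suc x) then show ?case by (cases n) simp_all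
qed

lemma entry_fun_upd: "(\<lambda>n. entry n w)(x := c) = (\<lambda>n. entry n (upd x c w))"
  by (auto simp: entry_upd)

lemma entry_env_code: "n < N \<Longrightarrow> entry n (env_code N e) = e n"
proof (induction N arbitrary: n e)
  case (Suc N) then show ?case by (cases n) simp_all
qed simp

lemma cf_entry: "cf f \<Longrightarrow> cf (\<lambda>x. entry n (f x))"
  by (induction n arbitrary: f) (simp_all add: cf_lft cf_rgt)

lemma cf_upd: "cf f \<Longrightarrow> cf g \<Longrightarrow> cf (\<lambda>x. upd y (f x) (g x))"
  by (induction y arbitrary: g) (simp_all add: cf_pair cf_lft cf_rgt)

lemma cf_tval: "cf (\<lambda>w. tval (\<lambda>n. entry n w) t)"
  by (induction t) (simp_all add: cf_entry[OF cf_id] cf_const cf_plus cf_times)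

text \<open>The normal form: \<open>d\<close> quantifiers, each followed by a negation, in front of a single query
  \<open>q u \<in> Z\<close>, which depending on \<open>u\<close> may be negated or replaced by a constant.\<close>

primrec nex :: "nat \<Rightarrow> ('a \<Rightarrow> 'a set \<Rightarrow> bool) \<Rightarrow> 'a \<Rightarrow> 'a set \<Rightarrow> bool" where
  "nex 0 L w Z = L w Z"
| "nex (Suc d) L w Z = (\<exists>c. \<not> nex d L (pair c w) Z)"

text \<open>The query is made if \<open>u \<in> A\<close> and counts as false otherwise;
  \<open>u \<in> C\<close> reverses the outcome. In this form literals are closed under negation and
  under case distinctions.\<close>

definition lit :: "'a set \<Rightarrow> 'a set \<Rightarrow> ('a \<Rightarrow> 'a) \<Rightarrow> 'a \<Rightarrow> 'a set \<Rightarrow> bool" where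
  "lit C A q u Z \<longleftrightarrow> (u \<in> C) \<noteq> (u \<in> A \<and> q u \<in> Z)"

definition literal :: "('a \<Rightarrow> 'a set \<Rightarrow> bool) \<Rightarrow> bool" where
  "literal L \<longleftrightarrow> (\<exists>C\<in>\<S>. \<exists>A\<in>\<S>. \<exists>q. cf q \<and> L = lit C A q)"

definition nf :: "nat \<Rightarrow> ('a \<Rightarrow> 'a set \<Rightarrow> bool) \<Rightarrow> bool" where
  "nf d P \<longleftrightarrow> (\<exists>L. literal L \<and> P = nex d L)"

lemma literal_neg: "literal L \<Longrightarrow> literal (\<lambda>u Z. \<not> L u Z)"
  unfolding literal_def
proof (elim bexE exE conjE)
  fix C A q assume *: "C \<in> \<S>" "A \<in> \<S>" "cf q" "L = lit C A q"
  then have "(\<lambda>u Z. \<not> L u Z) = lit (- C) A q" by (auto simp: lit_def fun_eq_iff)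
  then show "\<exists>C\<in>\<S>. \<exists>A\<in>\<S>. \<exists>q. cf q \<and> (\<lambda>u Z. \<not> L u Z) = lit C A q"
    using * Compl_in_sets by blast
qed

lemma literal_subst: "literal L \<Longrightarrow> cf h \<Longrightarrow> literal (\<lambda>u. L (h u))"
  unfolding literal_def
proof (elim bexE exE conjE)
  fix C A q assume *: "C \<in> \<S>" "A \<in> \<S>" "cf q" "L = lit C A q" "cf h"
  then have "(\<lambda>u. L (h u)) = lit {u. h u \<in> C} {u. h u \<in> A} (\<lambda>u. q (h u))" by (auto simp: lit_def fun_eq_iff)
  then show "\<exists>C\<in>\<S>. \<exists>A\<in>\<S>. \<exists>q. cf q \<and> (\<lambda>u. L (h u)) = lit C A q"
    using * cf_set cf_comp by blast
qed

lemma literal_If: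
  assumes "B \<in> \<S>" "literal L" "literal L'"
  shows "literal (\<lambda>u. if u \<in> B then L u else L' u)"
proof -
  obtain C A q C' A' q' where *: "C \<in> \<S>" "A \<in> \<S>" "cf q" "L = lit C A q"
    "C' \<in> \<S>" "A' \<in> \<S>" "cf q'" "L' = lit C' A' q'"
    using assms(2,3) unfolding literal_def by blast
  have "(\<lambda>u. if u \<in> B then L u else L' u) = lit {u. if u \<in> B then u \<in> C else u \<in> C'}
      {u. if u \<in> B then u \<in> A else u \<in> A'} (\<lambda>u. if u \<in> B then q u else q' u)"
    unfolding *(4,8) by (auto simp: lit_def fun_eq_iff)
  then show ?thesis
    unfolding literal_def using If_in_sets[OF assms(1) *(1,5)] If_in_sets[OF assms(1) *(2,6)] cf_If[OF assms(1) *(3,7)]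
    by blast
qed

text \<open>Each quantifier pairs its value with the number at hand, so under it the substitution
  has to act on the second component only. The resulting \<open>h'\<close> does not depend on the
  literal.\<close>

lemma nex_subst: "cf h \<Longrightarrow> \<exists>h'. cf h' \<and> (\<forall>L w Z. nex d L (h w) Z = nex d (\<lambda>u. L (h' u)) w Z)"
proof (induction d arbitrary: h)
  case 0 then show ?case by auto
next
  case (Suc d)
  have "cf (\<lambda>z. pair (lft z) (h (rgt z)))"
    by (intro cf_pair cf_lft cf_id cf_comp[OF Suc.prems] cf_rgt)
  from Suc.IH[OF this] obtain h' where h': "cf h'"
    "\<And>L w Z. nex d L (pair (lft w) (h (rgt w))) Z = nex d (\<lambda>u. L (h' u)) w Z" by blast
  have "nex d L (pair c (h w)) Z = nex d (\<lambda>u. L (h' u)) (pair c w) Z" for L w Z c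
    using h'(2)[of L "pair c w" Z] by simp
  then show ?case using h'(1) by auto
qed

lemma nf_subst: "nf d P \<Longrightarrow> cf h \<Longrightarrow> nf d (\<lambda>w. P (h w))"
  unfolding nf_def
proof (elim exE conjE)
  fix L assume h: "cf h" and L: "literal L" "P = nex d L"
  obtain h' where h': "cf h'" "\<And>L w Z. nex d L (h w) Z = nex d (\<lambda>u. L (h' u)) w Z"
    using nex_subst[OF h] by blast
  then have "(\<lambda>w. P (h w)) = nex d (\<lambda>u. L (h' u))" unfolding L by blast
  then show "\<exists>L. literal L \<and> (\<lambda>w. P (h w)) = nex d L" using literal_subst[OF L(1) h'(1)] by blast
qed

lemma nf_nex: "nf d P \<Longrightarrow> nf (Suc d) (\<lambda>w Z. \<exists>c. \<not> P (pair c w) Z)"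
  unfolding nf_def by (elim exE conjE) (auto simp: fun_eq_iff)

lemma nf_neg: "nf d P \<Longrightarrow> nf (Suc d) (\<lambda>w Z. \<not> P w Z)"
  using nf_nex[OF nf_subst[OF _ cf_rgt[OF cf_id]]] by simp

lemma nex_inner: "nex (Suc d) L w Z = nex d (\<lambda>u Z. \<exists>c. \<not> L (pair c u) Z) w Z"
  by (induction d arbitrary: w) simp_all

text \<open>The additional quantifier is a dummy in innermost position; its negation is compensated
  by negating the literal, so the outer quantifiers remain as they are.\<close>

lemma nf_pad: "nf d P \<Longrightarrow> nf (d + n) P"
proof (induction n)
  case (Suc n)
  then obtain L where L: "literal L" "P = nex (d + n) L" unfolding nf_def by blast
  have "P = nex (Suc (d + n)) (\<lambda>u Z. \<not> L (rgt u) Z)"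
    by (intro ext) (simp only: L(2) nex_inner rgt_pair simp_thms)
  moreover have "literal (\<lambda>u Z. \<not> L (rgt u) Z)"
    by (rule literal_neg[OF literal_subst[OF L(1) cf_rgt[OF cf_id]]])
  ultimately show ?case unfolding nf_def by auto
qed simp

text \<open>The case distinction is moved past \<open>d\<close> quantifiers into the literal, where
  removing the \<open>d\<close> values paired in front recovers the original
  \<open>w\<close>.\<close>

lemma nex_If: "(if w \<in> B then nex d L w Z else nex d L' w Z) =
    nex d (\<lambda>u. if (rgt ^^ d) u \<in> B then L u else L' u) w Z"
proof (induction d arbitrary: w B)
  case (Suc d)
  have "nex (Suc d) (\<lambda>u. if (rgt ^^ Suc d) u \<in> B then L u else L' u) w Z \<longleftrightarrow>
      (\<exists>c. \<not> nex d (\<lambda>u. if (rgt ^^ d) u \<in> {z. rgt z \<in> B} then L u else L' u) (pair c w) Z)"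
    by simp
  also have "\<dots> \<longleftrightarrow> (\<exists>c. \<not> (if pair c w \<in> {z. rgt z \<in> B} then nex d L (pair c w) Z else nex d L' (pair c w) Z))"
    unfolding Suc[symmetric] ..
  finally show ?case by simp
qed simp

lemma nf_If:
  assumes "B \<in> \<S>" "nf d P" "nf d Q"
  shows "nf d (\<lambda>w. if w \<in> B then P w else Q w)"
proof -
  obtain L L' where L: "literal L" "P = nex d L" "literal L'" "Q = nex d L'"
    using assms(2,3) unfolding nf_def by blast
  have "cf (\<lambda>u. (rgt ^^ d) u)" by (induction d) (simp_all add: cf_id cf_rgt)
  then have B: "{u. (rgt ^^ d) u \<in> B} \<in> \<S>" using cf_set assms(1) by blast
  have "(\<lambda>w. if w \<in> B then P w else Q w) = nex d (\<lambda>u. if u \<in> {u. (rgt ^^ d) u \<in> B} then L u else L' u)"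
  proof (intro ext)
    fix w Z show "(if w \<in> B then P w else Q w) Z =
        nex d (\<lambda>u. if u \<in> {u. (rgt ^^ d) u \<in> B} then L u else L' u) w Z"
      using nex_If[of w B d L Z L'] unfolding L by (simp split: if_splits)
  qed
  then show ?thesis unfolding nf_def using literal_If[OF B L(1,3)] by blast
qed

definition NF :: "('a \<Rightarrow> 'a set \<Rightarrow> bool) \<Rightarrow> bool" where
  "NF P \<longleftrightarrow> (\<exists>d. nf d P)"

lemma NF_neg: "NF P \<Longrightarrow> NF (\<lambda>w Z. \<not> P w Z)"
  unfolding NF_def using nf_neg by blast

lemma NF_ex:
  assumes "NF P"
  shows "NF (\<lambda>w Z. \<exists>c. P (upd x c w) Z)"
proof -
  obtain d where "nf d P" using assms unfolding NF_def by blast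
  from nf_nex[OF nf_subst[OF nf_neg[OF this], of "\<lambda>z. upd x (lft z) (rgt z)"]]
  show ?thesis unfolding NF_def by (auto simp: cf_upd cf_lft cf_rgt cf_id)
qed

text \<open>A disjunction is an existential quantifier over a selector \<open>c\<close>, where 0
  selects the first disjunct and every other number the second. Both disjuncts must have the same
  depth, hence the padding.\<close>

lemma NF_disj:
  assumes "NF P" "NF Q"
  shows "NF (\<lambda>w Z. P w Z \<or> Q w Z)"
proof -
  obtain d d' where d: "nf d (\<lambda>w Z. \<not> P w Z)" "nf d' (\<lambda>w Z. \<not> Q w Z)"
    using NF_neg[OF assms(1)] NF_neg[OF assms(2)] unfolding NF_def by blast
  then have "nf (d + d') (\<lambda>w Z. \<not> P w Z)" "nf (d + d') (\<lambda>w Z. \<not> Q w Z)"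
    using nf_pad[OF d(1), of d'] nf_pad[OF d(2), of d] by (simp_all add: add.commute)
  then have "nf (d + d') (\<lambda>z Z. \<not> P (rgt z) Z)" "nf (d + d') (\<lambda>z Z. \<not> Q (rgt z) Z)"
    using nf_subst[OF _ cf_rgt[OF cf_id]] by blast+
  moreover have "{z. lft z \<in> {\<zero>}} \<in> \<S>"
    using D0_comp[of "\<lambda>x. x = \<zero>"] by (intro cf_set cf_lft cf_id) (simp add: D0_intros tm_intros)
  ultimately have "nf (d + d') (\<lambda>z. if z \<in> {z. lft z \<in> {\<zero>}} then \<lambda>Z. \<not> P (rgt z) Z else (\<lambda>Z. \<not> Q (rgt z) Z))"
    by (intro nf_If)
  note * = nf_nex[OF this]
  have "(\<lambda>w Z. \<exists>c. \<not> (if pair c w \<in> {z. lft z \<in> {\<zero>}} then \<lambda>Z. \<not> P (rgt (pair c w)) Z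
      else (\<lambda>Z. \<not> Q (rgt (pair c w)) Z)) Z) = (\<lambda>w Z. P w Z \<or> Q w Z)"
    by (intro ext) (auto intro: exI[of _ \<zero>] exI[of _ \<one>])
  with * show ?thesis unfolding NF_def by auto
qed

lemma NF_lit: "C \<in> \<S> \<Longrightarrow> A \<in> \<S> \<Longrightarrow> cf q \<Longrightarrow> NF (\<lambda>w Z. (w \<in> C) \<noteq> (w \<in> A \<and> q w \<in> Z))"
  unfolding NF_def nf_def literal_def lit_def
  by (intro exI[of _ 0] exI[of _ "lit C A q"]) (auto simp: lit_def fun_eq_iff)

lemma NF_set: "C \<in> \<S> \<Longrightarrow> NF (\<lambda>w Z. w \<in> C)"
  using NF_lit[of C "{}" "\<lambda>w. w"] by (simp add: empty_in_sets cf_id)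

text \<open>Each set variable denotes either the set argument or a fixed set of the model. Atoms
  without the set argument become decidable sets of environment codes, and an atom about it becomes
  a query of the value of its term.\<close>

lemma NF_sat:
  assumes "arithmetical \<theta>" "\<And>X. (\<forall>Z. s Z X = Z) \<or> (\<exists>A\<in>\<S>. \<forall>Z. s Z X = A)"
  shows "NF (\<lambda>w Z. sat (\<lambda>n. entry n w) (s Z) \<theta>)"
  using assms(1)
proof (induction \<theta>)
  case (Eq t u)
  have "{z. \<exists>i j. z = pair i j \<and> j = i} \<in> \<S>" by (intro D0_comp D0_ex_pair D0_eq tm_intros)
  from NF_set[OF cf_set[OF cf_pair[OF cf_tval[of u] cf_tval[of t]] this]] show ?case by simp
next
  case (Less t u)
  have "{z. \<exists>i j. z = pair i j \<and> i \<prec> j} \<in> \<S>" by (intro D0_comp D0_ex_pair D0_less tm_intros)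
  from NF_set[OF cf_set[OF cf_pair[OF cf_tval[of t] cf_tval[of u]] this]] show ?case by simp
next
  case (Mem t X)
  consider "\<forall>Z. s Z X = Z" | A where "A \<in> \<S>" "\<forall>Z. s Z X = A" using assms(2)[of X] by metis
  then show ?case
  proof cases
    case 1
    have "NF (\<lambda>w Z. tval (\<lambda>n. entry n w) t \<in> Z)"
      using NF_lit[OF empty_in_sets UNIV_in_sets cf_tval[of t]] by simp
    then show ?thesis by (simp add: 1)
  next
    case (2 A)
    have "NF (\<lambda>w Z. tval (\<lambda>n. entry n w) t \<in> A)"
      using NF_set[OF cf_set[OF cf_tval[of t] 2(1)]] by simp
    then show ?thesis by (simp add: 2(2))
  qed
next
  case (Neg \<theta>) then show ?case by (simp add: NF_neg)
next
  case (Conj \<theta> \<psi>)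
  then have "NF (\<lambda>w Z. \<not> (\<not> sat (\<lambda>n. entry n w) (s Z) \<theta> \<or> \<not> sat (\<lambda>n. entry n w) (s Z) \<psi>))"
    by (intro NF_neg NF_disj) simp_all
  then show ?case by simp
next
  case (Disj \<theta> \<psi>) then show ?case by (simp add: NF_disj)
next
  case (Imp \<theta> \<psi>)
  then have "NF (\<lambda>w Z. \<not> sat (\<lambda>n. entry n w) (s Z) \<theta> \<or> sat (\<lambda>n. entry n w) (s Z) \<psi>)"
    by (intro NF_neg NF_disj) simp_all
  then show ?case by (simp only: sat.simps imp_conv_disj)
next
  case (AllN x \<theta>)
  then have "NF (\<lambda>w Z. sat (\<lambda>n. entry n w) (s Z) \<theta>)" by simp
  from NF_neg[OF NF_ex[OF NF_neg[OF this], of x]] show ?case by (simp add: entry_fun_upd)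
next
  case (ExN x \<theta>)
  then have "NF (\<lambda>w Z. sat (\<lambda>n. entry n w) (s Z) \<theta>)" by simp
  from NF_ex[OF this, of x] show ?case by (simp add: entry_fun_upd)
qed simp_all

primrec num_vars :: "fm \<Rightarrow> nat set" where
  "num_vars (Eq t u) = tvars t \<union> tvars u"
| "num_vars (Less t u) = tvars t \<union> tvars u"
| "num_vars (Mem t X) = tvars t"
| "num_vars (Neg \<phi>) = num_vars \<phi>"
| "num_vars (Conj \<phi> \<psi>) = num_vars \<phi> \<union> num_vars \<psi>"
| "num_vars (Disj \<phi> \<psi>) = num_vars \<phi> \<union> num_vars \<psi>"
| "num_vars (Imp \<phi> \<psi>) = num_vars \<phi> \<union> num_vars \<psi>"
| "num_vars (AllN x \<phi>) = num_vars \<phi>"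
| "num_vars (ExN x \<phi>) = num_vars \<phi>"
| "num_vars (AllS X \<phi>) = num_vars \<phi>"
| "num_vars (ExS X \<phi>) = num_vars \<phi>"

lemma finite_num_vars: "finite (num_vars \<phi>)"
proof -
  have "finite (tvars t)" for t by (induction t) auto
  then show ?thesis by (induction \<phi>) auto
qed

lemma sat_cong: "(\<And>x. x \<in> num_vars \<phi> \<Longrightarrow> e x = e' x) \<Longrightarrow> sat e s \<phi> = sat e' s \<phi>"
proof (induction \<phi> arbitrary: e e' s)
  case (Eq t u) then show ?case using tval_cong[of t e e'] tval_cong[of u e e'] by simp
next
  case (Less t u) then show ?case using tval_cong[of t e e'] tval_cong[of u e e'] by simp
next
  case (Mem t X) then show ?case using tval_cong[of t e e'] by simp
next
  case (Neg \<phi>) from Neg.IH[of e e'] Neg.prems show ?case by simp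
next
  case (Conj \<phi> \<psi>) from Conj.IH[of e e'] Conj.prems show ?case by simp
next
  case (Disj \<phi> \<psi>) from Disj.IH[of e e'] Disj.prems show ?case by simp
next
  case (Imp \<phi> \<psi>) from Imp.IH[of e e'] Imp.prems show ?case by simp
next
  case (AllN x \<phi>)
  have "sat (e(x := a)) s \<phi> = sat (e'(x := a)) s \<phi>" for a
    by (rule AllN.IH) (use AllN.prems in auto)
  then show ?case by simp
next
  case (ExN x \<phi>)
  have "sat (e(x := a)) s \<phi> = sat (e'(x := a)) s \<phi>" for a
    by (rule ExN.IH) (use ExN.prems in auto)
  then show ?case by simp
next
  case (AllS X \<phi>)
  have "sat e s \<phi> = sat e' s \<phi>" for s by (rule AllS.IH) (use AllS.prems in auto)
  then show ?case by simp
next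
  case (ExS X \<phi>)
  have "sat e s \<phi> = sat e' s \<phi>" for s by (rule ExS.IH) (use ExS.prems in auto)
  then show ?case by simp
qed

text \<open>Only finitely many number variables occur in \<theta>, so the assignment can be replaced
  by the code of an initial part of it, with \<open>n\<close> put in at \<open>x\<close>.\<close>

lemma sat_normal_form:
  assumes "arithmetical \<theta>" "\<And>X. (\<forall>Z. s Z X = Z) \<or> (\<exists>A\<in>\<S>. \<forall>Z. s Z X = A)"
  obtains d L g where "literal L" "cf g" "\<And>n Z. sat (e(x := n)) (s Z) \<theta> = nex d L (g n) Z"
proof -
  have "NF (\<lambda>w Z. sat (\<lambda>n. entry n w) (s Z) \<theta>)"
    by (rule NF_sat[where s = s, OF assms(1)]) (rule assms(2))
  then obtain d L where L: "literal L" "(\<lambda>w Z. sat (\<lambda>n. entry n w) (s Z) \<theta>) = nex d L"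
    unfolding NF_def nf_def by blast
  obtain N where N: "\<And>n. n \<in> num_vars \<theta> \<Longrightarrow> n < N"
    using finite_num_vars[of \<theta>] by (meson finite_nat_set_iff_bounded)
  let ?g = "\<lambda>n. upd x n (env_code N e)"
  have "sat (e(x := n)) (s Z) \<theta> = nex d L (?g n) Z" for n Z
  proof -
    have "sat (e(x := n)) (s Z) \<theta> = sat (\<lambda>m. entry m (?g n)) (s Z) \<theta>"
      by (rule sat_cong) (use N in \<open>auto simp: entry_upd entry_env_code\<close>)
    then show ?thesis using fun_cong[OF fun_cong[OF L(2)]] by simp
  qed
  moreover have "cf ?g" by (intro cf_upd cf_id cf_const)
  ultimately show thesis using that L(1) by blast
qed

section \<open>Transfinite recursion from kernels\<close>


lemma less_in_field: "LO X \<Longrightarrow> less_in X i j \<Longrightarrow> i \<in> field X \<and> j \<in> field X"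
  unfolding LO_def less_in_def by (metis pair_inject)

lemma D0_less_in: "X \<in> \<S> \<Longrightarrow> tm t \<Longrightarrow> tm u \<Longrightarrow> D0 (\<lambda>e. less_in X (t e) (u e))"
  unfolding less_in_def by (intro D0_intros tm_intros)

lemma field_in_sets: "X \<in> \<S> \<Longrightarrow> field X \<in> \<S>"
  unfolding field_def by (intro D0_comp D0_intros tm_intros)

text \<open>\<open>E\<close> is determined by \<open>R\<close>, but its existence is an instance of
  arithmetical comprehension and therefore part of the hypothesis.\<close>

definition kernels_exist :: bool where
  "kernels_exist \<longleftrightarrow> (\<forall>R\<in>\<S>. \<forall>E\<in>\<S>. (\<forall>s. s \<in> E \<longleftrightarrow> (\<exists>t. pair s t \<in> R)) \<longrightarrow>
     (\<forall>f\<in>\<S>. function_on f UNIV UNIV \<longrightarrow> \<not> path R f) \<longrightarrow>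
     (\<exists>v\<in>\<S>. \<forall>s. s \<in> v \<longleftrightarrow> (\<exists>t. pair s t \<in> R \<and> t \<notin> v)))"

lemma kernels_existI:
  assumes "\<And>B \<phi>. borel_code k B \<phi> \<Longrightarrow> \<exists>x\<in>partitions k. in_borel k x B \<phi> \<or> notin_borel k x B \<phi>"
  shows kernels_exist
  unfolding kernels_exist_def
proof (intro ballI impI)
  fix R E
  assume "R \<in> \<S>" "E \<in> \<S>" "\<forall>s. s \<in> E \<longleftrightarrow> (\<exists>t. pair s t \<in> R)"
    "\<forall>f\<in>\<S>. function_on f UNIV UNIV \<longrightarrow> \<not> path R f"
  then show "\<exists>v\<in>\<S>. \<forall>s. s \<in> v \<longleftrightarrow> (\<exists>t. pair s t \<in> R \<and> t \<notin> v)"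
    by (intro kernel[of R E k] assms) auto
qed

text \<open>The condition on a kernel, that some successor is not in \<open>v\<close>, has the same
  form as the clause of \<open>nex\<close>, that some \<open>c\<close> does not satisfy the rest.
  Hence \<open>(j, (l, u))\<close> is in the kernel iff the part of the normal form that remains
  after \<open>l\<close> quantifiers is true of \<open>u\<close> at stage \<open>j\<close>.\<close>

lemma iterates_exist:
  assumes K: kernels_exist
    and L: "literal L" and g: "cf g" and X: "X \<in> \<S>" "WO X"
  shows "\<exists>Y\<in>\<S>. Y = {z. \<exists>n j. z = pair n j \<and> j \<in> field X \<and> nex d L (g n) (below X Y j)}"
proof -
  have LO: "LO X" using X(2) unfolding WO_def by blast
  obtain C A q where C: "C \<in> \<S>" and A: "A \<in> \<S>" and q: "cf q" and L_eq: "L = lit C A q"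
    using L unfolding literal_def by blast
  define G where "G = {z. \<exists>x. z = pair x (g x)}"
  have GS: "G \<in> \<S>" using g unfolding cf_def G_def by simp
  have G: "pair x y \<in> G \<longleftrightarrow> y = g x" for x y unfolding G_def by auto
  \<comment> \<open>\<open>R\<close> has to be defined by a bounded formula, whereas
    \<open>q\<close> and \<open>g\<close> are only available through their graphs. So the question
    whether a query concerns an earlier stage and the place where it leads are made into sets,
    \<open>K\<close> and \<open>T\<close>.\<close>
  define K0 where "K0 = {z. \<exists>p j. z = pair p j \<and> (\<exists>m i. p = pair m i \<and> less_in X i j)}"
  define T0 where "T0 = {z. \<exists>p y. z = pair p y \<and> (\<exists>m i. p = pair m i \<and> (\<exists>i' u. y = pair i' u \<and> i' = i \<and> pair m u \<in> G))}"
  have K0S: "K0 \<in> \<S>" unfolding K0_def by (intro D0_comp D0_ex_pair tm_intros D0_less_in X)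
  have T0S: "T0 \<in> \<S>" unfolding T0_def by (intro D0_comp D0_ex_pair D0_conj D0_eq D0_mem tm_intros GS)
  define K where "K = {z. if z \<in> {z. lft z \<in> A} then z \<in> {z. pair (q (lft z)) (rgt z) \<in> K0} else z \<in> {}}"
  define T where "T = {z. pair (q (lft z)) (rgt z) \<in> T0}"
  have KS: "K \<in> \<S>" unfolding K_def
    by (intro If_in_sets cf_set cf_pair cf_lft cf_rgt cf_id cf_comp[OF q] A K0S empty_in_sets)
  have TS: "T \<in> \<S>" unfolding T_def
    by (intro cf_set cf_pair cf_lft cf_rgt cf_id cf_comp[OF q] T0S)
  have K_iff: "pair u j \<in> K \<longleftrightarrow> u \<in> A \<and> (\<exists>m i. q u = pair m i \<and> less_in X i j)" for u j
    unfolding K_def K0_def by simp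
  have T_iff: "pair u (pair i' u') \<in> T \<longleftrightarrow> (\<exists>m. q u = pair m i' \<and> u' = g m)" for u i' u'
    unfolding T_def T0_def by (auto simp: G)
  \<comment> \<open>A vertex \<open>(j, (l, u))\<close> is at level \<open>l\<close> of the block of stage \<open>j\<close>, and \<open>u\<close> codes the values chosen so
    far. The query is made at level \<open>d\<close> or, if it has to be negated, at level \<open>d + 1\<close>; the vertices at
    level \<open>d + 2\<close> are dead ends.\<close>
  let ?e = "num d \<oplus> \<one>"
  define stp where "stp j l u j' l' u' \<longleftrightarrow>
     (l \<prec> num d \<and> j' = j \<and> l' = l \<oplus> \<one> \<and> (\<exists>c w. u' = pair c w \<and> w = u)) \<or>
     (l = num d \<and> u \<notin> C \<and> j' = j \<and> l' = l \<oplus> \<one> \<and> u' = u) \<or>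
     ((l = num d \<and> u \<in> C \<or> l = ?e) \<and>
       (if pair u j \<in> K then l' = \<zero> \<and> pair u (pair j' u') \<in> T
        else j' = \<zero> \<and> l' = ?e \<oplus> \<one> \<and> u' = \<zero>))" for j l u j' l' u'
  define R where "R = {z. \<exists>s s'. z = pair s s' \<and> (\<exists>j y. s = pair j y \<and> (\<exists>l u. y = pair l u \<and>
    (\<exists>j' y'. s' = pair j' y' \<and> (\<exists>l' u'. y' = pair l' u' \<and> stp j l u j' l' u'))))}"
  define E where "E = {s. \<exists>j y. s = pair j y \<and> (\<exists>l u. y = pair l u \<and> l \<preceq> ?e)}"
  have RS: "R \<in> \<S>"
    unfolding R_def stp_def
    by (intro D0_comp D0_ex_pair D0_If D0_conj D0_disj D0_neg D0_eq D0_mem D0_less tm_intros C KS TS)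
  have ES: "E \<in> \<S>" unfolding E_def by (intro D0_comp D0_ex_pair D0_le tm_intros)
  have R: "pair (pair j (pair l u)) s' \<in> R \<longleftrightarrow> (\<exists>j' l' u'. s' = pair j' (pair l' u') \<and> stp j l u j' l' u')"
    for j l u s' unfolding R_def by auto
  have R_dom: "\<exists>j l u. s = pair j (pair l u)" if "pair s s' \<in> R" for s s'
    using that unfolding R_def by auto
  \<comment> \<open>Exactly the vertices of level at most \<open>d + 1\<close> have successors,
    which makes the set \<open>E\<close> of non-dead ends decidable.\<close>
  have stp_dom: "(\<exists>j' l' u'. stp j l u j' l' u') \<longleftrightarrow> l \<preceq> ?e" for j l u
  proof
    show "\<exists>j' l' u'. stp j l u j' l' u' \<Longrightarrow> l \<preceq> ?e"
      unfolding stp_def by (auto simp: le_def[of _ "?e"] N.less_imp_le)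
    assume "l \<preceq> ?e"
    then consider "l \<prec> num d" | "l = num d" "u \<notin> C" | "l = num d \<and> u \<in> C \<or> l = ?e"
      unfolding le_def less_succ by blast
    then show "\<exists>j' l' u'. stp j l u j' l' u'"
    proof cases
      case 1
      then have "stp j l u j (l \<oplus> \<one>) (pair \<zero> u)" unfolding stp_def by simp
      then show ?thesis by blast
    next
      case 2
      then have "stp j l u j (l \<oplus> \<one>) u" unfolding stp_def by simp
      then show ?thesis by blast
    next
      case 3
      show ?thesis
      proof (cases "pair u j \<in> K")
        case True
        then obtain m i where "q u = pair m i" unfolding K_iff by blast
        then have "stp j l u i \<zero> (g m)" using 3 True unfolding stp_def T_iff by simp
        then show ?thesis by blast
      next
        case False
        then have "stp j l u \<zero> (?e \<oplus> \<one>) \<zero>" using 3 unfolding stp_def by simp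
        then show ?thesis by blast
      qed
    qed
  qed
  have E: "s \<in> E \<longleftrightarrow> (\<exists>t. pair s t \<in> R)" for s
  proof
    assume "s \<in> E"
    then obtain j l u where s: "s = pair j (pair l u)" "l \<preceq> ?e" unfolding E_def by blast
    then obtain j' l' u' where "stp j l u j' l' u'" using stp_dom by blast
    then show "\<exists>t. pair s t \<in> R" unfolding s(1) R by blast
  next
    assume "\<exists>t. pair s t \<in> R"
    then obtain t where t: "pair s t \<in> R" by blast
    then obtain j l u where s: "s = pair j (pair l u)" using R_dom by blast
    then have "l \<preceq> ?e" using t stp_dom unfolding s R by blast
    then show "s \<in> E" unfolding E_def s by blast
  qed
  \<comment> \<open>A step that does not end in a dead end either raises the level within the same
    stage or passes to an earlier stage.\<close>
  have stp_cases: "j' = j \<and> l' = l \<oplus> \<one> \<or> less_in X j' j"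
    if "stp j l u j' l' u'" "l' \<preceq> ?e" for j l u j' l' u'
    using that unfolding stp_def K_iff T_iff by (auto split: if_splits)
  have wf: "\<not> path R f" if f: "f \<in> \<S>" "function_on f UNIV UNIV" for f
  proof
    assume p: "path R f"
    have fE: "\<exists>a. pair n a \<in> f" for n using function_onD(2)[OF f(2)] by blast
    have st: "\<exists>j l u. a = pair j (pair l u) \<and> l \<preceq> ?e" if a: "pair n a \<in> f" for n a
    proof -
      obtain b where "pair (n \<oplus> \<one>) b \<in> f" using fE by blast
      then have "a \<in> E" using p a E unfolding path_def by blast
      then show ?thesis unfolding E_def by blast
    qed
    have step: "\<exists>j' l' u'. pair (n \<oplus> \<one>) (pair j' (pair l' u')) \<in> f \<and> (j' = j \<and> l' = l \<oplus> \<one> \<or> less_in X j' j)"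
      if a: "pair n (pair j (pair l u)) \<in> f" for n j l u
    proof -
      obtain b where b: "pair (n \<oplus> \<one>) b \<in> f" using fE by blast
      then obtain j' l' u' where b': "b = pair j' (pair l' u')" "l' \<preceq> ?e" using st by blast
      have "pair (pair j (pair l u)) b \<in> R" using p a b unfolding path_def by blast
      then have "stp j l u j' l' u'" unfolding R b' by auto
      then show ?thesis using stp_cases b b' by blast
    qed
    \<comment> \<open>Otherwise the stage would remain \<open>j\<close> while the level grows with
      each step. The bound \<open>d + 1\<close> on the level is standard, so ordinary induction on
      \<open>i\<close>, outside the model, gives a contradiction after \<open>d + 2\<close>
      steps.\<close>
    have drop: "\<exists>n' j' y'. pair n' (pair j' y') \<in> f \<and> less_in X j' j" if a: "pair n (pair j y) \<in> f" for n j y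
    proof (rule ccontr)
      assume no: "\<nexists>n' j' y'. pair n' (pair j' y') \<in> f \<and> less_in X j' j"
      have "\<exists>l u. pair (n \<oplus> num i) (pair j (pair l u)) \<in> f \<and> num i \<preceq> l" for i
      proof (induction i)
        case 0
        then show ?case using st[OF a] a by auto
      next
        case (Suc i)
        then obtain l u where lu: "pair (n \<oplus> num i) (pair j (pair l u)) \<in> f" "num i \<preceq> l" by blast
        obtain l' u' where "pair (n \<oplus> num i \<oplus> \<one>) (pair j (pair l' u')) \<in> f" "l' = l \<oplus> \<one>"
          using step[OF lu(1)] no by blast
        then show ?case using lu(2) by (auto simp: plus_assoc)
      qed
      from this[of "Suc (Suc d)"] obtain l u where
        "pair (n \<oplus> num (Suc (Suc d))) (pair j (pair l u)) \<in> f" "num (Suc (Suc d)) \<preceq> l" by blast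
      moreover then have "l \<preceq> ?e" using st by fastforce
      ultimately have "?e \<oplus> \<one> \<preceq> ?e" using N.order_trans by (metis num.simps(2))
      then show False by simp
    qed
    \<comment> \<open>A stage is accompanied by a time at which the path visits it; the visited
      stages themselves need not form a set of the model.\<close>
    define D where "D = {z. \<exists>j w. z = pair j w \<and> (\<exists>n y. w = pair n y \<and> pair n (pair j y) \<in> f)}"
    have DS: "D \<in> \<S>" unfolding D_def by (intro D0_comp D0_ex_pair D0_mem tm_intros f)
    have D: "pair j w \<in> D \<longleftrightarrow> (\<exists>n y. w = pair n y \<and> pair n (pair j y) \<in> f)" for j w unfolding D_def by simp
    define R' where "R' = {z. \<exists>a b. z = pair a b \<and> less_in X b a}"
    have R'S: "R' \<in> \<S>" unfolding R'_def by (intro D0_comp D0_ex_pair D0_less_in X tm_intros)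
    have R': "pair a b \<in> R' \<longleftrightarrow> less_in X b a" for a b unfolding R'_def by simp
    obtain a0 where a0: "pair \<zero> a0 \<in> f" using fE by blast
    then obtain j0 l0 u0 where "a0 = pair j0 (pair l0 u0)" using st by blast
    then have "pair j0 (pair \<zero> (pair l0 u0)) \<in> D" using a0 unfolding D by blast
    have "\<exists>h\<in>\<S>. function_on h UNIV {a. \<exists>y. pair a y \<in> D} \<and> path R' h"
    proof (rule ex_path[OF R'S DS \<open>pair j0 (pair \<zero> (pair l0 u0)) \<in> D\<close>])
      fix j w assume "pair j w \<in> D"
      then obtain n y where "pair n (pair j y) \<in> f" unfolding D by blast
      from drop[OF this] show "\<exists>b y'. pair b y' \<in> D \<and> pair j b \<in> R'" unfolding D R' by blast
    qed
    then obtain h where h: "h \<in> \<S>" "function_on h UNIV {a. \<exists>y. pair a y \<in> D}" "path R' h" by blast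
    \<comment> \<open>Each value of \<open>h\<close> has the next value below it in \<open>X\<close>
      and so lies in the field.\<close>
    have "function_on h UNIV (field X)"
    proof (rule function_onI)
      show "pair i a \<in> h \<Longrightarrow> a \<in> field X" for i a
      proof -
        assume a: "pair i a \<in> h"
        obtain b where "pair (i \<oplus> \<one>) b \<in> h" using function_onD(2)[OF h(2)] by blast
        then have "less_in X b a" using h(3) a unfolding path_def R' by blast
        then show "a \<in> field X" using less_in_field[OF LO] by blast
      qed
    qed (use function_onD(2,3,4)[OF h(2)] in blast)+
    moreover have "\<forall>n a b. pair n a \<in> h \<longrightarrow> pair (n \<oplus> \<one>) b \<in> h \<longrightarrow> less_in X b a"
      using h(3) unfolding path_def R' by blast
    ultimately show False using X(2) h(1) unfolding WO_def by blast
  qed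
  obtain v where vS: "v \<in> \<S>" and v: "\<And>s. s \<in> v \<longleftrightarrow> (\<exists>t. pair s t \<in> R \<and> t \<notin> v)"
    using K[unfolded kernels_exist_def, rule_format, OF RS ES E wf] by metis
  define Y where "Y = {z. \<exists>n j. z = pair n j \<and> (j \<in> field X \<and> z \<in> {z. pair (rgt z) (pair \<zero> (g (lft z))) \<in> v})}"
  have YS: "Y \<in> \<S>"
    unfolding Y_def
    by (intro D0_comp D0_ex_pair D0_conj D0_mem tm_intros field_in_sets X
        cf_set cf_pair cf_rgt cf_lft cf_id cf_const cf_comp[OF g] vS)
  have Y: "pair n j \<in> Y \<longleftrightarrow> j \<in> field X \<and> pair j (pair \<zero> (g n)) \<in> v" for n j
    unfolding Y_def by simp
  \<comment> \<open>Such a vertex has exactly one successor, so it expresses the negation of the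
    query. If the query does not concern an earlier stage, that successor is a dead end, which is
    outside the kernel, and the query counts as false.\<close>
  have query: "pair j (pair l u) \<in> v \<longleftrightarrow> \<not> (u \<in> A \<and> q u \<in> below X Y j)"
    if l: "l = num d \<and> u \<in> C \<or> l = ?e" for j l u
  proof (cases "pair u j \<in> K")
    case True
    then obtain m i where mi: "u \<in> A" "q u = pair m i" "less_in X i j" unfolding K_iff by blast
    have "stp j l u j' l' u' \<longleftrightarrow> j' = i \<and> l' = \<zero> \<and> u' = g m" for j' l' u'
      using l True mi(2) unfolding stp_def T_iff by auto
    then have "pair j (pair l u) \<in> v \<longleftrightarrow> pair i (pair \<zero> (g m)) \<notin> v"
      by (subst v) (auto simp: R)
    moreover have "pair m i \<in> below X Y j \<longleftrightarrow> pair i (pair \<zero> (g m)) \<in> v"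
      unfolding below_def using mi(3) less_in_field[OF LO mi(3)] Y by simp
    ultimately show ?thesis using mi by simp
  next
    case False
    have "stp j l u j' l' u' \<longleftrightarrow> j' = \<zero> \<and> l' = ?e \<oplus> \<one> \<and> u' = \<zero>" for j' l' u'
      using l False unfolding stp_def by auto
    then have "pair j (pair l u) \<in> v \<longleftrightarrow> pair \<zero> (pair (?e \<oplus> \<one>) \<zero>) \<notin> v"
      by (subst v) (auto simp: R)
    moreover have "\<not> ?e \<oplus> \<one> \<preceq> ?e" by simp
    then have "pair \<zero> (pair (?e \<oplus> \<one>) \<zero>) \<notin> v"
      using stp_dom[of \<zero> "?e \<oplus> \<one>" \<zero>] by (subst v) (auto simp: R simp del: succ_le)
    ultimately show ?thesis using False unfolding K_iff below_def by auto
  qed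
  \<comment> \<open>The induction is on the number \<open>i\<close> of quantifiers that remain. At
    \<open>i = 0\<close> an element of \<open>C\<close> makes the negated query at level
    \<open>d\<close> itself, while other elements reach level \<open>d + 1\<close> first and thus
    negate twice.\<close>
  have level: "pair j (pair (num (d - i)) u) \<in> v \<longleftrightarrow> nex i L u (below X Y j)" if "i \<le> d" for i j u
    using that
  proof (induction i arbitrary: u)
    case 0
    show ?case
    proof (cases "u \<in> C")
      case True
      then show ?thesis using query[of "num d" u j] unfolding L_eq lit_def by simp
    next
      case False
      have "stp j (num d) u j' l' u' \<longleftrightarrow> j' = j \<and> l' = ?e \<and> u' = u" for j' l' u'
        using False unfolding stp_def by auto
      then have "pair j (pair (num d) u) \<in> v \<longleftrightarrow> pair j (pair (?e) u) \<notin> v"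
        by (subst v) (auto simp: R)
      then show ?thesis using query[of "?e" u j] False unfolding L_eq lit_def by simp
    qed
  next
    case (Suc i)
    then have di: "d - i = Suc (d - Suc i)" by simp
    have less: "num (d - Suc i) \<prec> num d"
    proof -
      have "num a \<preceq> num b" if "a \<le> b" for a b
        using that by (induction rule: dec_induct) (auto intro: N.order_trans)
      from this[of "Suc (d - Suc i)" d] Suc.prems show ?thesis by simp
    qed
    then have "num (d - Suc i) \<noteq> num d" "num (d - Suc i) \<noteq> ?e"
      using irrefl N.less_imp_le less_succ by metis+
    with less have "stp j (num (d - Suc i)) u j' l' u' \<longleftrightarrow> j' = j \<and> l' = num (d - i) \<and> (\<exists>c. u' = pair c u)" for j' l' u'
      unfolding stp_def di by simp
    then have "pair j (pair (num (d - Suc i)) u) \<in> v \<longleftrightarrow> (\<exists>c. pair j (pair (num (d - i)) (pair c u)) \<notin> v)"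
      by (subst v) (auto simp: R)
    then show ?case using Suc by simp
  qed
  have "Y = {z. \<exists>n j. z = pair n j \<and> j \<in> field X \<and> nex d L (g n) (below X Y j)}"
    (is "Y = ?Y")
  proof (rule set_eqI)
    fix z
    have "z \<in> Y \<longleftrightarrow> (\<exists>n j. z = pair n j \<and> pair n j \<in> Y)" unfolding Y_def by auto
    then show "z \<in> Y \<longleftrightarrow> z \<in> ?Y" unfolding Y using level[of d] by simp
  qed
  then show ?thesis using YS by blast
qed

lemma ATR_from_kernels:
  assumes K: kernels_exist
  shows ATR0
  unfolding ATR0_def ACA0_def
proof (intro conjI)
  show basic_axioms by (rule basic)
  show set_induction
    unfolding set_induction_def
  proof (intro ballI impI allI)
    fix X n assume "X \<in> \<S>" "\<zero> \<in> X" "\<forall>n. n \<in> X \<longrightarrow> n \<oplus> \<one> \<in> X"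
    then show "n \<in> X" using D0_induct[of "\<lambda>n. n \<in> X" n] D0_mem[OF tm_var] by blast
  qed
  show arithmetical_comprehension
    unfolding arithmetical_comprehension_def
  proof (intro allI impI)
    fix \<phi> :: fm and x e and s :: "nat \<Rightarrow> 'a set" assume \<phi>: "arithmetical \<phi>" and s: "range s \<subseteq> \<S>"
    obtain d L g where L: "literal L" "cf g" "\<And>n Z. sat (e(x := n)) s \<phi> = nex d L (g n) Z"
    proof (rule sat_normal_form[OF \<phi>, of "\<lambda>Z. s"])
      show "(\<forall>Z. s X = Z) \<or> (\<exists>A\<in>\<S>. \<forall>Z. s X = A)" for X using s by auto
    qed (rule that)
    define X where "X = {z. z = pair \<zero> \<zero>}"
    have XS: "X \<in> \<S>" unfolding X_def by (intro D0_comp D0_eq tm_intros)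
    have fX: "field X = {\<zero>}" unfolding field_def X_def by auto
    have nl: "\<not> less_in X i j" for i j unfolding less_in_def X_def by auto
    have "LO X" unfolding LO_def fX unfolding X_def by auto
    moreover have "\<not> (\<forall>n a b. pair n a \<in> f \<longrightarrow> pair (n \<oplus> \<one>) b \<in> f \<longrightarrow> less_in X b a)"
      if "function_on f UNIV (field X)" for f
      using function_onD(2)[OF that] nl by meson
    ultimately have "WO X" unfolding WO_def by blast
    from iterates_exist[OF K L(1,2) XS this] obtain Y where
      Y: "Y \<in> \<S>" "Y = {z. \<exists>n j. z = pair n j \<and> j \<in> field X \<and> nex d L (g n) (below X Y j)}" by blast
    have "pair n \<zero> \<in> Y \<longleftrightarrow> sat (e(x := n)) s \<phi>" for n
      by (subst Y(2)) (simp add: fX L(3)[symmetric])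
    moreover have "{n. pair n \<zero> \<in> Y} \<in> \<S>" by (intro D0_comp D0_mem tm_intros Y)
    ultimately show "\<exists>X\<in>\<S>. \<forall>n. n \<in> X \<longleftrightarrow> sat (e(x := n)) s \<phi>"
      by (intro bexI[of _ "{n. pair n \<zero> \<in> Y}"]) (simp_all only: mem_Collect_eq simp_thms)
  qed
  show arithmetical_transfinite_recursion
    unfolding arithmetical_transfinite_recursion_def
  proof (intro allI impI ballI)
    fix \<theta> :: fm and x V e and s :: "nat \<Rightarrow> 'a set" and X
    assume \<theta>: "arithmetical \<theta>" and s: "range s \<subseteq> \<S>" and X: "X \<in> \<S>" "WO X"
    obtain d L g where L: "literal L" "cf g" "\<And>n Z. sat (e(x := n)) (s(V := Z)) \<theta> = nex d L (g n) Z"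
    proof (rule sat_normal_form[OF \<theta>, of "\<lambda>Z. s(V := Z)"])
      show "(\<forall>Z. (s(V := Z)) X = Z) \<or> (\<exists>A\<in>\<S>. \<forall>Z. (s(V := Z)) X = A)" for X using s by auto
    qed (rule that)
    have "LO X" using X(2) unfolding WO_def by blast
    moreover obtain Y where Y: "Y \<in> \<S>"
      "Y = {z. \<exists>n j. z = pair n j \<and> j \<in> field X \<and> nex d L (g n) (below X Y j)}"
      using iterates_exist[OF K L(1,2) X] by blast
    ultimately have "iterates (\<lambda>n Z. sat (e(x := n)) (s(V := Z)) \<theta>) X Y"
      unfolding iterates_def L(3) by (intro conjI)
    then show "\<exists>Y\<in>\<S>. iterates (\<lambda>n Z. sat (e(x := n)) (s(V := Z)) \<theta>) X Y"
      using Y(1) by (rule bexI)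
  qed
qed

section \<open>The Kleene-Brouwer order\<close>


text \<open>Sequences are compared lexicographically, an undefined entry being larger than all numbers.\<close>

definition kb :: "'a \<Rightarrow> 'a \<Rightarrow> bool" where
  "kb \<sigma> \<tau> \<longleftrightarrow> (\<exists>l. l \<prec> \<sigma> \<and> (\<exists>a. a \<prec> \<sigma> \<and>
     (\<forall>i. i \<prec> l \<longrightarrow> (\<forall>b. b \<prec> \<sigma> \<oplus> \<tau> \<longrightarrow> (pair i b \<in> elems \<sigma> \<longleftrightarrow> pair i b \<in> elems \<tau>))) \<and>
     pair l a \<in> elems \<sigma> \<and> (\<forall>b. b \<prec> \<tau> \<longrightarrow> pair l b \<in> elems \<tau> \<longrightarrow> a \<prec> b)))"

lemma D0_kb: "tm t \<Longrightarrow> tm u \<Longrightarrow> D0 (\<lambda>e. kb (t e) (u e))"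
proof (rule D0_subst2[of kb])
  show "D0 (\<lambda>e. kb (e 0) (e 1))"
    unfolding kb_def by (intro D0_intros tm_intros D0_elems)
qed

lemma pair_in_elems_less: "pair i b \<in> elems \<sigma> \<or> pair i b \<in> elems \<tau> \<Longrightarrow> b \<prec> \<sigma> \<oplus> \<tau>"
  using pair_in_elems N.less_le_trans le_plus by blast

lemma kb_iff: "kb \<sigma> \<tau> \<longleftrightarrow> (\<exists>l a. (\<forall>i b. i \<prec> l \<longrightarrow> (pair i b \<in> elems \<sigma> \<longleftrightarrow> pair i b \<in> elems \<tau>)) \<and>
     pair l a \<in> elems \<sigma> \<and> (\<forall>b. pair l b \<in> elems \<tau> \<longrightarrow> a \<prec> b))"
proof -
  have 2: "(\<forall>i. i \<prec> l \<longrightarrow> (\<forall>b. b \<prec> \<sigma> \<oplus> \<tau> \<longrightarrow> (pair i b \<in> elems \<sigma> \<longleftrightarrow> pair i b \<in> elems \<tau>))) \<longleftrightarrow>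
      (\<forall>i b. i \<prec> l \<longrightarrow> (pair i b \<in> elems \<sigma> \<longleftrightarrow> pair i b \<in> elems \<tau>))" for l
    using pair_in_elems_less by metis
  have 3: "(\<forall>b. b \<prec> \<tau> \<longrightarrow> pair l b \<in> elems \<tau> \<longrightarrow> a \<prec> b) \<longleftrightarrow> (\<forall>b. pair l b \<in> elems \<tau> \<longrightarrow> a \<prec> b)" for l a
    using pair_in_elems by blast
  show ?thesis unfolding kb_def 2 3 using pair_in_elems by meson
qed

lemma kb_irrefl: "\<not> kb \<sigma> \<sigma>"
  unfolding kb_iff using irrefl by blast

text \<open>The smaller of the two positions \<open>l\<close> and \<open>m\<close> decides the
  comparison of \<sigma> and \<upsilon>.\<close>

lemma kb_trans:
  assumes "kb \<sigma> \<tau>" "kb \<tau> \<upsilon>"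
  shows "kb \<sigma> \<upsilon>"
proof -
  obtain l a where A: "\<And>i b. i \<prec> l \<Longrightarrow> pair i b \<in> elems \<sigma> \<longleftrightarrow> pair i b \<in> elems \<tau>"
    "pair l a \<in> elems \<sigma>" "\<And>b. pair l b \<in> elems \<tau> \<Longrightarrow> a \<prec> b"
    using assms(1) unfolding kb_iff by blast
  obtain m c where B: "\<And>i b. i \<prec> m \<Longrightarrow> pair i b \<in> elems \<tau> \<longleftrightarrow> pair i b \<in> elems \<upsilon>"
    "pair m c \<in> elems \<tau>" "\<And>b. pair m b \<in> elems \<upsilon> \<Longrightarrow> c \<prec> b"
    using assms(2) unfolding kb_iff by blast
  have agree: "pair i b \<in> elems \<sigma> \<longleftrightarrow> pair i b \<in> elems \<upsilon>" if "i \<prec> l" "i \<prec> m" for i b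
    using A(1)[OF that(1)] B(1)[OF that(2)] by simp
  consider "l \<prec> m" | "l = m" | "m \<prec> l" using linear by blast
  then show ?thesis
  proof cases
    case 1
    then have "i \<prec> l \<Longrightarrow> i \<prec> m" for i by (rule trans[rotated])
    moreover have "pair l b \<in> elems \<upsilon> \<Longrightarrow> a \<prec> b" for b using A(3) B(1)[OF 1] by simp
    ultimately show ?thesis unfolding kb_iff using A(2) agree by (intro exI[of _ l] exI[of _ a]) simp
  next
    case 2
    have "pair l b \<in> elems \<upsilon> \<Longrightarrow> a \<prec> b" for b
      using trans[OF A(3) B(3)] B(2) unfolding 2 by blast
    then show ?thesis unfolding kb_iff using A(2) agree 2 by (intro exI[of _ l] exI[of _ a]) simp
  next
    case 3
    then have "i \<prec> m \<Longrightarrow> i \<prec> l" for i by (rule trans[rotated])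
    moreover have "pair m c \<in> elems \<sigma>" using A(1)[OF 3] B(2) by simp
    ultimately show ?thesis unfolding kb_iff using B(3) agree by (intro exI[of _ m] exI[of _ c]) simp
  qed
qed

text \<open>The least position \<open>m\<close> at which the graphs differ exists since differing is
  a bounded property. One of the sequences has an entry there that the other lacks, and this entry
  is smaller than that of the other unless the other has a smaller one.\<close>

lemma kb_total:
  assumes "seq \<sigma> l" "seq \<tau> l'"
  shows "\<sigma> = \<tau> \<or> kb \<sigma> \<tau> \<or> kb \<tau> \<sigma>"
proof (cases "\<forall>i b. pair i b \<in> elems \<sigma> \<longleftrightarrow> pair i b \<in> elems \<tau>")
  case True
  have "z \<in> elems \<sigma> \<longleftrightarrow> z \<in> elems \<tau>" for z
    using seq_pair[OF assms(1), of z] seq_pair[OF assms(2), of z] True by metis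
  then have "elems \<sigma> = elems \<tau>" by blast
  then show ?thesis using seq_eqI[OF assms] by blast
next
  case False
  define P where "P i \<longleftrightarrow> (\<exists>b. b \<prec> \<sigma> \<oplus> \<tau> \<and> \<not> (pair i b \<in> elems \<sigma> \<longleftrightarrow> pair i b \<in> elems \<tau>))" for i
  have P: "P i \<longleftrightarrow> (\<exists>b. \<not> (pair i b \<in> elems \<sigma> \<longleftrightarrow> pair i b \<in> elems \<tau>))" for i
    unfolding P_def using pair_in_elems_less by metis
  have "D0 (\<lambda>e. P (e 0))" unfolding P_def by (intro D0_intros tm_intros D0_elems)
  moreover obtain i where "P i" using False unfolding P by blast
  ultimately obtain m where m: "P m" "\<And>i. i \<prec> m \<Longrightarrow> \<not> P i" by (rule least_number) blast
  then have agree: "\<And>i b. i \<prec> m \<Longrightarrow> pair i b \<in> elems \<sigma> \<longleftrightarrow> pair i b \<in> elems \<tau>" unfolding P by blast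
  obtain b where b: "pair m b \<in> elems \<sigma> \<and> pair m b \<notin> elems \<tau> \<or> pair m b \<in> elems \<tau> \<and> pair m b \<notin> elems \<sigma>"
    using m(1) unfolding P by blast
  have *: "kb \<alpha> \<beta> \<or> kb \<beta> \<alpha>"
    if ab: "seq \<alpha> j" "seq \<beta> j'" and ag: "\<And>i b. i \<prec> m \<Longrightarrow> pair i b \<in> elems \<alpha> \<longleftrightarrow> pair i b \<in> elems \<beta>"
      and c: "pair m b \<in> elems \<alpha>" "pair m b \<notin> elems \<beta>" for \<alpha> \<beta> j j'
  proof (cases "\<exists>c. pair m c \<in> elems \<beta> \<and> c \<prec> b")
    case True
    then obtain c where "pair m c \<in> elems \<beta>" "c \<prec> b" by blast
    moreover have "b' = b" if "pair m b' \<in> elems \<alpha>" for b' using seq_fun[OF ab(1) that c(1)] .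
    ultimately have "kb \<beta> \<alpha>" unfolding kb_iff using ag by (intro exI[of _ m] exI[of _ c]) blast
    then show ?thesis ..
  next
    case False
    then have "b \<prec> c" if "pair m c \<in> elems \<beta>" for c using that c(2) linear by metis
    then have "kb \<alpha> \<beta>" unfolding kb_iff using ag c(1) by (intro exI[of _ m] exI[of _ b]) blast
    then show ?thesis ..
  qed
  from b show ?thesis
  proof
    assume "pair m b \<in> elems \<sigma> \<and> pair m b \<notin> elems \<tau>"
    then show ?thesis using *[OF assms agree] by blast
  next
    assume "pair m b \<in> elems \<tau> \<and> pair m b \<notin> elems \<sigma>"
    then show ?thesis using *[OF assms(2,1)] agree by blast
  qed
qed

text \<open>At position \<open>l\<close> the longer sequence has an entry and the shorter one has
  none, which counts as larger. So children precede their parent.\<close>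

lemma kb_append: "seq \<sigma> l \<Longrightarrow> append_entry \<sigma> n \<tau> \<Longrightarrow> kb \<tau> \<sigma>"
proof -
  assume l: "seq \<sigma> l" and "append_entry \<sigma> n \<tau>"
  then have \<tau>: "seq \<tau> (l \<oplus> \<one>)" "elems \<tau> = insert (pair l n) (elems \<sigma>)" using append_entry_iff by blast+
  have "pair l b \<notin> elems \<sigma>" for b using seq_dom[OF l] irrefl by blast
  then show "kb \<tau> \<sigma>" unfolding kb_iff \<tau>(2) using irrefl by (intro exI[of _ l] exI[of _ n]) auto
qed

definition kb_order :: "'a set \<Rightarrow> 'a set" where
  "kb_order B = {z. \<exists>\<sigma> \<tau>. z = pair \<sigma> \<tau> \<and> (\<sigma> \<in> B \<and> \<tau> \<in> B \<and> (\<sigma> = \<tau> \<or> kb \<sigma> \<tau>))}"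

lemma kb_order_iff: "pair \<sigma> \<tau> \<in> kb_order B \<longleftrightarrow> \<sigma> \<in> B \<and> \<tau> \<in> B \<and> (\<sigma> = \<tau> \<or> kb \<sigma> \<tau>)"
  unfolding kb_order_def by simp

lemma kb_order_in_sets: "B \<in> \<S> \<Longrightarrow> kb_order B \<in> \<S>"
  unfolding kb_order_def by (intro D0_comp D0_ex_pair D0_intros tm_intros D0_kb)

lemma field_kb_order: "field (kb_order B) = B"
  unfolding field_def kb_order_iff by simp

lemma less_in_kb_order: "less_in (kb_order B) \<sigma> \<tau> \<longleftrightarrow> \<sigma> \<in> B \<and> \<tau> \<in> B \<and> kb \<sigma> \<tau>"
  unfolding less_in_def kb_order_iff using kb_irrefl kb_trans by blast

lemma LO_kb_order: "tree B \<Longrightarrow> LO (kb_order B)"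
proof -
  assume "tree B"
  then have seq: "\<sigma> \<in> B \<Longrightarrow> \<exists>l. seq \<sigma> l" for \<sigma> unfolding tree_def by blast
  show ?thesis
    unfolding LO_def field_kb_order
  proof (intro conjI ballI allI impI)
    show "z \<in> kb_order B \<Longrightarrow> \<exists>i\<in>B. \<exists>j\<in>B. z = pair i j" for z unfolding kb_order_def by blast
    show "pair i j \<in> kb_order B \<Longrightarrow> pair j k \<in> kb_order B \<Longrightarrow> pair i k \<in> kb_order B" for i j k
      unfolding kb_order_iff using kb_trans by blast
    show "pair i j \<in> kb_order B \<Longrightarrow> pair j i \<in> kb_order B \<Longrightarrow> i = j" for i j
      unfolding kb_order_iff using kb_trans kb_irrefl by blast
    show "i \<in> B \<Longrightarrow> j \<in> B \<Longrightarrow> pair i j \<in> kb_order B \<or> pair j i \<in> kb_order B" for i j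
      unfolding kb_order_iff using kb_total seq by blast
  qed
qed

section \<open>Kleene-Brouwer orders of well-founded trees under arithmetical comprehension\<close>

context
  assumes ACA: arithmetical_comprehension
begin

lemma Sigma_comp:
  assumes "D0 (\<lambda>e. P (e 0) (e 1))"
  shows "{n. \<exists>a. P a n} \<in> \<S>"
proof -
  obtain \<phi> \<psi> s E where \<phi>: "bounded_fm \<phi>" "bounded_fm \<psi>" "range s \<subseteq> \<S>"
    "\<And>a n. sat (E(2 := n, 0 := a)) s \<phi> = P a n" "\<And>a n. sat (E(2 := n, 0 := a)) s \<psi> = P a n"
    by (rule Sigma01_instance[OF assms assms]) (rule that)
  have "arithmetical \<phi>" using \<phi>(1) by induction simp_all
  then have "arithmetical (ExN 0 \<phi>)" by simp
  moreover have "arithmetical (ExN 0 \<phi>) \<longrightarrow> range s \<subseteq> \<S> \<longrightarrow>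
      (\<exists>X\<in>\<S>. \<forall>n. n \<in> X \<longleftrightarrow> sat (E(2 := n)) s (ExN 0 \<phi>))"
    by (rule ACA[unfolded arithmetical_comprehension_def, THEN spec, THEN spec, THEN spec, THEN spec])
  moreover have "sat (E(2 := n)) s (ExN 0 \<phi>) \<longleftrightarrow> (\<exists>a. P a n)" for n using \<phi>(4) by simp
  ultimately obtain X where "X \<in> \<S>" "\<forall>n. n \<in> X \<longleftrightarrow> (\<exists>a. P a n)" using \<phi>(3) by (auto simp del: sat.simps)
  moreover then have "X = {n. \<exists>a. P a n}" by auto
  ultimately show ?thesis by simp
qed

lemma Pi_comp:
  assumes "D0 (\<lambda>e. P (e 0) (e 1))"
  shows "{n. \<forall>a. P a n} \<in> \<S>"
proof -
  have "{n. \<exists>a. \<not> P a n} \<in> \<S>" by (rule Sigma_comp) (rule D0_neg[OF assms])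
  from Compl_in_sets[OF this] show ?thesis by (simp add: Compl_eq)
qed

text \<open>The eventual values of the entries of a descending sequence form an infinite path.\<close>

lemma WO_kb_order:
  assumes B: "B \<in> \<S>" "wf_tree B" and root: "\<rho> \<in> B" "seq \<rho> \<zero>"
  shows "WO (kb_order B)"
proof -
  have tB: "tree B" using B(2) unfolding wf_tree_def by blast
  have seqB: "\<exists>l. seq \<sigma> l" if "\<sigma> \<in> B" for \<sigma> using tB that unfolding tree_def by blast
  have closed: "\<sigma> \<in> B" if "\<tau> \<in> B" "seq \<sigma> l" "elems \<sigma> \<subseteq> elems \<tau>" for \<sigma> \<tau> l
    using tB that unfolding tree_def by blast
  have False
    if f: "f \<in> \<S>" "function_on f UNIV B"
      and desc: "\<And>n \<sigma> \<tau>. pair n \<sigma> \<in> f \<Longrightarrow> pair (n \<oplus> \<one>) \<tau> \<in> f \<Longrightarrow> kb \<tau> \<sigma>" for f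
  proof -
    have fE: "\<exists>\<tau>\<in>B. pair n \<tau> \<in> f" for n by (rule function_onD(2)[OF f(2)])
    \<comment> \<open>A pair of \<sigma> and \<open>n\<close> belongs to \<open>S0\<close> iff all
      members of the sequence from \<open>n\<close> on extend \<sigma>. The index \<open>m\<close>
      and the member \<tau> are packed into one number \<open>w\<close> because
      \<open>Pi_comp\<close> admits a single unbounded quantifier.\<close>
    define S0 where "S0 = {p. \<forall>w. \<exists>\<sigma> n. p = pair \<sigma> n \<and> ((\<exists>m \<tau>. w = pair m \<tau> \<and> (n \<preceq> m \<and> w \<in> f \<and>
        \<not> (\<forall>z. z \<prec> \<sigma> \<longrightarrow> z \<in> elems \<sigma> \<longrightarrow> z \<in> elems \<tau>))) \<longrightarrow> False)}"
    have S0S: "S0 \<in> \<S>"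
      unfolding S0_def by (intro Pi_comp D0_ex_pair D0_intros tm_intros D0_le D0_elems f)
    have S0: "pair \<sigma> n \<in> S0 \<longleftrightarrow> (\<forall>m \<tau>. n \<preceq> m \<longrightarrow> pair m \<tau> \<in> f \<longrightarrow> elems \<sigma> \<subseteq> elems \<tau>)" for \<sigma> n
    proof -
      have *: "(\<forall>z. z \<prec> \<sigma> \<longrightarrow> z \<in> elems \<sigma> \<longrightarrow> z \<in> elems \<tau>) \<longleftrightarrow> elems \<sigma> \<subseteq> elems \<tau>" for \<sigma> \<tau>
        using elems_less by blast
      have "pair \<sigma> n \<in> S0 \<longleftrightarrow> (\<forall>w. \<not> (\<exists>m \<tau>. w = pair m \<tau> \<and> (n \<preceq> m \<and> w \<in> f \<and> \<not> elems \<sigma> \<subseteq> elems \<tau>)))"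
        unfolding S0_def * by simp
      also have "\<dots> \<longleftrightarrow> (\<forall>m \<tau>. n \<preceq> m \<longrightarrow> pair m \<tau> \<in> f \<longrightarrow> elems \<sigma> \<subseteq> elems \<tau>)"
        by metis
      finally show ?thesis .
    qed
    define S1 where "S1 = {\<sigma>. \<exists>n. \<sigma> \<in> B \<and> pair \<sigma> n \<in> S0}"
    have S1S: "S1 \<in> \<S>" unfolding S1_def by (intro Sigma_comp D0_intros tm_intros B S0S)
    have compat: "\<exists>\<tau>\<in>B. elems \<sigma> \<subseteq> elems \<tau> \<and> elems \<sigma>' \<subseteq> elems \<tau>" if s: "\<sigma> \<in> S1" "\<sigma>' \<in> S1" for \<sigma> \<sigma>'
    proof -
      obtain n n' where n: "pair \<sigma> n \<in> S0" "pair \<sigma>' n' \<in> S0" using s unfolding S1_def by blast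
      obtain \<tau> where "\<tau> \<in> B" "pair (n \<oplus> n') \<tau> \<in> f" using fE by blast
      then show ?thesis using n unfolding S0 using le_plus by blast
    qed
    \<comment> \<open>Below the length of \<sigma> both sequences have the entries of \<sigma>, so
      the position that decides their comparison is not among these.\<close>
    have late: "l \<preceq> l'"
      if *: "seq \<sigma> l" "elems \<sigma> \<subseteq> elems \<tau>" "elems \<sigma> \<subseteq> elems \<tau>'" "\<tau>' \<in> B" "pair l' a' \<in> elems \<tau>'"
        "\<And>b. pair l' b \<in> elems \<tau> \<Longrightarrow> a' \<prec> b" for \<sigma> l \<tau> \<tau>' l' a'
    proof (rule ccontr)
      assume "\<not> l \<preceq> l'"
      then have "l' \<prec> l" using N.not_le by blast
      then obtain b where "pair l' b \<in> elems \<sigma>" using seq_total[OF *(1)] by blast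
      then have "a' \<prec> b" "b = a'" using * seqB seq_fun by blast+
      then show False using irrefl by blast
    qed
    have S1_step: "\<exists>\<sigma>'. \<sigma>' \<in> S1 \<and> seq \<sigma>' (l \<oplus> \<one>)" if \<sigma>: "\<sigma> \<in> S1" "seq \<sigma> l" for \<sigma> l
    proof -
      obtain n where n: "\<And>m \<tau>. n \<preceq> m \<Longrightarrow> pair m \<tau> \<in> f \<Longrightarrow> elems \<sigma> \<subseteq> elems \<tau>"
        using \<sigma>(1) unfolding S1_def S0 by blast
      define V where "V = {a. \<exists>w. \<exists>m \<tau>. w = pair m \<tau> \<and> (n \<preceq> m \<and> w \<in> f \<and> pair l a \<in> elems \<tau>)}"
      have VS: "V \<in> \<S>" unfolding V_def by (intro Sigma_comp D0_ex_pair D0_intros tm_intros D0_le D0_elems f)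
      have V: "a \<in> V \<longleftrightarrow> (\<exists>m \<tau>. n \<preceq> m \<and> pair m \<tau> \<in> f \<and> pair l a \<in> elems \<tau>)" for a
        unfolding V_def by auto
      \<comment> \<open>Of two consecutive members the later one has an entry at the position where
        they first differ, which is at least \<open>l\<close>; hence it has an entry at
        \<open>l\<close>.\<close>
      have "\<exists>a. a \<in> V"
      proof -
        obtain \<tau> where \<tau>: "\<tau> \<in> B" "pair n \<tau> \<in> f" using fE by blast
        obtain \<tau>' where \<tau>': "\<tau>' \<in> B" "pair (n \<oplus> \<one>) \<tau>' \<in> f" using fE by blast
        obtain l' a' where k: "pair l' a' \<in> elems \<tau>'" "\<And>b. pair l' b \<in> elems \<tau> \<Longrightarrow> a' \<prec> b"
          using desc[OF \<tau>(2) \<tau>'(2)] unfolding kb_iff by blast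
        have sub: "elems \<sigma> \<subseteq> elems \<tau>" "elems \<sigma> \<subseteq> elems \<tau>'" using n[of n \<tau>] n[of "n \<oplus> \<one>" \<tau>'] \<tau> \<tau>' by simp_all
        have "l \<preceq> l'" by (rule late[OF \<sigma>(2) sub \<tau>'(1) k])
        obtain j where "seq \<tau>' j" using seqB[OF \<tau>'(1)] by blast
        moreover then have "l \<prec> j" using seq_dom[OF _ k(1)] \<open>l \<preceq> l'\<close> N.le_less_trans by blast
        ultimately obtain a where "pair l a \<in> elems \<tau>'" using seq_total by blast
        then show ?thesis unfolding V using \<tau>'(2) le_plus by blast
      qed
      then obtain a0 where "a0 \<in> V" by blast
      moreover have "D0 (\<lambda>e. e 0 \<in> V)" by (intro D0_mem tm_intros VS)
      ultimately obtain a where a: "a \<in> V" "\<And>b. b \<prec> a \<Longrightarrow> b \<notin> V"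
        using least_number[of "\<lambda>a. a \<in> V"] by blast
      obtain m \<tau> where m: "n \<preceq> m" "pair m \<tau> \<in> f" "pair l a \<in> elems \<tau>" using a(1) unfolding V by blast
      \<comment> \<open>The least entry \<open>a\<close> that ever occurs at position
        \<open>l\<close> after \<open>n\<close> is the eventual one: a later change at
        \<open>l\<close> would produce a smaller element of \<open>V\<close>, and a change below
        \<open>l\<close> is excluded by \<open>late\<close>.\<close>
      define Q where "Q = {i. \<exists>\<tau>. pair (m \<oplus> i) \<tau> \<in> f \<and> pair l a \<in> elems \<tau>}"
      have QS: "Q \<in> \<S>" unfolding Q_def by (intro Sigma_comp D0_intros tm_intros D0_elems f)
      have "i \<in> Q" for i
      proof (rule D0_induct[of "\<lambda>i. i \<in> Q"])
        show "D0 (\<lambda>e. e 0 \<in> Q)" by (intro D0_mem tm_intros QS)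
        show "\<zero> \<in> Q" unfolding Q_def using m by auto
        fix i assume "i \<in> Q"
        then obtain \<tau> where \<tau>: "pair (m \<oplus> i) \<tau> \<in> f" "pair l a \<in> elems \<tau>" unfolding Q_def by blast
        obtain \<tau>' where \<tau>': "\<tau>' \<in> B" "pair (m \<oplus> i \<oplus> \<one>) \<tau>' \<in> f" using fE by blast
        obtain l' a' where k: "\<And>i b. i \<prec> l' \<Longrightarrow> pair i b \<in> elems \<tau>' \<longleftrightarrow> pair i b \<in> elems \<tau>"
          "pair l' a' \<in> elems \<tau>'" "\<And>b. pair l' b \<in> elems \<tau> \<Longrightarrow> a' \<prec> b"
          using desc[OF \<tau>(1) \<tau>'(2)] unfolding kb_iff by blast
        have nm: "n \<preceq> m \<oplus> i" using m(1) N.order_trans le_plus(1) by blast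
        then have nm': "n \<preceq> m \<oplus> i \<oplus> \<one>" using N.order_trans le_plus(1) by blast
        have "l \<preceq> l'" by (rule late[OF \<sigma>(2) n[OF nm \<tau>(1)] n[OF nm' \<tau>'(2)] \<tau>'(1) k(2,3)])
        moreover have "l' \<noteq> l"
        proof
          assume "l' = l"
          then have "a' \<in> V" unfolding V using nm' \<tau>'(2) k(2) by blast
          then show False using a(2) k(3) \<tau>(2) \<open>l' = l\<close> by blast
        qed
        ultimately have "l \<prec> l'" unfolding le_def by blast
        then have "pair l a \<in> elems \<tau>'" using k(1) \<tau>(2) by blast
        then show "i \<oplus> \<one> \<in> Q" unfolding Q_def using \<tau>'(2) by (auto simp: plus_assoc)
      qed
      then have ev: "pair l a \<in> elems \<tau>" if "m \<preceq> j" "pair j \<tau> \<in> f" for j \<tau>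
      proof -
        obtain i where "j = m \<oplus> i" using \<open>m \<preceq> j\<close> le_iff by blast
        then show ?thesis using \<open>\<And>i. i \<in> Q\<close> that(2) function_onD(3)[OF f(2)] unfolding Q_def by blast
      qed
      obtain \<sigma>' where \<sigma>': "seq \<sigma>' (l \<oplus> \<one>)" "elems \<sigma>' = insert (pair l a) (elems \<sigma>)" by (rule ex_append[OF \<sigma>(2)])
      have sub: "elems \<sigma>' \<subseteq> elems \<tau>" if "m \<preceq> j" "pair j \<tau> \<in> f" for j \<tau>
        using ev[OF that] n[of j \<tau>] that m(1) N.order_trans unfolding \<sigma>'(2) by blast
      have "\<tau> \<in> B" using m(2) function_onD(1)[OF f(2)] by blast
      then have "\<sigma>' \<in> B" using closed[OF _ \<sigma>'(1)] sub[OF N.order_refl m(2)] by blast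
      then have "\<sigma>' \<in> S1" unfolding S1_def S0 using sub by blast
      then show ?thesis using \<sigma>'(1) by blast
    qed
    have S1_ex: "\<exists>\<sigma>. \<sigma> \<in> S1 \<and> seq \<sigma> l" for l
    proof (rule Sigma_induct[of "\<lambda>\<sigma> l. \<sigma> \<in> S1 \<and> seq \<sigma> l"])
      show "D0 (\<lambda>e. e 0 \<in> S1 \<and> seq (e 0) (e 1))" by (intro D0_intros tm_intros S1S D0_seq)
      have "pair \<rho> \<zero> \<in> S0" unfolding S0 seq_zero[OF root(2)] by blast
      then show "\<exists>\<sigma>. \<sigma> \<in> S1 \<and> seq \<sigma> \<zero>" unfolding S1_def using root by blast
    qed (use S1_step in blast)
    \<comment> \<open>The stable nodes are pairwise compatible, as sufficiently late members extend
      any two of them, and they have all lengths; so their union is an infinite branch.\<close>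
    define g where "g = {z. \<exists>\<sigma>. \<sigma> \<in> S1 \<and> z \<in> elems \<sigma>}"
    have gS: "g \<in> \<S>" unfolding g_def by (intro Sigma_comp D0_intros tm_intros S1S D0_elems)
    have S1B: "\<sigma> \<in> S1 \<Longrightarrow> \<sigma> \<in> B" for \<sigma> unfolding S1_def by blast
    have "function_on g UNIV UNIV"
    proof (rule function_onI)
      show "\<exists>i a. z = pair i a" if z: "z \<in> g" for z
      proof -
        obtain \<sigma> where "\<sigma> \<in> S1" "z \<in> elems \<sigma>" using z unfolding g_def by blast
        then show ?thesis using seqB[OF S1B] seq_pair by blast
      qed
      show "\<exists>a. pair i a \<in> g" for i
      proof -
        obtain \<sigma> where \<sigma>: "\<sigma> \<in> S1" "seq \<sigma> (i \<oplus> \<one>)" using S1_ex by blast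
        then show ?thesis using seq_total[OF \<sigma>(2), of i] unfolding g_def by auto
      qed
      show "a = b" if ab: "pair i a \<in> g" "pair i b \<in> g" for i a b
      proof -
        obtain \<sigma> \<sigma>' where s: "\<sigma> \<in> S1" "pair i a \<in> elems \<sigma>" "\<sigma>' \<in> S1" "pair i b \<in> elems \<sigma>'"
          using ab unfolding g_def by blast
        obtain \<tau> where \<tau>: "\<tau> \<in> B" "elems \<sigma> \<subseteq> elems \<tau>" "elems \<sigma>' \<subseteq> elems \<tau>" using compat[OF s(1,3)] by blast
        obtain l where "seq \<tau> l" using seqB[OF \<tau>(1)] by blast
        then show ?thesis using seq_fun s \<tau> by blast
      qed
    qed simp
    moreover have "\<exists>\<sigma>\<in>B. seq \<sigma> n \<and> elems \<sigma> \<subseteq> g" for n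
    proof -
      obtain \<sigma> where \<sigma>: "\<sigma> \<in> S1" "seq \<sigma> n" using S1_ex by blast
      then have "elems \<sigma> \<subseteq> g" unfolding g_def by blast
      then show ?thesis using \<sigma> S1B by blast
    qed
    ultimately show False using B(2) gS unfolding wf_tree_def by metis
  qed
  then show ?thesis
    unfolding WO_def field_kb_order less_in_kb_order using LO_kb_order[OF tB] by (intro conjI notI) (assumption, elim bexE conjE, metis)
qed

end

end

section \<open>Evaluation maps from transfinite recursion\<close>

definition pair_term :: "trm \<Rightarrow> trm \<Rightarrow> trm" where
  "pair_term t u = Plus (Times (Plus t u) (Plus t u)) t"

text \<open>Number variable 0 is the argument of the operator, set variable 0 its set argument. The value 0
  always belongs to the result, so that the set argument determines the current node as the one
  whose predecessors are the \<open>i\<close> with \<open>(0, i)\<close> in it; the value 1 belongs to the result if this node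
  evaluates to true. The set variables 1 to 6 are the field and the strict order, the true leaves,
  the unions, the intersections, and the child relation.\<close>

definition eval_step :: fm where
  "eval_step = Disj (Eq (Var 0) Zero) (Conj (Eq (Var 0) One) (ExN 1 (Conj (Mem (Var 1) 1) (Conj
     (AllN 2 (Conj (Imp (Mem (pair_term (Var 2) (Var 1)) 2) (Mem (pair_term Zero (Var 2)) 0))
                   (Imp (Mem (pair_term Zero (Var 2)) 0) (Mem (pair_term (Var 2) (Var 1)) 2))))
     (Disj (Mem (Var 1) 3) (Disj
       (Conj (Mem (Var 1) 4)
         (ExN 2 (Conj (Mem (pair_term (Var 1) (Var 2)) 6) (Mem (pair_term One (Var 2)) 0))))
       (Conj (Mem (Var 1) 5)
         (AllN 2 (Imp (Mem (pair_term (Var 1) (Var 2)) 6) (Mem (pair_term One (Var 2)) 0))))))))))"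

context rca0
begin

lemma tval_pair_term [simp]: "tval e (pair_term t u) = pair (tval e t) (tval e u)"
  unfolding pair_term_def pair_def by simp

text \<open>The point is the map that sends \<open>n\<close> to the minimum of \<open>n\<close> and
  \<open>k - 1\<close>; the least number sent to \<open>i\<close> is \<open>i\<close>
  itself.\<close>

lemma ex_partition:
  assumes "k \<ge> 1"
  shows "partitions k \<noteq> {}"
proof -
  obtain k' where k: "k = Suc k'" using assms by (cases k) auto
  define x where "x = {z. \<exists>n i. z = pair n i \<and> (if n \<prec> num k' then i = n else i = num k')}"
  have "x \<in> \<S>" unfolding x_def by (intro D0_comp D0_ex_pair D0_If D0_eq D0_less tm_intros)
  have x: "pair n i \<in> x \<longleftrightarrow> (if n \<prec> num k' then i = n else i = num k')" for n i
    unfolding x_def by simp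
  have "function_on x UNIV {i. i \<prec> num k}"
  proof (rule function_onI)
    show "z \<in> x \<Longrightarrow> \<exists>i a. z = pair i a" for z unfolding x_def by blast
    show "pair i a \<in> x \<Longrightarrow> a \<in> {i. i \<prec> num k}" for i a
      unfolding x k by (auto simp: N.less_imp_le split: if_splits)
    show "\<exists>a. pair i a \<in> x" for i unfolding x by auto
    show "pair i a \<in> x \<Longrightarrow> pair i b \<in> x \<Longrightarrow> a = b" for i a b unfolding x by (auto split: if_splits)
  qed
  moreover have least: "least {n. pair n i \<in> x} i" if "i \<prec> num k" for i
  proof -
    have "i \<preceq> num k'" using that unfolding k by simp
    then have "pair i i \<in> x" unfolding x le_def by auto
    moreover have "pair n i \<notin> x" if "n \<prec> i" for n
      using that N.less_le_trans[OF that \<open>i \<preceq> num k'\<close>] irrefl unfolding x by auto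
    ultimately show ?thesis unfolding least_def by simp
  qed
  moreover have "j \<prec> num k \<Longrightarrow> i \<prec> j \<Longrightarrow> i \<prec> num k" for i j using N.less_trans by blast
  ultimately have "ordered_surjection k UNIV x"
    unfolding ordered_surjection_def least_def by blast
  then show ?thesis unfolding partitions_def using \<open>x \<in> \<S>\<close> by blast
qed

text \<open>A bounded form of being obtained by appending some entry. It suffices that the length
  grows by one and the graph is extended, since the entry at the new position is then
  determined.\<close>

definition child :: "'a \<Rightarrow> 'a \<Rightarrow> bool" where
  "child \<sigma> \<tau> \<longleftrightarrow> (\<exists>l. l \<preceq> \<sigma> \<and> (seq \<sigma> l \<and> seq \<tau> (l \<oplus> \<one>) \<and> (\<forall>z. z \<prec> \<sigma> \<longrightarrow> z \<in> elems \<sigma> \<longrightarrow> z \<in> elems \<tau>)))"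

lemma D0_child: "tm t \<Longrightarrow> tm u \<Longrightarrow> D0 (\<lambda>e. child (t e) (u e))"
proof (rule D0_subst2[of child])
  show "D0 (\<lambda>e. child (e 0) (e 1))"
    unfolding child_def by (intro D0_intros D0_ex_le tm_intros D0_elems D0_seq)
qed

lemma child_iff: "child \<sigma> \<tau> \<longleftrightarrow> (\<exists>n. append_entry \<sigma> n \<tau>)"
proof
  assume "child \<sigma> \<tau>"
  then obtain l where l: "seq \<sigma> l" "seq \<tau> (l \<oplus> \<one>)" and sub: "elems \<sigma> \<subseteq> elems \<tau>"
    unfolding child_def using elems_less by blast
  obtain n where n: "pair l n \<in> elems \<tau>" using seq_total[OF l(2), of l] by auto
  have "z \<in> insert (pair l n) (elems \<sigma>)" if z: "z \<in> elems \<tau>" for z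
  proof -
    obtain i a where ia: "i \<prec> l \<oplus> \<one>" "z = pair i a" using seq_pair[OF l(2) z] by blast
    show ?thesis
    proof (cases "i = l")
      case True
      then show ?thesis using ia n z seq_fun[OF l(2)] by blast
    next
      case False
      then have "i \<prec> l" using ia(1) by (simp add: le_def)
      then obtain b where "pair i b \<in> elems \<sigma>" using seq_total[OF l(1)] by blast
      then show ?thesis using ia z sub seq_fun[OF l(2)] by blast
    qed
  qed
  then have "elems \<tau> = insert (pair l n) (elems \<sigma>)" using n sub by blast
  then show "\<exists>n. append_entry \<sigma> n \<tau>" unfolding append_entry_iff[OF l(1)] using l(2) by blast
next
  assume "\<exists>n. append_entry \<sigma> n \<tau>"
  then obtain n l where "seq \<sigma> l" "seq \<tau> (l \<oplus> \<one>)" "elems \<tau> = insert (pair l n) (elems \<sigma>)"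
    unfolding append_entry_def by blast
  then show "child \<sigma> \<tau>" unfolding child_def using seq_length_le by blast
qed

lemma interior_labels: "lab_union \<notin> clopen_labels k" "lab_inter \<notin> clopen_labels k"
  unfolding clopen_labels_def lab_empty_def lab_full_def lab_union_def lab_inter_def lab_cyl_def lab_cocyl_def
  using num_inject by (auto simp del: num.simps)

text \<open>A bounded form of \<open>in_clopen\<close> for clopen labels and a fixed point
  \<open>x\<close>; 2 and 3 are the tags of \<open>lab_cyl\<close> and
  \<open>lab_cocyl\<close>.\<close>

definition holds_at :: "'a set \<Rightarrow> 'a \<Rightarrow> bool" where
  "holds_at x q \<longleftrightarrow> q = lab_full \<or> (\<exists>a b. q = pair a b \<and>
     (a = num 2 \<and> (\<forall>z. z \<prec> b \<longrightarrow> z \<in> elems b \<longrightarrow> z \<in> x) \<or>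
      a = num 3 \<and> \<not> (\<forall>z. z \<prec> b \<longrightarrow> z \<in> elems b \<longrightarrow> z \<in> x)))"

lemma D0_holds_at: "x \<in> \<S> \<Longrightarrow> tm t \<Longrightarrow> D0 (\<lambda>e. holds_at x (t e))"
proof (rule D0_subst1[of "holds_at x"])
  assume "x \<in> \<S>"
  then show "D0 (\<lambda>e. holds_at x (e 0))"
    unfolding holds_at_def by (intro D0_ex_pair D0_intros tm_intros D0_elems)
qed

lemma in_clopen_iff:
  assumes x: "x \<in> partitions k" and q: "q \<in> clopen_labels k"
  shows "in_clopen k x q \<longleftrightarrow> holds_at x q"
proof -
  have sub: "(\<forall>z. z \<prec> b \<longrightarrow> z \<in> elems b \<longrightarrow> z \<in> x) \<longleftrightarrow> elems b \<subseteq> x" for b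
    using elems_less by blast
  have neq: "num 0 \<noteq> num 2" "num 0 \<noteq> num 3" "num 1 \<noteq> num 0" "num 1 \<noteq> num 2" "num 1 \<noteq> num 3" "num 2 \<noteq> num 3"
    unfolding num_inject by simp_all
  note neqs = neq neq[symmetric]
  consider "q = lab_empty" | "q = lab_full" | b where "q = lab_cyl b" "b \<in> finite_partitions k"
    | b where "q = lab_cocyl b" "b \<in> finite_partitions k"
    using q unfolding clopen_labels_def by blast
  then show ?thesis
    unfolding in_clopen_def holds_at_def sub cylinder_def lab_empty_def lab_full_def lab_cyl_def lab_cocyl_def
    using x neqs by cases (auto simp del: num.simps)
qed

lemma evaluation_map_exists:
  assumes atr: ATR0 and code: "borel_code k B \<phi>" and x: "x \<in> partitions k"
  shows "\<exists>f. evaluation_map k B \<phi> x f"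
proof -
  have ACA: arithmetical_comprehension and ATR: arithmetical_transfinite_recursion
    using atr unfolding ATR0_def ACA0_def by blast+
  have BS: "B \<in> \<S>" and \<phi>S: "\<phi> \<in> \<S>" and wf: "wf_tree B" and \<phi>f: "function_on \<phi> B UNIV"
    using code unfolding borel_code_def by blast+
  have lab: "if leaf B \<sigma> then q \<in> clopen_labels k else q \<in> {lab_union, lab_inter}"
    if "pair \<sigma> q \<in> \<phi>" "\<sigma> \<in> B" for \<sigma> q
    using code that unfolding borel_code_def by blast
  have lab_ex: "\<exists>q. pair \<sigma> q \<in> \<phi>" if "\<sigma> \<in> B" for \<sigma>
    using \<phi>f that unfolding function_on_def by blast
  have lab_fun: "q = q'" if "pair \<sigma> q \<in> \<phi>" "pair \<sigma> q' \<in> \<phi>" "\<sigma> \<in> B" for \<sigma> q q'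
    using \<phi>f that unfolding function_on_def by blast
  obtain \<rho> where \<rho>: "\<rho> \<in> B" "seq \<rho> \<zero>" using code unfolding borel_code_def root_def by blast
  have tB: "tree B" using wf unfolding wf_tree_def by blast
  have xS: "x \<in> \<S>" using x unfolding partitions_def by blast
  define X where "X = kb_order B"
  have XS: "X \<in> \<S>" unfolding X_def by (rule kb_order_in_sets[OF BS])
  have WO: "WO X" unfolding X_def by (rule WO_kb_order[OF ACA BS wf \<rho>])
  have less: "less_in X \<sigma> \<tau> \<longleftrightarrow> \<sigma> \<in> B \<and> \<tau> \<in> B \<and> kb \<sigma> \<tau>" for \<sigma> \<tau>
    unfolding X_def by (rule less_in_kb_order)
  have field: "field X = B" unfolding X_def by (rule field_kb_order)
  define Lt where "Lt = {z. \<exists>\<sigma> \<tau>. z = pair \<sigma> \<tau> \<and> less_in X \<sigma> \<tau>}"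
  define Ch where "Ch = {z. \<exists>\<sigma> \<tau>. z = pair \<sigma> \<tau> \<and> (\<tau> \<in> B \<and> child \<sigma> \<tau>)}"
  \<comment> \<open>Having no child is a Pi01 property, so this set exists by arithmetical
    comprehension.\<close>
  define Lf where "Lf = {\<sigma>. \<forall>\<tau>. \<sigma> \<in> B \<and> pair \<sigma> \<tau> \<notin> Ch}"
  define T where "T = {\<sigma>. \<exists>q. \<sigma> \<in> Lf \<and> pair \<sigma> q \<in> \<phi> \<and> holds_at x q}"
  define U where "U = {\<sigma>. pair \<sigma> lab_union \<in> \<phi>}"
  define I where "I = {\<sigma>. pair \<sigma> lab_inter \<in> \<phi>}"
  have LtS: "Lt \<in> \<S>" unfolding Lt_def by (intro D0_comp D0_ex_pair D0_less_in tm_intros XS)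
  have ChS: "Ch \<in> \<S>" unfolding Ch_def by (intro D0_comp D0_ex_pair D0_intros D0_child tm_intros BS)
  have LfS: "Lf \<in> \<S>" unfolding Lf_def by (intro Pi_comp[OF ACA] D0_intros tm_intros BS ChS)
  have TS: "T \<in> \<S>" unfolding T_def by (intro Sigma_comp[OF ACA] D0_intros D0_holds_at tm_intros LfS \<phi>S xS)
  have US: "U \<in> \<S>" and IS: "I \<in> \<S>" unfolding U_def I_def by (intro D0_comp D0_mem tm_intros \<phi>S)+
  have Lt: "pair \<sigma> \<tau> \<in> Lt \<longleftrightarrow> less_in X \<sigma> \<tau>" for \<sigma> \<tau> unfolding Lt_def by simp
  have Ch: "pair \<sigma> \<tau> \<in> Ch \<longleftrightarrow> \<tau> \<in> children B \<sigma>" for \<sigma> \<tau>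
    unfolding Ch_def children_def child_iff by simp
  have Lf: "\<sigma> \<in> Lf \<longleftrightarrow> leaf B \<sigma>" for \<sigma> unfolding Lf_def leaf_def Ch by auto
  define s :: "nat \<Rightarrow> 'a set" where "s = (\<lambda>_. {})(1 := B, 2 := Lt, 3 := T, 4 := U, 5 := I, 6 := Ch)"
  have "range s \<subseteq> \<S>" unfolding s_def using BS LtS TS US IS ChS empty_in_sets by auto
  moreover have "arithmetical eval_step" unfolding eval_step_def by simp
  ultimately obtain Y where YS: "Y \<in> \<S>"
    and Y: "iterates (\<lambda>n Z. sat ((\<lambda>_. \<zero>)(0 := n)) (s(0 := Z)) eval_step) X Y"
    using ATR XS WO unfolding arithmetical_transfinite_recursion_def by metis
  \<comment> \<open>The evaluation clause for a single node, where the numbers paired with 1 in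
    \<open>Z\<close> are the nodes already found true.\<close>
  define step where "step \<sigma> Z \<longleftrightarrow> \<sigma> \<in> T \<or> (\<sigma> \<in> U \<and> (\<exists>\<tau>\<in>children B \<sigma>. pair \<one> \<tau> \<in> Z)) \<or>
      (\<sigma> \<in> I \<and> (\<forall>\<tau>\<in>children B \<sigma>. pair \<one> \<tau> \<in> Z))" for \<sigma> Z
  have sat: "sat ((\<lambda>_. \<zero>)(0 := n)) (s(0 := Z)) eval_step \<longleftrightarrow>
      n = \<zero> \<or> n = \<one> \<and> (\<exists>\<sigma>\<in>B. (\<forall>i. less_in X i \<sigma> \<longleftrightarrow> pair \<zero> i \<in> Z) \<and> step \<sigma> Z)" for n Z
    unfolding eval_step_def s_def step_def by (auto simp: Lt Ch)
  have "Y = {z. \<exists>n j. z = pair n j \<and> j \<in> field X \<and> (n = \<zero> \<or> n = \<one> \<and>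
      (\<exists>\<sigma>\<in>B. (\<forall>i. less_in X i \<sigma> \<longleftrightarrow> pair \<zero> i \<in> below X Y j) \<and> step \<sigma> (below X Y j)))}"
    using Y unfolding iterates_def sat by blast
  then have Y_iff: "pair n j \<in> Y \<longleftrightarrow> j \<in> B \<and> (n = \<zero> \<or> n = \<one> \<and>
      (\<exists>\<sigma>\<in>B. (\<forall>i. less_in X i \<sigma> \<longleftrightarrow> pair \<zero> i \<in> below X Y j) \<and> step \<sigma> (below X Y j)))" for n j
    unfolding field by (subst (asm) set_eq_iff) (drule spec[of _ "pair n j"], simp)
  have Y0: "pair \<zero> j \<in> Y \<longleftrightarrow> j \<in> B" for j using Y_iff by simp
  have below: "pair n i \<in> below X Y j \<longleftrightarrow> less_in X i j \<and> pair n i \<in> Y" for n i j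
    unfolding below_def by auto
  have below0: "pair \<zero> i \<in> below X Y j \<longleftrightarrow> less_in X i j" for i j
    unfolding below Y0 less by blast
  \<comment> \<open>In an irreflexive total order an element is determined by its predecessors; this
    identifies the node found by \<open>eval_step\<close> with the current stage.\<close>
  have same: "\<sigma> = j" if j: "\<sigma> \<in> B" "j \<in> B" "\<And>i. less_in X i \<sigma> \<longleftrightarrow> less_in X i j" for \<sigma> j
  proof -
    obtain l l' where "seq \<sigma> l" "seq j l'" using tB j unfolding tree_def by blast
    then have "\<sigma> = j \<or> kb \<sigma> j \<or> kb j \<sigma>" by (rule kb_total)
    then show ?thesis using j kb_irrefl unfolding less by blast
  qed
  \<comment> \<open>All children of \<open>j\<close> precede it in the Kleene-Brouwer order, so
    restricting \<open>Y\<close> to the earlier stages loses none of the values that the clause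
    refers to.\<close>
  have "step j (below X Y j) \<longleftrightarrow> step j Y" if j: "j \<in> B" for j
  proof -
    obtain l where l: "seq j l" using tB j unfolding tree_def by blast
    have "less_in X \<tau> j" if "\<tau> \<in> children B j" for \<tau>
      using that j kb_append[OF l] unfolding less children_def by blast
    then show ?thesis unfolding step_def below by blast
  qed
  then have Y1: "pair \<one> j \<in> Y \<longleftrightarrow> step j Y" if "j \<in> B" for j
    unfolding Y_iff[of \<one>] below0 using that same by auto
  define f where "f = {z. \<exists>\<sigma> b. z = pair \<sigma> b \<and> (\<sigma> \<in> B \<and> (if pair \<one> \<sigma> \<in> Y then b = \<one> else b = \<zero>))}"
  have fS: "f \<in> \<S>" unfolding f_def by (intro D0_comp D0_ex_pair D0_conj D0_If D0_eq D0_mem tm_intros BS YS)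
  have f: "pair \<sigma> b \<in> f \<longleftrightarrow> \<sigma> \<in> B \<and> (if pair \<one> \<sigma> \<in> Y then b = \<one> else b = \<zero>)" for \<sigma> b
    unfolding f_def by simp
  have f1: "pair \<sigma> \<one> \<in> f \<longleftrightarrow> step \<sigma> Y" if "\<sigma> \<in> B" for \<sigma>
    unfolding f using that Y1 by auto
  have chB: "\<tau> \<in> children B \<sigma> \<Longrightarrow> \<tau> \<in> B" for \<sigma> \<tau> unfolding children_def by blast
  have f1': "pair \<tau> \<one> \<in> f \<longleftrightarrow> pair \<one> \<tau> \<in> Y" if "\<tau> \<in> B" for \<tau>
    unfolding f using that by auto
  have "evaluation_map k B \<phi> x f"
    unfolding evaluation_map_def
  proof (intro conjI ballI impI)
    show "f \<in> \<S>" by (rule fS)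
    show "function_on f B {\<zero>, \<one>}"
      unfolding function_on_def
    proof (intro conjI ballI)
      show "\<exists>i\<in>B. \<exists>j\<in>{\<zero>, \<one>}. z = pair i j" if "z \<in> f" for z
        using that unfolding f_def by (auto split: if_splits)
      show "\<exists>!b. pair \<sigma> b \<in> f" if "\<sigma> \<in> B" for \<sigma>
        unfolding f using that by auto
    qed
    fix \<sigma> assume \<sigma>: "\<sigma> \<in> B"
    show "pair \<sigma> \<one> \<in> f \<longleftrightarrow> (\<exists>q. pair \<sigma> q \<in> \<phi> \<and> in_clopen k x q)" if lf: "leaf B \<sigma>"
    proof -
      have q: "q \<in> clopen_labels k" if "pair \<sigma> q \<in> \<phi>" for q using lab[OF that \<sigma>] lf by simp
      have "\<sigma> \<notin> U" "\<sigma> \<notin> I" unfolding U_def I_def using q interior_labels by blast+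
      then have "step \<sigma> Y \<longleftrightarrow> \<sigma> \<in> T" unfolding step_def by blast
      also have "\<dots> \<longleftrightarrow> (\<exists>q. pair \<sigma> q \<in> \<phi> \<and> in_clopen k x q)"
        unfolding T_def Lf using lf q in_clopen_iff[OF x] by blast
      finally show ?thesis using f1[OF \<sigma>] by blast
    qed
    show "pair \<sigma> \<one> \<in> f \<longleftrightarrow> (\<exists>\<tau>\<in>children B \<sigma>. pair \<tau> \<one> \<in> f)" if u: "pair \<sigma> lab_union \<in> \<phi>"
    proof -
      have "\<not> leaf B \<sigma>" using lab[OF u \<sigma>] interior_labels by auto
      then have "\<sigma> \<notin> T" unfolding T_def Lf by blast
      moreover have "\<sigma> \<in> U" "\<sigma> \<notin> I"
        unfolding U_def I_def using u lab_fun[OF u _ \<sigma>, of lab_inter] lab_simps(3) by auto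
      ultimately have "step \<sigma> Y \<longleftrightarrow> (\<exists>\<tau>\<in>children B \<sigma>. pair \<one> \<tau> \<in> Y)" unfolding step_def by blast
      then show ?thesis using f1[OF \<sigma>] f1' chB by blast
    qed
    show "pair \<sigma> \<one> \<in> f \<longleftrightarrow> (\<forall>\<tau>\<in>children B \<sigma>. pair \<tau> \<one> \<in> f)" if i: "pair \<sigma> lab_inter \<in> \<phi>"
    proof -
      have "\<not> leaf B \<sigma>" using lab[OF i \<sigma>] interior_labels by auto
      then have "\<sigma> \<notin> T" unfolding T_def Lf by blast
      moreover have "\<sigma> \<in> I" "\<sigma> \<notin> U"
        unfolding U_def I_def using i lab_fun[OF i _ \<sigma>, of lab_union] lab_simps(3) by auto
      ultimately have "step \<sigma> Y \<longleftrightarrow> (\<forall>\<tau>\<in>children B \<sigma>. pair \<one> \<tau> \<in> Y)" unfolding step_def by blast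
      then show ?thesis using f1[OF \<sigma>] f1' chB by blast
    qed
  qed
  then show ?thesis by blast
qed

text \<open>Any point will do: it has an evaluation map, and the value of this map at the root is 0
  or 1.\<close>

lemma borel_evaluated:
  assumes ATR0 "k \<ge> 1" and code: "borel_code k B \<phi>"
  shows "\<exists>x\<in>partitions k. in_borel k x B \<phi> \<or> notin_borel k x B \<phi>"
proof -
  obtain x where x: "x \<in> partitions k" using ex_partition[OF assms(2)] by blast
  obtain f where f: "evaluation_map k B \<phi> x f" using evaluation_map_exists[OF assms(1) code x] by blast
  obtain \<rho> where \<rho>: "\<rho> \<in> B" "root \<rho>" using code unfolding borel_code_def by blast
  have "pair \<rho> \<zero> \<in> f \<or> pair \<rho> \<one> \<in> f"
    using f \<rho>(1) unfolding evaluation_map_def function_on_def by (metis insertE pair_inject singletonD)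
  then show ?thesis using x f \<rho> unfolding in_borel_def notin_borel_def by blast
qed

end

theorem theorem1p5:
  fixes M :: "'a l2" and k :: nat
  assumes "k \<ge> 2"
    and "l2_structure M"
    and "l2_structure.RCA0 M"
  shows "l2_structure.ATR0 M \<longleftrightarrow>
    (\<forall>B \<phi>. l2_structure.borel_code M k B \<phi> \<longrightarrow>
       (\<exists>x \<in> l2_structure.partitions M k.
          l2_structure.in_borel M k x B \<phi> \<or> l2_structure.notin_borel M k x B \<phi>))"
proof -
  interpret rca0 M using assms(2,3) by (simp add: rca0_def rca0_axioms_def)
  show ?thesis
  proof
    assume ATR0
    then show "\<forall>B \<phi>. borel_code k B \<phi> \<longrightarrow>
        (\<exists>x\<in>partitions k. in_borel k x B \<phi> \<or> notin_borel k x B \<phi>)"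
      using borel_evaluated[of k] assms(1) by simp
  next
    assume "\<forall>B \<phi>. borel_code k B \<phi> \<longrightarrow>
        (\<exists>x\<in>partitions k. in_borel k x B \<phi> \<or> notin_borel k x B \<phi>)"
    then have kernels_exist by (intro kernels_existI[of k]) blast
    then show ATR0 by (rule ATR_from_kernels)
  qed
qed

end
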